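(* Let $\mathsf C$ be a monoidal category with unit $I$ and with switching isomorphisms $s_{X,Y}\colon X\otimes Y\to Y\otimes X$. Then the trace pairing $\operatorname{tr}\colon\mathsf C^{tk}(X,Y)\times\mathsf C^{tk}(Y,X)\to\mathsf C(I,I)$ is functorial: if $F\colon\mathsf C\to\mathsf D$ is a (strong) monoidal functor between monoidal categories with switching isomorphisms which is compatible with the switching isomorphisms, then for $f\in\mathsf C^{tk}(X,Y)$, $g\in\mathsf C^{tk}(Y,X)$ the morphisms $F(f),F(g)$ are thick and $F(\operatorname{tr}(f,g))=\operatorname{tr}(F(f),F(g))$ under the identification $F(I)\cong I$. Moreover, it has the following properties: (1) $\operatorname{tr}(f,g)=\operatorname{tr}(g,f)$ for thick morphisms $f\in\mathsf C^{tk}(X,Y)$, $g\in\mathsf C^{tk}(Y,X)$. If $Y$ has the trace property then $\operatorname{tr}(f,g)=\operatorname{tr}(f\circ g)$, and symmetrically, if $X$ has the trace property then $\operatorname{tr}(f,g)=\operatorname{tr}(g\circ f)$. (2) If $\mathsf C$ is an additive category with distributive monoidal structure, then the trace pairing is a bilinear map. (3) $\operatorname{tr}(f_1\otimes f_2,g_1\otimes g_2)=\operatorname{tr}(f_1,g_1)\operatorname{tr}(f_2,g_2)$ for $f_i\in\mathsf C^{tk}(X_i,Y_i)$, $g_i\in\mathsf C^{tk}(Y_i,X_i)$ ($i=1,2$), provided $s$ gives $\mathsf C$ the structure of a symmetric monoidal category. More generally, this property holds if $\mathsf C$ is a balanced monoidal category with braiding $c$ and twist $\theta$ and $s_{X,Y}=(\mathrm{id}_Y\otimes\theta_X)\circ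 c_{X,Y}$.
   Context: Associators and unit constraints are suppressed. $\mathsf C(X,Y)$ is the set of morphisms. The product in $\mathsf C(I,I)$ is composition (equivalently, tensor product under $I\otimes I\cong I$). Thick and thickened morphisms. For objects $X,Y$ consider triples $(Z,t,b)$ with $Z\in\mathsf C$, $t\colon I\to Y\otimes Z$, $b\colon Z\otimes X\to I$. Let $\Psi(Z,t,b)\colon X\to Y$ be $X\cong I\otimes X\xrightarrow{t\otimes\mathrm{id}_X}Y\otimes Z\otimes X\xrightarrow{\mathrm{id}_Y\otimes b}Y\otimes I\cong Y$. A morphism is thick if it equals $\Psi(Z,t,b)$ for some triple; $\mathsf C^{tk}(X,Y)$ is the set of thick morphisms $X\to Y$. $\widehat{\mathsf C}(X,Y)$ is the collection of equivalence classes $[Z,t,b]$ under the equivalence relation generated by $(Z,t,b)\sim(Z',t',b')$ if there is $g\in\mathsf C(Z,Z')$ with $t'=(\mathrm{id}_Y\otimes g)\circ t$ and $b=b'\circ(g\otimes\mathrm{id}_X)$. $\Psi$ induces a map $\widehat{\mathsf C}(X,Y)\to\mathsf C(X,Y)$; $\widehat f$ is a thickener of $f$ if $\Psi(\widehat f)=f$. Compositions: for $\widehat f=[Z,t,b]\in\widehat{\mathsf C}(X,Y)$, set $\widehat f\circ g=[Z,t,b\circ(\mathrm{id}_Z\otimes g)]$ for $g\colon W\to X$, and $h\circ\widehat f=[Z,(h\otimes\mathrm{id}_Z)\circ t,b]$ for $h\colon Y\to W$. Switching isomorphisms: a family of isomorphisms $s_{X,Y}$ natural in $X$ and $Y$;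 no further axioms. Set $\widehat{\operatorname{tr}}([Z,t,b])=b\circ s_{X,Z}\circ t\in\mathsf C(I,I)$ for $[Z,t,b]\in\widehat{\mathsf C}(X,X)$. $X$ has the trace property if $\widehat{\operatorname{tr}}$ is constant on the fibers of $\Psi\colon\widehat{\mathsf C}(X,X)\to\mathsf C(X,X)$; then $\operatorname{tr}(f):=\widehat{\operatorname{tr}}(\widehat f)$ for thick $f\colon X\to X$ with any thickener $\widehat f$. The trace pairing is $\operatorname{tr}(f,g):=\widehat{\operatorname{tr}}(\widehat f\circ g)=\widehat{\operatorname{tr}}(f\circ\widehat g)$ for any thickeners $\widehat f$ of $f$, $\widehat g$ of $g$; it is independent of choices and needs no trace property. A strong monoidal functor $F$ with structure isomorphisms $\varphi_{X,Y}\colon F(X)\otimes F(Y)\to F(X\otimes Y)$ is compatible with switching isomorphisms if $F(s_{X,Y})\circ\varphi_{X,Y}=\varphi_{Y,X}\circ s_{F(X),F(Y)}$. A monoidal structure on an additive category is distributive if for all $X,Y$ the functors $Z\mapsto Z\otimes X$ and $Z\mapsto Y\otimes Z$ preserve (finite) coproducts, so canonically $(Z_1\otimes X)\oplus(Z_2\otimes X)\cong(Z_1\oplus Z_2)\otimes X$, $(Y\otimes Z_1)\oplus(Y\otimes Z_2)\cong Y\otimes(Z_1\oplus Z_2)$, $0\otimes X\cong0$, $Y\otimes0\cong0$. A balanced monoidal category is a braided monoidal category (braiding $c_{X,Y}\colon X\otimes Y\to Y\otimes X$ natural, with $c_{X,Y\otimes Z}=(\mathrm{id}_Y\otimes c_{X,Z})(c_{X,Y}\otimes\mathrm{id}_Z)$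 and $c_{X\otimes Y,Z}=(c_{X,Z}\otimes\mathrm{id}_Y)(\mathrm{id}_X\otimes c_{Y,Z})$) with a natural family of isomorphisms (twists) $\theta_X\colon X\to X$ such that $\theta_I=\mathrm{id}_I$ and $\theta_{X\otimes Y}=c_{Y,X}\circ(\theta_Y\otimes\theta_X)\circ c_{X,Y}$. A symmetric monoidal category is the case $\theta\equiv\mathrm{id}$. *)

theory Defs
  imports "HOL-Algebra.Group"
begin

section \<open>Categories\<close>

record ('o, 'm) cat =
  Obj :: "'o set"
  Arr :: "'m set"
  Dom :: "'m \<Rightarrow> 'o"
  Cod :: "'m \<Rightarrow> 'o"
  Id :: "'o \<Rightarrow> 'm"
  Comp :: "'m \<Rightarrow> 'm \<Rightarrow> 'm"  (infixl "\<cdot>\<index>" 65)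

definition Hom :: "('o, 'm, 'x) cat_scheme \<Rightarrow> 'o \<Rightarrow> 'o \<Rightarrow> 'm set"
  where "Hom C X Y = {f \<in> Arr C. Dom C f = X \<and> Cod C f = Y}"

locale category =
  fixes C :: "('o, 'm, 'x) cat_scheme" (structure)
  assumes Dom_in: "f \<in> Arr C \<Longrightarrow> Dom C f \<in> Obj C"
    and Cod_in: "f \<in> Arr C \<Longrightarrow> Cod C f \<in> Obj C"
    and Id_in: "X \<in> Obj C \<Longrightarrow> Id C X \<in> Hom C X X"
    and Comp_in: "\<lbrakk>f \<in> Hom C X Y; g \<in> Hom C Y Z\<rbrakk> \<Longrightarrow> g \<cdot> f \<in> Hom C X Z"
    and Comp_Id_right: "f \<in> Hom C X Y \<Longrightarrow> f \<cdot> Id C X = f"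
    and Comp_Id_left: "f \<in> Hom C X Y \<Longrightarrow> Id C Y \<cdot> f = f"
    and Comp_assoc: "\<lbrakk>f \<in> Hom C W X; g \<in> Hom C X Y; h \<in> Hom C Y Z\<rbrakk>
          \<Longrightarrow> (h \<cdot> g) \<cdot> f = h \<cdot> (g \<cdot> f)"

context
  fixes C :: "('o, 'm, 'x) cat_scheme" (structure)
begin

definition inverse_pair :: "'m \<Rightarrow> 'm \<Rightarrow> bool"
  where "inverse_pair f g \<longleftrightarrow> f \<in> Arr C \<and> g \<in> Hom C (Cod C f) (Dom C f) \<and>
           g \<cdot> f = Id C (Dom C f) \<and> f \<cdot> g = Id C (Cod C f)"

definition isomorphism :: "'m \<Rightarrow> bool"
  where "isomorphism f \<longleftrightarrow> (\<exists>g. inverse_pair f g)"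

definition inv_arr :: "'m \<Rightarrow> 'm"
  where "inv_arr f = (THE g. inverse_pair f g)"

definition initial :: "'o \<Rightarrow> bool"
  where "initial Z \<longleftrightarrow> Z \<in> Obj C \<and> (\<forall>X\<in>Obj C. \<exists>!f. f \<in> Hom C Z X)"

definition terminal :: "'o \<Rightarrow> bool"
  where "terminal Z \<longleftrightarrow> Z \<in> Obj C \<and> (\<forall>X\<in>Obj C. \<exists>!f. f \<in> Hom C X Z)"

definition coproduct :: "'o \<Rightarrow> 'o \<Rightarrow> 'o \<Rightarrow> 'm \<Rightarrow> 'm \<Rightarrow> bool"
  where "coproduct X1 X2 P i1 i2 \<longleftrightarrow>
           X1 \<in> Obj C \<and> X2 \<in> Obj C \<and> P \<in> Obj C \<and> i1 \<in> Hom C X1 P \<and> i2 \<in> Hom C X2 P \<and>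
           (\<forall>Y\<in>Obj C. \<forall>f1\<in>Hom C X1 Y. \<forall>f2\<in>Hom C X2 Y.
              \<exists>!h. h \<in> Hom C P Y \<and> h \<cdot> i1 = f1 \<and> h \<cdot> i2 = f2)"

end

text \<open>An additive category is a category enriched in abelian groups that has a zero object and
  binary biproducts. The enrichment is given by a (partial) addition of arrows
  and a zero arrow for every pair of objects.\<close>

definition hom_group ::
    "('o, 'm, 'x) cat_scheme \<Rightarrow> ('m \<Rightarrow> 'm \<Rightarrow> 'm) \<Rightarrow> ('o \<Rightarrow> 'o \<Rightarrow> 'm) \<Rightarrow> 'o \<Rightarrow> 'o \<Rightarrow> 'm monoid"
  where "hom_group C add_arr zero_arr X Y = \<lparr>carrier = Hom C X Y, mult = add_arr, one = zero_arr X Y\<rparr>"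

locale additive_category = category C for C :: "('o, 'm, 'x) cat_scheme" (structure) +
  fixes add_arr :: "'m \<Rightarrow> 'm \<Rightarrow> 'm" and zero_arr :: "'o \<Rightarrow> 'o \<Rightarrow> 'm"
  assumes hom_comm_group:
      "\<lbrakk>X \<in> Obj C; Y \<in> Obj C\<rbrakk> \<Longrightarrow> comm_group (hom_group C add_arr zero_arr X Y)"
    and Comp_plus_left: "\<lbrakk>f \<in> Hom C X Y; g \<in> Hom C Y Z; g' \<in> Hom C Y Z\<rbrakk>
          \<Longrightarrow> add_arr g g' \<cdot> f = add_arr (g \<cdot> f) (g' \<cdot> f)"
    and Comp_plus_right: "\<lbrakk>f \<in> Hom C X Y; f' \<in> Hom C X Y; g \<in> Hom C Y Z\<rbrakk>
          \<Longrightarrow> g \<cdot> add_arr f f' = add_arr (g \<cdot> f) (g \<cdot> f')"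
    and zero_object: "\<exists>Z. initial C Z \<and> terminal C Z"
    and biproducts: "\<lbrakk>X1 \<in> Obj C; X2 \<in> Obj C\<rbrakk> \<Longrightarrow>
          \<exists>P\<in>Obj C. \<exists>i1\<in>Hom C X1 P. \<exists>i2\<in>Hom C X2 P. \<exists>p1\<in>Hom C P X1. \<exists>p2\<in>Hom C P X2.
            p1 \<cdot> i1 = Id C X1 \<and> p2 \<cdot> i2 = Id C X2 \<and>
            p2 \<cdot> i1 = zero_arr X1 X2 \<and> p1 \<cdot> i2 = zero_arr X2 X1 \<and>
            add_arr (i1 \<cdot> p1) (i2 \<cdot> p2) = Id C P"


section \<open>Monoidal categories\<close>

text \<open>The associators \<open>Assoc X Y Z : (X \<otimes> Y) \<otimes> Z \<rightarrow> X \<otimes> (Y \<otimes> Z)\<close> and the unit constraints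
  \<open>LUnit X : I \<otimes> X \<rightarrow> X\<close>, \<open>RUnit X : X \<otimes> I \<rightarrow> X\<close> are explicit: monoidal categories
  need not be strict.\<close>

record ('o, 'm) moncat = "('o, 'm) cat" +
  TensO :: "'o \<Rightarrow> 'o \<Rightarrow> 'o"  (infixr "\<otimes>\<^sub>o\<index>" 70)
  TensA :: "'m \<Rightarrow> 'm \<Rightarrow> 'm"  (infixr "\<otimes>\<^sub>a\<index>" 70)
  UnitO :: 'o  ("\<I>\<index>")
  Assoc :: "'o \<Rightarrow> 'o \<Rightarrow> 'o \<Rightarrow> 'm"
  LUnit :: "'o \<Rightarrow> 'm"
  RUnit :: "'o \<Rightarrow> 'm"

locale monoidal_category = category C for C :: "('o, 'm, 'x) moncat_scheme" (structure) +
  assumes TensO_in: "\<lbrakk>X \<in> Obj C; Y \<in> Obj C\<rbrakk> \<Longrightarrow> X \<otimes>\<^sub>o Y \<in> Obj C"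
    and TensA_in: "\<lbrakk>f \<in> Hom C X X'; g \<in> Hom C Y Y'\<rbrakk>
          \<Longrightarrow> f \<otimes>\<^sub>a g \<in> Hom C (X \<otimes>\<^sub>o Y) (X' \<otimes>\<^sub>o Y')"
    and TensA_Id: "\<lbrakk>X \<in> Obj C; Y \<in> Obj C\<rbrakk> \<Longrightarrow> Id C X \<otimes>\<^sub>a Id C Y = Id C (X \<otimes>\<^sub>o Y)"
    and TensA_Comp: "\<lbrakk>f \<in> Hom C X X'; f' \<in> Hom C X' X''; g \<in> Hom C Y Y'; g' \<in> Hom C Y' Y''\<rbrakk>
          \<Longrightarrow> (f' \<cdot> f) \<otimes>\<^sub>a (g' \<cdot> g) = (f' \<otimes>\<^sub>a g') \<cdot> (f \<otimes>\<^sub>a g)"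
    and UnitO_in: "\<I> \<in> Obj C"
    and Assoc_in: "\<lbrakk>X \<in> Obj C; Y \<in> Obj C; Z \<in> Obj C\<rbrakk>
          \<Longrightarrow> Assoc C X Y Z \<in> Hom C ((X \<otimes>\<^sub>o Y) \<otimes>\<^sub>o Z) (X \<otimes>\<^sub>o (Y \<otimes>\<^sub>o Z))"
    and Assoc_iso: "\<lbrakk>X \<in> Obj C; Y \<in> Obj C; Z \<in> Obj C\<rbrakk> \<Longrightarrow> isomorphism C (Assoc C X Y Z)"
    and Assoc_natural: "\<lbrakk>f \<in> Hom C X X'; g \<in> Hom C Y Y'; h \<in> Hom C Z Z'\<rbrakk>
          \<Longrightarrow> Assoc C X' Y' Z' \<cdot> ((f \<otimes>\<^sub>a g) \<otimes>\<^sub>a h) = (f \<otimes>\<^sub>a (g \<otimes>\<^sub>a h)) \<cdot> Assoc C X Y Z"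
    and LUnit_in: "X \<in> Obj C \<Longrightarrow> LUnit C X \<in> Hom C (\<I> \<otimes>\<^sub>o X) X"
    and LUnit_iso: "X \<in> Obj C \<Longrightarrow> isomorphism C (LUnit C X)"
    and LUnit_natural: "f \<in> Hom C X Y \<Longrightarrow> LUnit C Y \<cdot> (Id C \<I> \<otimes>\<^sub>a f) = f \<cdot> LUnit C X"
    and RUnit_in: "X \<in> Obj C \<Longrightarrow> RUnit C X \<in> Hom C (X \<otimes>\<^sub>o \<I>) X"
    and RUnit_iso: "X \<in> Obj C \<Longrightarrow> isomorphism C (RUnit C X)"
    and RUnit_natural: "f \<in> Hom C X Y \<Longrightarrow> RUnit C Y \<cdot> (f \<otimes>\<^sub>a Id C \<I>) = f \<cdot> RUnit C X"
    and pentagon: "\<lbrakk>W \<in> Obj C; X \<in> Obj C; Y \<in> Obj C; Z \<in> Obj C\<rbrakk>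
          \<Longrightarrow> Assoc C W X (Y \<otimes>\<^sub>o Z) \<cdot> Assoc C (W \<otimes>\<^sub>o X) Y Z =
              (Id C W \<otimes>\<^sub>a Assoc C X Y Z) \<cdot> Assoc C W (X \<otimes>\<^sub>o Y) Z \<cdot> (Assoc C W X Y \<otimes>\<^sub>a Id C Z)"
    and triangle: "\<lbrakk>X \<in> Obj C; Y \<in> Obj C\<rbrakk>
          \<Longrightarrow> (Id C X \<otimes>\<^sub>a LUnit C Y) \<cdot> Assoc C X \<I> Y = RUnit C X \<otimes>\<^sub>a Id C Y"

definition distributive :: "('o, 'm, 'x) moncat_scheme \<Rightarrow> bool"
  where "distributive C \<longleftrightarrow> (\<forall>X\<in>Obj C.
     (\<forall>Z. initial C Z \<longrightarrow> initial C (Z \<otimes>\<^sub>o\<^bsub>C\<^esub> X) \<and> initial C (X \<otimes>\<^sub>o\<^bsub>C\<^esub> Z)) \<and>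
     (\<forall>Z1 Z2 P i1 i2. coproduct C Z1 Z2 P i1 i2 \<longrightarrow>
        coproduct C (Z1 \<otimes>\<^sub>o\<^bsub>C\<^esub> X) (Z2 \<otimes>\<^sub>o\<^bsub>C\<^esub> X) (P \<otimes>\<^sub>o\<^bsub>C\<^esub> X)
          (i1 \<otimes>\<^sub>a\<^bsub>C\<^esub> Id C X) (i2 \<otimes>\<^sub>a\<^bsub>C\<^esub> Id C X) \<and>
        coproduct C (X \<otimes>\<^sub>o\<^bsub>C\<^esub> Z1) (X \<otimes>\<^sub>o\<^bsub>C\<^esub> Z2) (X \<otimes>\<^sub>o\<^bsub>C\<^esub> P)
          (Id C X \<otimes>\<^sub>a\<^bsub>C\<^esub> i1) (Id C X \<otimes>\<^sub>a\<^bsub>C\<^esub> i2)))"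

locale switching = monoidal_category C for C :: "('o, 'm, 'x) moncat_scheme" (structure) +
  fixes s :: "'o \<Rightarrow> 'o \<Rightarrow> 'm"
  assumes switch_in: "\<lbrakk>X \<in> Obj C; Y \<in> Obj C\<rbrakk> \<Longrightarrow> s X Y \<in> Hom C (X \<otimes>\<^sub>o Y) (Y \<otimes>\<^sub>o X)"
    and switch_iso: "\<lbrakk>X \<in> Obj C; Y \<in> Obj C\<rbrakk> \<Longrightarrow> isomorphism C (s X Y)"
    and switch_natural: "\<lbrakk>f \<in> Hom C X X'; g \<in> Hom C Y Y'\<rbrakk>
          \<Longrightarrow> s X' Y' \<cdot> (f \<otimes>\<^sub>a g) = (g \<otimes>\<^sub>a f) \<cdot> s X Y"

text \<open>A braiding is a family of switching isomorphisms subject to the two hexagon identities.\<close>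

locale braided_monoidal_category = switching C c
  for C :: "('o, 'm, 'x) moncat_scheme" (structure) and c :: "'o \<Rightarrow> 'o \<Rightarrow> 'm" +
  assumes hexagon1: "\<lbrakk>X \<in> Obj C; Y \<in> Obj C; Z \<in> Obj C\<rbrakk>
          \<Longrightarrow> Assoc C Y Z X \<cdot> c X (Y \<otimes>\<^sub>o Z) \<cdot> Assoc C X Y Z =
              (Id C Y \<otimes>\<^sub>a c X Z) \<cdot> Assoc C Y X Z \<cdot> (c X Y \<otimes>\<^sub>a Id C Z)"
    and hexagon2: "\<lbrakk>X \<in> Obj C; Y \<in> Obj C; Z \<in> Obj C\<rbrakk>
          \<Longrightarrow> inv_arr C (Assoc C Z X Y) \<cdot> c (X \<otimes>\<^sub>o Y) Z \<cdot> inv_arr C (Assoc C X Y Z) =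
              (c X Z \<otimes>\<^sub>a Id C Y) \<cdot> inv_arr C (Assoc C X Z Y) \<cdot> (Id C X \<otimes>\<^sub>a c Y Z)"

locale balanced_monoidal_category = braided_monoidal_category C c
  for C :: "('o, 'm, 'x) moncat_scheme" (structure) and c :: "'o \<Rightarrow> 'o \<Rightarrow> 'm" +
  fixes \<theta> :: "'o \<Rightarrow> 'm"
  assumes twist_in: "X \<in> Obj C \<Longrightarrow> \<theta> X \<in> Hom C X X"
    and twist_iso: "X \<in> Obj C \<Longrightarrow> isomorphism C (\<theta> X)"
    and twist_natural: "f \<in> Hom C X Y \<Longrightarrow> \<theta> Y \<cdot> f = f \<cdot> \<theta> X"
    and twist_Unit: "\<theta> \<I> = Id C \<I>"
    and twist_Tens: "\<lbrakk>X \<in> Obj C; Y \<in> Obj C\<rbrakk>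
          \<Longrightarrow> \<theta> (X \<otimes>\<^sub>o Y) = c Y X \<cdot> (\<theta> Y \<otimes>\<^sub>a \<theta> X) \<cdot> c X Y"

text \<open>With trivial twists, the last axiom above reads \<open>c Y X \<cdot> c X Y = id\<close>.\<close>

definition symmetric_monoidal_category ::
    "('o, 'm, 'x) moncat_scheme \<Rightarrow> ('o \<Rightarrow> 'o \<Rightarrow> 'm) \<Rightarrow> bool"
  where "symmetric_monoidal_category C c \<longleftrightarrow> balanced_monoidal_category C c (Id C)"


section \<open>Strong monoidal functors\<close>

locale strong_monoidal_functor = C: monoidal_category C + D: monoidal_category D
  for C :: "('o, 'm, 'x) moncat_scheme" and D :: "('p, 'n, 'y) moncat_scheme" +
  fixes FO :: "'o \<Rightarrow> 'p" and FA :: "'m \<Rightarrow> 'n"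
    and \<phi> :: "'o \<Rightarrow> 'o \<Rightarrow> 'n" and \<phi>\<^sub>0 :: 'n
  assumes FO_in: "X \<in> Obj C \<Longrightarrow> FO X \<in> Obj D"
    and FA_in: "f \<in> Hom C X Y \<Longrightarrow> FA f \<in> Hom D (FO X) (FO Y)"
    and FA_Id: "X \<in> Obj C \<Longrightarrow> FA (Id C X) = Id D (FO X)"
    and FA_Comp: "\<lbrakk>f \<in> Hom C X Y; g \<in> Hom C Y Z\<rbrakk> \<Longrightarrow> FA (g \<cdot>\<^bsub>C\<^esub> f) = FA g \<cdot>\<^bsub>D\<^esub> FA f"
    and \<phi>_in: "\<lbrakk>X \<in> Obj C; Y \<in> Obj C\<rbrakk>
          \<Longrightarrow> \<phi> X Y \<in> Hom D (FO X \<otimes>\<^sub>o\<^bsub>D\<^esub> FO Y) (FO (X \<otimes>\<^sub>o\<^bsub>C\<^esub> Y))"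
    and \<phi>_iso: "\<lbrakk>X \<in> Obj C; Y \<in> Obj C\<rbrakk> \<Longrightarrow> isomorphism D (\<phi> X Y)"
    and \<phi>_natural: "\<lbrakk>f \<in> Hom C X X'; g \<in> Hom C Y Y'\<rbrakk>
          \<Longrightarrow> \<phi> X' Y' \<cdot>\<^bsub>D\<^esub> (FA f \<otimes>\<^sub>a\<^bsub>D\<^esub> FA g) = FA (f \<otimes>\<^sub>a\<^bsub>C\<^esub> g) \<cdot>\<^bsub>D\<^esub> \<phi> X Y"
    and \<phi>\<^sub>0_in: "\<phi>\<^sub>0 \<in> Hom D \<I>\<^bsub>D\<^esub> (FO \<I>\<^bsub>C\<^esub>)"
    and \<phi>\<^sub>0_iso: "isomorphism D \<phi>\<^sub>0"
    and \<phi>_Assoc: "\<lbrakk>X \<in> Obj C; Y \<in> Obj C; Z \<in> Obj C\<rbrakk>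
          \<Longrightarrow> FA (Assoc C X Y Z) \<cdot>\<^bsub>D\<^esub> \<phi> (X \<otimes>\<^sub>o\<^bsub>C\<^esub> Y) Z \<cdot>\<^bsub>D\<^esub> (\<phi> X Y \<otimes>\<^sub>a\<^bsub>D\<^esub> Id D (FO Z)) =
              \<phi> X (Y \<otimes>\<^sub>o\<^bsub>C\<^esub> Z) \<cdot>\<^bsub>D\<^esub> (Id D (FO X) \<otimes>\<^sub>a\<^bsub>D\<^esub> \<phi> Y Z) \<cdot>\<^bsub>D\<^esub> Assoc D (FO X) (FO Y) (FO Z)"
    and \<phi>_LUnit: "X \<in> Obj C
          \<Longrightarrow> FA (LUnit C X) \<cdot>\<^bsub>D\<^esub> \<phi> \<I>\<^bsub>C\<^esub> X \<cdot>\<^bsub>D\<^esub> (\<phi>\<^sub>0 \<otimes>\<^sub>a\<^bsub>D\<^esub> Id D (FO X)) = LUnit D (FO X)"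
    and \<phi>_RUnit: "X \<in> Obj C
          \<Longrightarrow> FA (RUnit C X) \<cdot>\<^bsub>D\<^esub> \<phi> X \<I>\<^bsub>C\<^esub> \<cdot>\<^bsub>D\<^esub> (Id D (FO X) \<otimes>\<^sub>a\<^bsub>D\<^esub> \<phi>\<^sub>0) = RUnit D (FO X)"

definition switching_compatible ::
    "('o, 'm, 'x) moncat_scheme \<Rightarrow> ('o \<Rightarrow> 'o \<Rightarrow> 'm) \<Rightarrow>
     ('p, 'n, 'y) moncat_scheme \<Rightarrow> ('p \<Rightarrow> 'p \<Rightarrow> 'n) \<Rightarrow>
     ('o \<Rightarrow> 'p) \<Rightarrow> ('m \<Rightarrow> 'n) \<Rightarrow> ('o \<Rightarrow> 'o \<Rightarrow> 'n) \<Rightarrow> bool"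
  where "switching_compatible C s D s' FO FA \<phi> \<longleftrightarrow>
    (\<forall>X\<in>Obj C. \<forall>Y\<in>Obj C.
       FA (s X Y) \<cdot>\<^bsub>D\<^esub> \<phi> X Y = \<phi> Y X \<cdot>\<^bsub>D\<^esub> s' (FO X) (FO Y))"


section \<open>Thick and thickened morphisms\<close>

context
  fixes C :: "('o, 'm, 'x) moncat_scheme" (structure)
begin

definition triples :: "'o \<Rightarrow> 'o \<Rightarrow> ('o \<times> 'm \<times> 'm) set"
  where "triples X Y =
    {(Z, t, b). Z \<in> Obj C \<and> t \<in> Hom C \<I> (Y \<otimes>\<^sub>o Z) \<and> b \<in> Hom C (Z \<otimes>\<^sub>o X) \<I>}"

fun \<Psi> :: "'o \<Rightarrow> 'o \<Rightarrow> 'o \<times> 'm \<times> 'm \<Rightarrow> 'm"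
  where "\<Psi> X Y (Z, t, b) =
    RUnit C Y \<cdot> (Id C Y \<otimes>\<^sub>a b) \<cdot> Assoc C Y Z X \<cdot> (t \<otimes>\<^sub>a Id C X) \<cdot> inv_arr C (LUnit C X)"

definition Thick :: "'o \<Rightarrow> 'o \<Rightarrow> 'm set"
  where "Thick X Y = \<Psi> X Y ` triples X Y"

fun triple_step :: "'o \<Rightarrow> 'o \<Rightarrow> 'o \<times> 'm \<times> 'm \<Rightarrow> 'o \<times> 'm \<times> 'm \<Rightarrow> bool"
  where "triple_step X Y (Z, t, b) (Z', t', b') \<longleftrightarrow>
    (Z, t, b) \<in> triples X Y \<and> (Z', t', b') \<in> triples X Y \<and>
    (\<exists>g\<in>Hom C Z Z'. t' = (Id C Y \<otimes>\<^sub>a g) \<cdot> t \<and> b = b' \<cdot> (g \<otimes>\<^sub>a Id C X))"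

definition triple_equiv :: "'o \<Rightarrow> 'o \<Rightarrow> (('o \<times> 'm \<times> 'm) \<times> ('o \<times> 'm \<times> 'm)) set"
  where "triple_equiv X Y =
    {(T, T'). T \<in> triples X Y \<and> T' \<in> triples X Y \<and> equivclp (triple_step X Y) T T'}"

definition Thickened :: "'o \<Rightarrow> 'o \<Rightarrow> ('o \<times> 'm \<times> 'm) set set"
  where "Thickened X Y = triples X Y // triple_equiv X Y"

text \<open>The map induced by \<open>\<Psi>\<close> on equivalence classes (\<open>\<Psi>\<close> is constant on each class).\<close>

definition \<Psi>_hat :: "'o \<Rightarrow> 'o \<Rightarrow> ('o \<times> 'm \<times> 'm) set \<Rightarrow> 'm"
  where "\<Psi>_hat X Y fh = the_elem (\<Psi> X Y ` fh)"

definition thickeners :: "'o \<Rightarrow> 'o \<Rightarrow> 'm \<Rightarrow> ('o \<times> 'm \<times> 'm) set set"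
  where "thickeners X Y f = {fh \<in> Thickened X Y. \<Psi>_hat X Y fh = f}"

text \<open>For \<open>fh\<close> a thickened morphism from \<open>X\<close> to \<open>Y\<close>: precomposition with \<open>g : W \<rightarrow> X\<close>
  and postcomposition with \<open>h : Y \<rightarrow> W\<close>, computed on representatives.\<close>

definition precomp :: "'o \<Rightarrow> 'o \<Rightarrow> ('o \<times> 'm \<times> 'm) set \<Rightarrow> 'm \<Rightarrow> ('o \<times> 'm \<times> 'm) set"
  where "precomp W Y fh g =
    (\<Union>(Z, t, b)\<in>fh. triple_equiv W Y `` {(Z, t, b \<cdot> (Id C Z \<otimes>\<^sub>a g))})"

definition postcomp :: "'o \<Rightarrow> 'o \<Rightarrow> 'm \<Rightarrow> ('o \<times> 'm \<times> 'm) set \<Rightarrow> ('o \<times> 'm \<times> 'm) set"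
  where "postcomp X W h fh =
    (\<Union>(Z, t, b)\<in>fh. triple_equiv X W `` {(Z, (h \<otimes>\<^sub>a Id C Z) \<cdot> t, b)})"


section \<open>Traces\<close>

context
  fixes s :: "'o \<Rightarrow> 'o \<Rightarrow> 'm"
begin

definition tr_hat :: "'o \<Rightarrow> ('o \<times> 'm \<times> 'm) set \<Rightarrow> 'm"
  where "tr_hat X fh = the_elem ((\<lambda>(Z, t, b). b \<cdot> s X Z \<cdot> t) ` fh)"

definition trace_property :: "'o \<Rightarrow> bool"
  where "trace_property X \<longleftrightarrow>
    (\<forall>fh\<in>Thickened X X. \<forall>gh\<in>Thickened X X.
       \<Psi>_hat X X fh = \<Psi>_hat X X gh \<longrightarrow> tr_hat X fh = tr_hat X gh)"

text \<open>The common value of \<open>tr_hat\<close> on all thickeners; meaningful when \<open>X\<close> has the trace property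
  and \<open>f : X \<rightarrow> X\<close> is thick.\<close>

definition trace :: "'o \<Rightarrow> 'm \<Rightarrow> 'm"
  where "trace X f = (THE v. \<forall>fh\<in>thickeners X X f. v = tr_hat X fh)"

definition trace_pairing :: "'o \<Rightarrow> 'o \<Rightarrow> 'm \<Rightarrow> 'm \<Rightarrow> 'm"
  where "trace_pairing X Y f g =
    (THE v. (\<forall>fh\<in>thickeners X Y f. v = tr_hat Y (precomp Y Y fh g)) \<and>
            (\<forall>gh\<in>thickeners Y X g. v = tr_hat Y (postcomp Y Y f gh)))"

end

end

end

theory Submission
  imports Defs
begin

text \<open>
The pairing is computed from representatives. If \<open>f\<close> is represented by \<open>(Z, t, b)\<close>, it is
\<open>b \<cdot> (Z \<triangleright> g) \<cdot> s Y Z \<cdot> t\<close>, and everything is a consequence of string-diagram manipulations with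
the cup \<open>t\<close> and the cap \<open>b\<close>. The categories are not strict, so the diagrams have to be drawn without
associators getting in the way. The device is a Cayley representation: an object \<open>X\<close> acts on \<open>C\<close>
by \<open>V \<mapsto> X \<otimes> V\<close>, and a cup \<open>t : \<I> \<rightarrow> Y \<otimes> Z\<close>, a cap \<open>b : Z \<otimes> X \<rightarrow> \<I>\<close>, a switching isomorphism and a
scalar become families
\<open>V \<rightarrow> Y \<otimes> (Z \<otimes> V)\<close>, \<open>Z \<otimes> (X \<otimes> V) \<rightarrow> V\<close>, \<open>X \<otimes> (Y \<otimes> V) \<rightarrow> Y \<otimes> (X \<otimes> V)\<close> and \<open>V \<rightarrow> V\<close>, natural in \<open>V\<close>
(\<open>cup\<close>, \<open>cap\<close>, \<open>sw\<close>, \<open>scal\<close>). All objects that occur are then bracketed to the right,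
the interchange law is naturality in \<open>V\<close>, and coherence isomorphisms enter only where
a formula is translated into families. Tensoring with \<open>\<I>\<close> is faithful, so nothing is lost
(\<open>scal_inject\<close>, \<open>rwhisker_Unit_faithful\<close>).

\<^item> Independence of choices (\<open>trace_exchange\<close>): given \<open>(Z, t, b)\<close> for \<open>f\<close> and \<open>(W, u, c)\<close> for \<open>g\<close>, bend \<open>t\<close>
  with \<open>c\<close> into \<open>h : W \<rightarrow> Z\<close>. Then \<open>g\<close> applied to \<open>t\<close> equals \<open>h\<close> applied to \<open>u\<close>, and \<open>b\<close>
  precomposed with \<open>h\<close> equals \<open>c\<close> precomposed with \<open>f\<close>. Naturality of \<open>s\<close> lets \<open>h\<close> and \<open>f\<close> pass
  through \<open>s\<close>, which identifies the value computed from \<open>f\<close>'s representative with the one computed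
  from \<open>g\<close>'s. Hence it depends on \<open>f\<close> and \<open>g\<close> only (\<open>trace_pairing_eq\<close>). Symmetry and the
  comparison with the trace follow.
\<^item> Functoriality (\<open>F_trace_pairing\<close>): conjugating \<open>F t\<close> and \<open>F b\<close> by the structure isomorphisms gives a
  representative of \<open>F f\<close> (\<open>F_\<Psi>\<close>).
\<^item> Bilinearity (\<open>trace_pairing_bilinear\<close>): a functor preserving the initial object and binary
  coproducts is additive, so tensoring is additive, and \<open>b \<cdot> (Z \<triangleright> g) \<cdot> s Y Z \<cdot> t\<close> is additive in \<open>g\<close>;
  symmetry gives additivity in \<open>f\<close>. Thick morphisms are closed under sums because two representatives
  can be moved to the coproduct of their middle objects (\<open>Thick_add\<close>).
\<^item> Multiplicativity (\<open>trace_pairing_tensor\<close>): \<open>f\<^sub>1 \<otimes> f\<^sub>2\<close> is represented by the nested cup and cap with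
  middle object \<open>Z\<^sub>2 \<otimes> Z\<^sub>1\<close>, for which no braiding is needed (\<open>\<Psi>_tensor\<close>). In its trace, the
  hexagons split the braidings of tensor products, the Yang-Baxter equation and naturality
  pull the first loop through the strands of the second, and the double braiding coming from the
  twist of a tensor product is absorbed on the way (\<open>twisted_trace_tensor\<close>).
\<close>

section \<open>Inverses and cancellation in a category\<close>

lemma HomD:
  assumes "f \<in> Hom C X Y"
  shows "f \<in> Arr C" "Dom C f = X" "Cod C f = Y"
  using assms by (auto simp: Hom_def)

context category
begin

lemma Hom_iff: "f \<in> Hom C X Y \<longleftrightarrow> f \<in> Arr C \<and> Dom C f = X \<and> Cod C f = Y"
  by (simp add: Hom_def)

lemma Comp_arr [simp]:
  assumes "f \<in> Arr C" "g \<in> Arr C" "Cod C f = Dom C g"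
  shows "g \<cdot> f \<in> Arr C" "Dom C (g \<cdot> f) = Dom C f" "Cod C (g \<cdot> f) = Cod C g"
  using Comp_in[of f "Dom C f" "Dom C g" g "Cod C g"] assms by (auto simp: Hom_def)

lemma Id_arr [simp]:
  assumes "X \<in> Obj C"
  shows "Id C X \<in> Arr C" "Dom C (Id C X) = X" "Cod C (Id C X) = X"
  using Id_in[OF assms] by (auto simp: Hom_def)

lemma Dom_Cod_obj [simp]:
  assumes "f \<in> Arr C"
  shows "Dom C f \<in> Obj C" "Cod C f \<in> Obj C"
  using Dom_in Cod_in assms by auto

lemma Hom_obj:
  assumes "f \<in> Hom C X Y"
  shows "X \<in> Obj C" "Y \<in> Obj C"
  using assms Dom_in Cod_in by (auto simp: Hom_def)

lemma Comp_Id [simp]: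
  assumes "f \<in> Arr C"
  shows "X = Dom C f \<Longrightarrow> f \<cdot> Id C X = f" "Y = Cod C f \<Longrightarrow> Id C Y \<cdot> f = f"
  using assms Comp_Id_right[of f "Dom C f" "Cod C f"] Comp_Id_left[of f "Dom C f" "Cod C f"]
  by (auto simp: Hom_def)

lemma assoc [simp]:
  assumes "f \<in> Arr C" "g \<in> Arr C" "h \<in> Arr C" "Cod C f = Dom C g" "Cod C g = Dom C h"
  shows "(h \<cdot> g) \<cdot> f = h \<cdot> (g \<cdot> f)"
  using Comp_assoc[of f "Dom C f" "Dom C g" g "Dom C h" h "Cod C h"] assms by (auto simp: Hom_def)

text \<open>An equation between composites, put into the form in which it rewrites inside a longer
composite bracketed to the right.\<close>

lemma Comp_extend:
  assumes "g \<cdot> f = k" "f \<in> Arr C" "g \<in> Arr C" "q \<in> Arr C" "Cod C f = Dom C g" "Cod C q = Dom C f"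
  shows "g \<cdot> (f \<cdot> q) = k \<cdot> q"
  using assms assoc by metis

lemma inverse_pair_unique:
  assumes "inverse_pair C f g" "inverse_pair C f h"
  shows "g = h"
proof -
  have "g = g \<cdot> (f \<cdot> h)" "(g \<cdot> f) \<cdot> h = h"
    using assms by (auto simp: inverse_pair_def Hom_def)
  moreover have "(g \<cdot> f) \<cdot> h = g \<cdot> (f \<cdot> h)"
    using assms by (intro assoc) (auto simp: inverse_pair_def Hom_def)
  ultimately show ?thesis by simp
qed

lemma inverse_pair_inv_arr:
  assumes "isomorphism C f"
  shows "inverse_pair C f (inv_arr C f)"
  unfolding inv_arr_def
  using assms inverse_pair_unique by (metis (no_types, lifting) isomorphism_def theI)

lemma inv_arr:
  assumes "isomorphism C f"
  shows "f \<in> Arr C" "inv_arr C f \<in> Arr C" "Dom C (inv_arr C f) = Cod C f"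
    "Cod C (inv_arr C f) = Dom C f"
    "inv_arr C f \<cdot> f = Id C (Dom C f)" "f \<cdot> inv_arr C f = Id C (Cod C f)"
  using inverse_pair_inv_arr[OF assms] by (auto simp: inverse_pair_def Hom_def)

lemma inv_arr_cancel:
  assumes "isomorphism C f" "q \<in> Arr C"
  shows "Cod C q = Dom C f \<Longrightarrow> inv_arr C f \<cdot> (f \<cdot> q) = q"
    "Cod C q = Cod C f \<Longrightarrow> f \<cdot> (inv_arr C f \<cdot> q) = q"
  using assms inv_arr[OF assms(1)] by (simp_all add: assoc[symmetric] del: assoc)

lemma iso_left_cancel:
  assumes "isomorphism C f" "f \<cdot> g = f \<cdot> h" "g \<in> Arr C" "h \<in> Arr C"
    "Cod C g = Dom C f" "Cod C h = Dom C f"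
  shows "g = h"
  using assms inv_arr_cancel(1) by metis

lemma iso_right_cancel:
  assumes "isomorphism C f" "g \<cdot> f = h \<cdot> f" "g \<in> Arr C" "h \<in> Arr C"
    "Dom C g = Cod C f" "Dom C h = Cod C f"
  shows "g = h"
proof -
  have "g = (g \<cdot> f) \<cdot> inv_arr C f" "h = (h \<cdot> f) \<cdot> inv_arr C f"
    using assms(1,3-6) inv_arr[OF assms(1)] by simp_all
  then show ?thesis
    using assms(2) by simp
qed

lemma iso_Comp:
  assumes "isomorphism C f" "isomorphism C g" "Cod C f = Dom C g"
  shows "isomorphism C (g \<cdot> f)"
  unfolding isomorphism_def inverse_pair_def
  by (rule exI[of _ "inv_arr C f \<cdot> inv_arr C g"])
     (use assms inv_arr[OF assms(1)] inv_arr[OF assms(2)] inv_arr_cancel[OF assms(1)]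
       inv_arr_cancel[OF assms(2)] in \<open>simp add: Hom_iff\<close>)

lemma iso_inv_arr:
  assumes "isomorphism C f"
  shows "isomorphism C (inv_arr C f)"
  unfolding isomorphism_def inverse_pair_def
  by (rule exI[of _ f]) (use inv_arr[OF assms] in \<open>simp add: Hom_iff\<close>)

end

section \<open>Whiskering and coherence in a monoidal category\<close>

abbreviation (in monoidal_category) lwhisker (infixr "\<triangleright>" 72)
  where "X \<triangleright> f \<equiv> Id C X \<otimes>\<^sub>a f"

abbreviation (in monoidal_category) rwhisker (infixl "\<triangleleft>" 71)
  where "f \<triangleleft> X \<equiv> f \<otimes>\<^sub>a Id C X"

context monoidal_category
begin

lemma Tens_obj [simp]: "X \<in> Obj C \<Longrightarrow> Y \<in> Obj C \<Longrightarrow> X \<otimes>\<^sub>o Y \<in> Obj C" "\<I> \<in> Obj C"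
  using TensO_in UnitO_in by auto

lemma Tens_arr [simp]:
  assumes "f \<in> Arr C" "g \<in> Arr C"
  shows "f \<otimes>\<^sub>a g \<in> Arr C" "Dom C (f \<otimes>\<^sub>a g) = Dom C f \<otimes>\<^sub>o Dom C g"
    "Cod C (f \<otimes>\<^sub>a g) = Cod C f \<otimes>\<^sub>o Cod C g"
  using TensA_in[of f "Dom C f" "Cod C f" g "Dom C g" "Cod C g"] assms by (auto simp: Hom_def)

lemma Tens_Id [simp]: "X \<in> Obj C \<Longrightarrow> Y \<in> Obj C \<Longrightarrow> X \<triangleright> Id C Y = Id C (X \<otimes>\<^sub>o Y)"
  by (rule TensA_Id)

lemma Tens_Comp:
  assumes "f \<in> Arr C" "f' \<in> Arr C" "g \<in> Arr C" "g' \<in> Arr C" "Cod C f = Dom C f'" "Cod C g = Dom C g'"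
  shows "(f' \<otimes>\<^sub>a g') \<cdot> (f \<otimes>\<^sub>a g) = (f' \<cdot> f) \<otimes>\<^sub>a (g' \<cdot> g)"
  using TensA_Comp[of f "Dom C f" "Dom C f'" f' "Cod C f'" g "Dom C g" "Dom C g'" g' "Cod C g'"] assms
  by (auto simp: Hom_def)

lemma Tens_Comp_extend:
  assumes "f \<in> Arr C" "f' \<in> Arr C" "g \<in> Arr C" "g' \<in> Arr C" "Cod C f = Dom C f'" "Cod C g = Dom C g'"
    "q \<in> Arr C" "Cod C q = Dom C f \<otimes>\<^sub>o Dom C g"
  shows "(f' \<otimes>\<^sub>a g') \<cdot> ((f \<otimes>\<^sub>a g) \<cdot> q) = ((f' \<cdot> f) \<otimes>\<^sub>a (g' \<cdot> g)) \<cdot> q"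
  using assms by (intro Comp_extend[OF Tens_Comp]) auto

lemma lwhisker_Comp:
  assumes "X \<in> Obj C" "f \<in> Arr C" "g \<in> Arr C" "Cod C f = Dom C g"
  shows "X \<triangleright> (g \<cdot> f) = (X \<triangleright> g) \<cdot> (X \<triangleright> f)"
  using assms by (simp add: Tens_Comp)

lemma rwhisker_Comp:
  assumes "X \<in> Obj C" "f \<in> Arr C" "g \<in> Arr C" "Cod C f = Dom C g"
  shows "(g \<cdot> f) \<triangleleft> X = (g \<triangleleft> X) \<cdot> (f \<triangleleft> X)"
  using assms by (simp add: Tens_Comp)

lemmas whisker = lwhisker_Comp rwhisker_Comp

lemma iso_Tens:
  assumes "isomorphism C f" "isomorphism C g"
  shows "isomorphism C (f \<otimes>\<^sub>a g)"
  unfolding isomorphism_def inverse_pair_def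
  by (rule exI[of _ "inv_arr C f \<otimes>\<^sub>a inv_arr C g"])
     (use inv_arr[OF assms(1)] inv_arr[OF assms(2)] in \<open>simp add: Hom_iff Tens_Comp\<close>)

lemma iso_Id: "X \<in> Obj C \<Longrightarrow> isomorphism C (Id C X)"
  unfolding isomorphism_def inverse_pair_def
  by (rule exI[of _ "Id C X"]) (simp add: Hom_iff)

abbreviation "\<alpha> \<equiv> Assoc C"
abbreviation "\<alpha>i X Y Z \<equiv> inv_arr C (Assoc C X Y Z)"
abbreviation "lu \<equiv> LUnit C"
abbreviation "lui X \<equiv> inv_arr C (LUnit C X)"
abbreviation "\<rho> \<equiv> RUnit C"
abbreviation "\<rho>i X \<equiv> inv_arr C (RUnit C X)"

lemma structure_arr [simp]:
  assumes "X \<in> Obj C"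
  shows "lu X \<in> Arr C" "Dom C (lu X) = \<I> \<otimes>\<^sub>o X" "Cod C (lu X) = X"
    and "\<rho> X \<in> Arr C" "Dom C (\<rho> X) = X \<otimes>\<^sub>o \<I>" "Cod C (\<rho> X) = X"
    and "Y \<in> Obj C \<Longrightarrow> Z \<in> Obj C \<Longrightarrow> \<alpha> X Y Z \<in> Arr C"
    and "Y \<in> Obj C \<Longrightarrow> Z \<in> Obj C \<Longrightarrow> Dom C (\<alpha> X Y Z) = (X \<otimes>\<^sub>o Y) \<otimes>\<^sub>o Z"
    and "Y \<in> Obj C \<Longrightarrow> Z \<in> Obj C \<Longrightarrow> Cod C (\<alpha> X Y Z) = X \<otimes>\<^sub>o Y \<otimes>\<^sub>o Z"
  using assms LUnit_in RUnit_in Assoc_in by (auto simp: Hom_def)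

lemma structure_inv_arr [simp]:
  assumes "X \<in> Obj C"
  shows "lui X \<in> Arr C" "Dom C (lui X) = X" "Cod C (lui X) = \<I> \<otimes>\<^sub>o X"
    and "\<rho>i X \<in> Arr C" "Dom C (\<rho>i X) = X" "Cod C (\<rho>i X) = X \<otimes>\<^sub>o \<I>"
    and "Y \<in> Obj C \<Longrightarrow> Z \<in> Obj C \<Longrightarrow> \<alpha>i X Y Z \<in> Arr C"
    and "Y \<in> Obj C \<Longrightarrow> Z \<in> Obj C \<Longrightarrow> Dom C (\<alpha>i X Y Z) = X \<otimes>\<^sub>o Y \<otimes>\<^sub>o Z"
    and "Y \<in> Obj C \<Longrightarrow> Z \<in> Obj C \<Longrightarrow> Cod C (\<alpha>i X Y Z) = (X \<otimes>\<^sub>o Y) \<otimes>\<^sub>o Z"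
  using assms inv_arr[OF LUnit_iso] inv_arr[OF RUnit_iso] inv_arr[OF Assoc_iso] by auto

lemma structure_cancel [simp]:
  assumes "X \<in> Obj C"
  shows "lu X \<cdot> lui X = Id C X" "lui X \<cdot> lu X = Id C (\<I> \<otimes>\<^sub>o X)"
    and "\<rho> X \<cdot> \<rho>i X = Id C X" "\<rho>i X \<cdot> \<rho> X = Id C (X \<otimes>\<^sub>o \<I>)"
    and "Y \<in> Obj C \<Longrightarrow> Z \<in> Obj C \<Longrightarrow> \<alpha> X Y Z \<cdot> \<alpha>i X Y Z = Id C (X \<otimes>\<^sub>o Y \<otimes>\<^sub>o Z)"
    and "Y \<in> Obj C \<Longrightarrow> Z \<in> Obj C \<Longrightarrow> \<alpha>i X Y Z \<cdot> \<alpha> X Y Z = Id C ((X \<otimes>\<^sub>o Y) \<otimes>\<^sub>o Z)"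
  using assms inv_arr[OF LUnit_iso] inv_arr[OF RUnit_iso] inv_arr[OF Assoc_iso] by auto

lemma structure_cancel' [simp]:
  assumes "X \<in> Obj C" "q \<in> Arr C"
  shows "Cod C q = X \<Longrightarrow> lu X \<cdot> (lui X \<cdot> q) = q" "Cod C q = \<I> \<otimes>\<^sub>o X \<Longrightarrow> lui X \<cdot> (lu X \<cdot> q) = q"
    and "Cod C q = X \<Longrightarrow> \<rho> X \<cdot> (\<rho>i X \<cdot> q) = q" "Cod C q = X \<otimes>\<^sub>o \<I> \<Longrightarrow> \<rho>i X \<cdot> (\<rho> X \<cdot> q) = q"
    and "Y \<in> Obj C \<Longrightarrow> Z \<in> Obj C \<Longrightarrow> Cod C q = X \<otimes>\<^sub>o Y \<otimes>\<^sub>o Z \<Longrightarrow> \<alpha> X Y Z \<cdot> (\<alpha>i X Y Z \<cdot> q) = q"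
    and "Y \<in> Obj C \<Longrightarrow> Z \<in> Obj C \<Longrightarrow> Cod C q = (X \<otimes>\<^sub>o Y) \<otimes>\<^sub>o Z \<Longrightarrow> \<alpha>i X Y Z \<cdot> (\<alpha> X Y Z \<cdot> q) = q"
  using assms inv_arr_cancel[OF LUnit_iso] inv_arr_cancel[OF RUnit_iso] inv_arr_cancel[OF Assoc_iso] by auto

lemma \<alpha>_nat:
  assumes "f \<in> Arr C" "g \<in> Arr C" "h \<in> Arr C" "X = Cod C f" "Y = Cod C g" "Z = Cod C h"
  shows "\<alpha> X Y Z \<cdot> ((f \<otimes>\<^sub>a g) \<otimes>\<^sub>a h) = (f \<otimes>\<^sub>a g \<otimes>\<^sub>a h) \<cdot> \<alpha> (Dom C f) (Dom C g) (Dom C h)"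
  using Assoc_natural[of f "Dom C f" "Cod C f" g "Dom C g" "Cod C g" h "Dom C h" "Cod C h"] assms
  by (auto simp: Hom_def)

lemma \<alpha>i_nat:
  assumes "f \<in> Arr C" "g \<in> Arr C" "h \<in> Arr C" "X = Cod C f" "Y = Cod C g" "Z = Cod C h"
  shows "\<alpha>i X Y Z \<cdot> (f \<otimes>\<^sub>a g \<otimes>\<^sub>a h) = ((f \<otimes>\<^sub>a g) \<otimes>\<^sub>a h) \<cdot> \<alpha>i (Dom C f) (Dom C g) (Dom C h)"
proof -
  have "\<alpha>i X Y Z \<cdot> (f \<otimes>\<^sub>a g \<otimes>\<^sub>a h)
      = \<alpha>i X Y Z \<cdot> (((f \<otimes>\<^sub>a g \<otimes>\<^sub>a h) \<cdot> \<alpha> (Dom C f) (Dom C g) (Dom C h)) \<cdot> \<alpha>i (Dom C f) (Dom C g) (Dom C h))"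
    using assms by simp
  also have "\<dots> = ((f \<otimes>\<^sub>a g) \<otimes>\<^sub>a h) \<cdot> \<alpha>i (Dom C f) (Dom C g) (Dom C h)"
    using assms by (simp add: \<alpha>_nat[symmetric])
  finally show ?thesis .
qed

lemma lu_nat:
  assumes "f \<in> Arr C" "Y = Cod C f"
  shows "lu Y \<cdot> (\<I> \<triangleright> f) = f \<cdot> lu (Dom C f)"
  using LUnit_natural[of f "Dom C f" "Cod C f"] assms by (auto simp: Hom_def)

lemma \<rho>_nat:
  assumes "f \<in> Arr C" "Y = Cod C f"
  shows "\<rho> Y \<cdot> (f \<triangleleft> \<I>) = f \<cdot> \<rho> (Dom C f)"
  using RUnit_natural[of f "Dom C f" "Cod C f"] assms by (auto simp: Hom_def)

lemma lui_nat:
  assumes "f \<in> Arr C" "Y = Cod C f"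
  shows "lui Y \<cdot> f = (\<I> \<triangleright> f) \<cdot> lui (Dom C f)"
proof -
  have "lui Y \<cdot> f = lui Y \<cdot> ((f \<cdot> lu (Dom C f)) \<cdot> lui (Dom C f))"
    using assms by simp
  also have "\<dots> = (\<I> \<triangleright> f) \<cdot> lui (Dom C f)"
    using assms by (simp add: lu_nat[OF assms, symmetric])
  finally show ?thesis .
qed

lemma lwhisker_Unit_faithful:
  assumes "\<I> \<triangleright> f = \<I> \<triangleright> g" "f \<in> Arr C" "g \<in> Arr C" "Dom C f = Dom C g" "Cod C f = Cod C g"
  shows "f = g"
proof -
  have "f \<cdot> lu (Dom C f) = g \<cdot> lu (Dom C f)"
    using assms lu_nat[of f "Cod C f"] lu_nat[of g "Cod C f"] by simp
  then show ?thesis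
    by (rule iso_right_cancel[rotated]) (use assms LUnit_iso[of "Dom C f"] in simp_all)
qed

lemma rwhisker_Unit_faithful:
  assumes "f \<triangleleft> \<I> = g \<triangleleft> \<I>" "f \<in> Arr C" "g \<in> Arr C" "Dom C f = Dom C g" "Cod C f = Cod C g"
  shows "f = g"
proof -
  have "f \<cdot> \<rho> (Dom C f) = g \<cdot> \<rho> (Dom C f)"
    using assms \<rho>_nat[of f "Cod C f"] \<rho>_nat[of g "Cod C f"] by simp
  then show ?thesis
    by (rule iso_right_cancel[rotated]) (use assms RUnit_iso[of "Dom C f"] in simp_all)
qed

lemma pentagon':
  assumes "W \<in> Obj C" "X \<in> Obj C" "Y \<in> Obj C" "Z \<in> Obj C"
  shows "(W \<triangleright> \<alpha> X Y Z) \<cdot> (\<alpha> W (X \<otimes>\<^sub>o Y) Z \<cdot> (\<alpha> W X Y \<triangleleft> Z)) = \<alpha> W X (Y \<otimes>\<^sub>o Z) \<cdot> \<alpha> (W \<otimes>\<^sub>o X) Y Z"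
  using pentagon[OF assms] assms by simp

text \<open>Kelly's lemma. Since \<open>\<I> \<otimes> -\<close> is faithful, it may be checked after tensoring with \<open>\<I>\<close>,
where the pentagon for \<open>\<I>, \<I>, X, Y\<close> reduces both sides to the triangle.\<close>

lemma LUnit_Tens:
  assumes X: "X \<in> Obj C" and Y: "Y \<in> Obj C"
  shows "lu (X \<otimes>\<^sub>o Y) \<cdot> \<alpha> \<I> X Y = lu X \<triangleleft> Y"
proof (rule lwhisker_Unit_faithful)
  note [simp] = X Y
  have iso: "isomorphism C (\<alpha> \<I> (\<I> \<otimes>\<^sub>o X) Y \<cdot> (\<alpha> \<I> \<I> X \<triangleleft> Y))"
    by (intro iso_Comp iso_Tens iso_Id Assoc_iso) auto
  show "\<I> \<triangleright> (lu (X \<otimes>\<^sub>o Y) \<cdot> \<alpha> \<I> X Y) = \<I> \<triangleright> (lu X \<triangleleft> Y)"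
  proof (rule iso_right_cancel[OF iso])
    have "(\<I> \<triangleright> (lu (X \<otimes>\<^sub>o Y) \<cdot> \<alpha> \<I> X Y)) \<cdot> (\<alpha> \<I> (\<I> \<otimes>\<^sub>o X) Y \<cdot> (\<alpha> \<I> \<I> X \<triangleleft> Y))
       = (\<I> \<triangleright> lu (X \<otimes>\<^sub>o Y)) \<cdot> (\<alpha> \<I> \<I> (X \<otimes>\<^sub>o Y) \<cdot> \<alpha> (\<I> \<otimes>\<^sub>o \<I>) X Y)"
      by (simp add: whisker pentagon')
    also have "\<dots> = (\<rho> \<I> \<triangleleft> (X \<otimes>\<^sub>o Y)) \<cdot> \<alpha> (\<I> \<otimes>\<^sub>o \<I>) X Y"
      by (simp add: triangle[symmetric])
    also have "\<dots> = \<alpha> \<I> X Y \<cdot> (((\<I> \<triangleright> lu X) \<cdot> \<alpha> \<I> \<I> X) \<triangleleft> Y)"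
      by (simp add: triangle \<alpha>_nat)
    also have "\<dots> = (\<I> \<triangleright> (lu X \<triangleleft> Y)) \<cdot> (\<alpha> \<I> (\<I> \<otimes>\<^sub>o X) Y \<cdot> (\<alpha> \<I> \<I> X \<triangleleft> Y))"
      by (simp add: whisker Comp_extend[OF \<alpha>_nat])
    finally show "(\<I> \<triangleright> (lu (X \<otimes>\<^sub>o Y) \<cdot> \<alpha> \<I> X Y)) \<cdot> (\<alpha> \<I> (\<I> \<otimes>\<^sub>o X) Y \<cdot> (\<alpha> \<I> \<I> X \<triangleleft> Y)) = \<dots>" .
  qed auto
qed (use X Y in auto)

lemma interchange:
  assumes "f \<in> Arr C" "g \<in> Arr C" "Y = Cod C g" "X = Dom C f"
  shows "(f \<triangleleft> Y) \<cdot> (X \<triangleright> g) = (Cod C f \<triangleright> g) \<cdot> (f \<triangleleft> Dom C g)"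
  using assms by (simp add: Tens_Comp)

lemmas \<alpha>_nat' = Comp_extend[OF \<alpha>_nat]
  and \<alpha>i_nat' = Comp_extend[OF \<alpha>i_nat]
  and lu_nat' = Comp_extend[OF lu_nat]
  and interchange' = Comp_extend[OF interchange]

lemma LUnit_Tens_inv:
  assumes "X \<in> Obj C" "Y \<in> Obj C"
  shows "\<alpha> \<I> X Y \<cdot> (lui X \<triangleleft> Y) = lui (X \<otimes>\<^sub>o Y)"
proof (rule iso_left_cancel[OF LUnit_iso[of "X \<otimes>\<^sub>o Y"]])
  show "lu (X \<otimes>\<^sub>o Y) \<cdot> (\<alpha> \<I> X Y \<cdot> (lui X \<triangleleft> Y)) = lu (X \<otimes>\<^sub>o Y) \<cdot> lui (X \<otimes>\<^sub>o Y)"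
    using assms by (simp add: Comp_extend[OF LUnit_Tens] flip: rwhisker_Comp)
qed (use assms in auto)

lemma triangle_inv:
  assumes "X \<in> Obj C" "Y \<in> Obj C"
  shows "\<alpha> X \<I> Y \<cdot> (\<rho>i X \<triangleleft> Y) = X \<triangleright> lui Y"
proof (rule iso_left_cancel)
  show "isomorphism C (X \<triangleright> lu Y)"
    using assms by (intro iso_Tens iso_Id LUnit_iso)
  show "(X \<triangleright> lu Y) \<cdot> (\<alpha> X \<I> Y \<cdot> (\<rho>i X \<triangleleft> Y)) = (X \<triangleright> lu Y) \<cdot> (X \<triangleright> lui Y)"
    using assms by (simp add: Comp_extend[OF triangle] flip: rwhisker_Comp lwhisker_Comp)
qed (use assms in auto)

text \<open>The pentagon solved for different edges, in the forms in which the translations into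
families meet it.\<close>

lemma pentagon_mid:
  assumes "W \<in> Obj C" "X \<in> Obj C" "Y \<in> Obj C" "Z \<in> Obj C"
  shows "\<alpha> W (X \<otimes>\<^sub>o Y) Z \<cdot> (\<alpha> W X Y \<triangleleft> Z)
    = (W \<triangleright> \<alpha>i X Y Z) \<cdot> (\<alpha> W X (Y \<otimes>\<^sub>o Z) \<cdot> \<alpha> (W \<otimes>\<^sub>o X) Y Z)"
proof -
  have "(W \<triangleright> \<alpha>i X Y Z) \<cdot> ((W \<triangleright> \<alpha> X Y Z) \<cdot> (\<alpha> W (X \<otimes>\<^sub>o Y) Z \<cdot> (\<alpha> W X Y \<triangleleft> Z)))
      = \<alpha> W (X \<otimes>\<^sub>o Y) Z \<cdot> (\<alpha> W X Y \<triangleleft> Z)"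
    using assms by (simp add: Comp_extend[OF lwhisker_Comp[symmetric]])
  then show ?thesis
    using assms by (simp add: pentagon')
qed

lemma pentagon_inv_left:
  assumes "W \<in> Obj C" "X \<in> Obj C" "Y \<in> Obj C" "Z \<in> Obj C"
  shows "\<alpha> (W \<otimes>\<^sub>o X) Y Z \<cdot> (\<alpha>i W X Y \<triangleleft> Z)
    = \<alpha>i W X (Y \<otimes>\<^sub>o Z) \<cdot> ((W \<triangleright> \<alpha> X Y Z) \<cdot> \<alpha> W (X \<otimes>\<^sub>o Y) Z)"
proof (rule iso_right_cancel)
  show "isomorphism C (\<alpha> W X Y \<triangleleft> Z)"
    using assms by (intro iso_Tens iso_Id Assoc_iso)
  show "(\<alpha> (W \<otimes>\<^sub>o X) Y Z \<cdot> (\<alpha>i W X Y \<triangleleft> Z)) \<cdot> (\<alpha> W X Y \<triangleleft> Z)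
    = (\<alpha>i W X (Y \<otimes>\<^sub>o Z) \<cdot> ((W \<triangleright> \<alpha> X Y Z) \<cdot> \<alpha> W (X \<otimes>\<^sub>o Y) Z)) \<cdot> (\<alpha> W X Y \<triangleleft> Z)"
    using assms by (simp add: pentagon' flip: rwhisker_Comp)
qed (use assms in auto)

lemma \<alpha>_nat_right:
  assumes "X \<in> Obj C" "Y \<in> Obj C" "h \<in> Arr C" "Z = Cod C h"
  shows "\<alpha> X Y Z \<cdot> ((X \<otimes>\<^sub>o Y) \<triangleright> h) = (X \<triangleright> (Y \<triangleright> h)) \<cdot> \<alpha> X Y (Dom C h)"
  using assms \<alpha>_nat[of "Id C X" "Id C Y" h] by simp

lemma whisker_cancel [simp]:
  assumes "W \<in> Obj C" "X \<in> Obj C" "Y \<in> Obj C" "Z \<in> Obj C" "q \<in> Arr C"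
  shows "Cod C q = W \<otimes>\<^sub>o ((X \<otimes>\<^sub>o Y) \<otimes>\<^sub>o Z) \<Longrightarrow> (W \<triangleright> \<alpha>i X Y Z) \<cdot> ((W \<triangleright> \<alpha> X Y Z) \<cdot> q) = q"
    "Cod C q = W \<otimes>\<^sub>o X \<otimes>\<^sub>o Y \<otimes>\<^sub>o Z \<Longrightarrow> (W \<triangleright> \<alpha> X Y Z) \<cdot> ((W \<triangleright> \<alpha>i X Y Z) \<cdot> q) = q"
    "Cod C q = ((X \<otimes>\<^sub>o Y) \<otimes>\<^sub>o Z) \<otimes>\<^sub>o W \<Longrightarrow> (\<alpha>i X Y Z \<triangleleft> W) \<cdot> ((\<alpha> X Y Z \<triangleleft> W) \<cdot> q) = q"
    "Cod C q = (X \<otimes>\<^sub>o Y \<otimes>\<^sub>o Z) \<otimes>\<^sub>o W \<Longrightarrow> (\<alpha> X Y Z \<triangleleft> W) \<cdot> ((\<alpha>i X Y Z \<triangleleft> W) \<cdot> q) = q"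
  using assms
  by (simp_all add: Comp_extend[OF lwhisker_Comp[symmetric]] Comp_extend[OF rwhisker_Comp[symmetric]])

lemma whisker_cancel' [simp]:
  assumes "W \<in> Obj C" "X \<in> Obj C" "Y \<in> Obj C" "Z \<in> Obj C"
  shows "(W \<triangleright> \<alpha>i X Y Z) \<cdot> (W \<triangleright> \<alpha> X Y Z) = Id C (W \<otimes>\<^sub>o ((X \<otimes>\<^sub>o Y) \<otimes>\<^sub>o Z))"
    "(\<alpha>i X Y Z \<triangleleft> W) \<cdot> (\<alpha> X Y Z \<triangleleft> W) = Id C (((X \<otimes>\<^sub>o Y) \<otimes>\<^sub>o Z) \<otimes>\<^sub>o W)"
    "(W \<triangleright> \<alpha> X Y Z) \<cdot> (W \<triangleright> \<alpha>i X Y Z) = Id C (W \<otimes>\<^sub>o (X \<otimes>\<^sub>o Y \<otimes>\<^sub>o Z))"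
    "(\<alpha> X Y Z \<triangleleft> W) \<cdot> (\<alpha>i X Y Z \<triangleleft> W) = Id C ((X \<otimes>\<^sub>o Y \<otimes>\<^sub>o Z) \<otimes>\<^sub>o W)"
  using assms by (simp_all flip: lwhisker_Comp rwhisker_Comp)

lemma pentagon_long:
  assumes "W \<in> Obj C" "X \<in> Obj C" "Y \<in> Obj C" "Z \<in> Obj C"
  shows "(W \<triangleright> \<alpha> X Y Z) \<cdot> \<alpha> W (X \<otimes>\<^sub>o Y) Z = \<alpha> W X (Y \<otimes>\<^sub>o Z) \<cdot> (\<alpha> (W \<otimes>\<^sub>o X) Y Z \<cdot> (\<alpha>i W X Y \<triangleleft> Z))"
  using assms by (simp add: pentagon_inv_left)

lemma pentagon_inv:
  assumes "W \<in> Obj C" "X \<in> Obj C" "Y \<in> Obj C" "Z \<in> Obj C"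
  shows "(\<alpha>i W X Y \<triangleleft> Z) \<cdot> (\<alpha>i W (X \<otimes>\<^sub>o Y) Z \<cdot> (W \<triangleright> \<alpha>i X Y Z)) = \<alpha>i (W \<otimes>\<^sub>o X) Y Z \<cdot> \<alpha>i W X (Y \<otimes>\<^sub>o Z)"
proof (rule iso_right_cancel)
  show "isomorphism C (\<alpha> W X (Y \<otimes>\<^sub>o Z) \<cdot> \<alpha> (W \<otimes>\<^sub>o X) Y Z)"
    using assms by (intro iso_Comp Assoc_iso) auto
  have "((\<alpha>i W X Y \<triangleleft> Z) \<cdot> (\<alpha>i W (X \<otimes>\<^sub>o Y) Z \<cdot> (W \<triangleright> \<alpha>i X Y Z))) \<cdot> (\<alpha> W X (Y \<otimes>\<^sub>o Z) \<cdot> \<alpha> (W \<otimes>\<^sub>o X) Y Z)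
    = Id C (((W \<otimes>\<^sub>o X) \<otimes>\<^sub>o Y) \<otimes>\<^sub>o Z)"
    using assms by (simp flip: pentagon')
  also have "\<dots> = (\<alpha>i (W \<otimes>\<^sub>o X) Y Z \<cdot> \<alpha>i W X (Y \<otimes>\<^sub>o Z)) \<cdot> (\<alpha> W X (Y \<otimes>\<^sub>o Z) \<cdot> \<alpha> (W \<otimes>\<^sub>o X) Y Z)"
    using assms by simp
  finally show "((\<alpha>i W X Y \<triangleleft> Z) \<cdot> (\<alpha>i W (X \<otimes>\<^sub>o Y) Z \<cdot> (W \<triangleright> \<alpha>i X Y Z))) \<cdot> (\<alpha> W X (Y \<otimes>\<^sub>o Z)
    \<cdot> \<alpha> (W \<otimes>\<^sub>o X) Y Z) = \<dots>" .
qed (use assms in auto)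

lemma pentagon_inv_mid:
  assumes "W \<in> Obj C" "X \<in> Obj C" "Y \<in> Obj C" "Z \<in> Obj C"
  shows "\<alpha>i W (X \<otimes>\<^sub>o Y) Z \<cdot> (W \<triangleright> \<alpha>i X Y Z)
    = (\<alpha> W X Y \<triangleleft> Z) \<cdot> (\<alpha>i (W \<otimes>\<^sub>o X) Y Z \<cdot> \<alpha>i W X (Y \<otimes>\<^sub>o Z))"
  using assms by (simp flip: pentagon_inv)

lemma pentagon_inv_long:
  assumes "W \<in> Obj C" "X \<in> Obj C" "Y \<in> Obj C" "Z \<in> Obj C"
  shows "(\<alpha>i W X Y \<triangleleft> Z) \<cdot> \<alpha>i W (X \<otimes>\<^sub>o Y) Z
    = \<alpha>i (W \<otimes>\<^sub>o X) Y Z \<cdot> (\<alpha>i W X (Y \<otimes>\<^sub>o Z) \<cdot> (W \<triangleright> \<alpha> X Y Z))"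
proof -
  have "(\<alpha>i W X Y \<triangleleft> Z) \<cdot> \<alpha>i W (X \<otimes>\<^sub>o Y) Z
    = ((\<alpha>i W X Y \<triangleleft> Z) \<cdot> (\<alpha>i W (X \<otimes>\<^sub>o Y) Z \<cdot> (W \<triangleright> \<alpha>i X Y Z))) \<cdot> (W \<triangleright> \<alpha> X Y Z)"
    using assms by simp
  then show ?thesis
    unfolding pentagon_inv[OF assms] using assms by simp
qed

lemma pentagon_inv_right:
  assumes "W \<in> Obj C" "X \<in> Obj C" "Y \<in> Obj C" "Z \<in> Obj C"
  shows "(\<alpha> W X Y \<triangleleft> Z) \<cdot> \<alpha>i (W \<otimes>\<^sub>o X) Y Z
    = \<alpha>i W (X \<otimes>\<^sub>o Y) Z \<cdot> ((W \<triangleright> \<alpha>i X Y Z) \<cdot> \<alpha> W X (Y \<otimes>\<^sub>o Z))"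
  using assms by (simp add: Comp_extend[OF pentagon_inv_mid])

end

section \<open>Cups, caps and switchings as natural families\<close>

context monoidal_category
begin

text \<open>The families that represent \<open>t : \<I> \<rightarrow> Y \<otimes> Z\<close>, \<open>b : Z \<otimes> X \<rightarrow> \<I>\<close>, \<open>s X Y\<close> and \<open>k : \<I> \<rightarrow> \<I>\<close>
under the action of objects by tensoring on the left. In \<open>sw\<close> the whole family \<open>s\<close> is an
argument because braidings and switching isomorphisms are used side by side.\<close>

definition cup :: "'o \<Rightarrow> 'o \<Rightarrow> 'm \<Rightarrow> 'o \<Rightarrow> 'm"
  where "cup Y Z t V = \<alpha> Y Z V \<cdot> ((t \<triangleleft> V) \<cdot> lui V)"

definition cap :: "'o \<Rightarrow> 'o \<Rightarrow> 'm \<Rightarrow> 'o \<Rightarrow> 'm"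
  where "cap Z X b V = lu V \<cdot> ((b \<triangleleft> V) \<cdot> \<alpha>i Z X V)"

definition sw :: "('o \<Rightarrow> 'o \<Rightarrow> 'm) \<Rightarrow> 'o \<Rightarrow> 'o \<Rightarrow> 'o \<Rightarrow> 'm"
  where "sw s X Y V = \<alpha> Y X V \<cdot> ((s X Y \<triangleleft> V) \<cdot> \<alpha>i X Y V)"

definition scal :: "'m \<Rightarrow> 'o \<Rightarrow> 'm"
  where "scal k V = lu V \<cdot> ((k \<triangleleft> V) \<cdot> lui V)"

lemma cup_arr [simp]:
  assumes "t \<in> Hom C \<I> (Y \<otimes>\<^sub>o Z)" "Y \<in> Obj C" "Z \<in> Obj C" "V \<in> Obj C"
  shows "cup Y Z t V \<in> Arr C" "Dom C (cup Y Z t V) = V" "Cod C (cup Y Z t V) = Y \<otimes>\<^sub>o Z \<otimes>\<^sub>o V"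
  using assms(2-) HomD[OF assms(1)] by (simp_all add: cup_def)

lemma cap_arr [simp]:
  assumes "b \<in> Hom C (Z \<otimes>\<^sub>o X) \<I>" "Z \<in> Obj C" "X \<in> Obj C" "V \<in> Obj C"
  shows "cap Z X b V \<in> Arr C" "Dom C (cap Z X b V) = Z \<otimes>\<^sub>o X \<otimes>\<^sub>o V" "Cod C (cap Z X b V) = V"
  using assms(2-) HomD[OF assms(1)] by (simp_all add: cap_def)

lemma cup_nat:
  assumes t: "t \<in> Hom C \<I> (Y \<otimes>\<^sub>o Z)" and o: "Y \<in> Obj C" "Z \<in> Obj C"
    and v: "v \<in> Arr C" "V = Cod C v"
  shows "cup Y Z t V \<cdot> v = (Y \<triangleright> (Z \<triangleright> v)) \<cdot> cup Y Z t (Dom C v)"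
  using o v HomD[OF t]
  by (simp add: cup_def lui_nat interchange' \<alpha>_nat' flip: Tens_Id)

lemma cap_nat:
  assumes b: "b \<in> Hom C (Z \<otimes>\<^sub>o X) \<I>" and o: "Z \<in> Obj C" "X \<in> Obj C"
    and v: "v \<in> Arr C" "V = Cod C v"
  shows "cap Z X b V \<cdot> (Z \<triangleright> (X \<triangleright> v)) = v \<cdot> cap Z X b (Dom C v)"
  using o v HomD[OF b]
  by (simp add: cap_def \<alpha>i_nat interchange' lu_nat')

lemma scal_arr [simp]:
  assumes "k \<in> Hom C \<I> \<I>" "V \<in> Obj C"
  shows "scal k V \<in> Arr C" "Dom C (scal k V) = V" "Cod C (scal k V) = V"
  using assms(2-) HomD[OF assms(1)] by (simp_all add: scal_def)

lemma scal_nat: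
  assumes k: "k \<in> Hom C \<I> \<I>" and v: "v \<in> Arr C" "V = Cod C v"
  shows "scal k V \<cdot> v = v \<cdot> scal k (Dom C v)"
  using v HomD[OF k]
  by (simp add: scal_def lui_nat interchange' lu_nat')

lemma scal_Comp:
  assumes k: "k \<in> Hom C \<I> \<I>" and l: "l \<in> Hom C \<I> \<I>" and V: "V \<in> Obj C"
  shows "scal (k \<cdot> l) V = scal k V \<cdot> scal l V"
  using V HomD[OF k] HomD[OF l] by (simp add: scal_def whisker)

text \<open>Conjugating by the unit constraint turns the component at \<open>\<I>\<close> into \<open>k \<otimes> \<I>\<close>, and tensoring
with \<open>\<I>\<close> is faithful.\<close>

lemma scal_inject:
  assumes k: "k \<in> Hom C \<I> \<I>" and l: "l \<in> Hom C \<I> \<I>" and eq: "scal k \<I> = scal l \<I>"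
  shows "k = l"
proof -
  have "lui \<I> \<cdot> (scal m \<I> \<cdot> lu \<I>) = m \<triangleleft> \<I>" if m: "m \<in> Hom C \<I> \<I>" for m
    using HomD[OF m] by (simp add: scal_def)
  then have "k \<triangleleft> \<I> = l \<triangleleft> \<I>"
    using k l eq by metis
  then show ?thesis
    using HomD[OF k] HomD[OF l] by (metis rwhisker_Unit_faithful)
qed

text \<open>A scalar acts by natural endomorphisms of the identity functor, so the action of one
scalar commutes with that of another.\<close>

lemma scalars_commute:
  assumes k: "k \<in> Hom C \<I> \<I>" and l: "l \<in> Hom C \<I> \<I>"
  shows "k \<cdot> l = l \<cdot> k"
proof (rule scal_inject)
  show "scal (k \<cdot> l) \<I> = scal (l \<cdot> k) \<I>"
    using k l scal_nat[OF k, of "scal l \<I>" \<I>] by (simp add: scal_Comp)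
qed (use k l in \<open>auto simp: Hom_iff\<close>)

text \<open>The triangle, the pentagon and Kelly's lemma absorb all coherence isomorphisms in the
definition of \<open>\<Psi>\<close>; from here on a thick morphism can be handled as a cup followed by a cap.\<close>

lemma rwhisker_\<Psi>:
  assumes o: "X \<in> Obj C" "Y \<in> Obj C" "V \<in> Obj C" and T: "(Z, t, b) \<in> triples C X Y"
  shows "\<Psi> C X Y (Z, t, b) \<triangleleft> V = (Y \<triangleright> cap Z X b V) \<cdot> cup Y Z t (X \<otimes>\<^sub>o V)"
proof -
  from T have Z: "Z \<in> Obj C" and t: "t \<in> Hom C \<I> (Y \<otimes>\<^sub>o Z)" and b: "b \<in> Hom C (Z \<otimes>\<^sub>o X) \<I>"
    by (auto simp: triples_def)
  note [simp] = o Z HomD[OF t] HomD[OF b]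
  have "\<Psi> C X Y (Z, t, b) \<triangleleft> V
    = (\<rho> Y \<triangleleft> V) \<cdot> (((Y \<triangleright> b) \<triangleleft> V) \<cdot> ((\<alpha> Y Z X \<triangleleft> V) \<cdot> (((t \<triangleleft> X) \<triangleleft> V) \<cdot> (lui X \<triangleleft> V))))"
    by (simp add: whisker)
  also have "\<dots> = (Y \<triangleright> lu V) \<cdot> (\<alpha> Y \<I> V \<cdot> (((Y \<triangleright> b) \<triangleleft> V) \<cdot> ((\<alpha> Y Z X \<triangleleft> V) \<cdot> (((t \<triangleleft> X) \<triangleleft> V) \<cdot> (lui X \<triangleleft> V)))))"
    by (simp flip: triangle)
  also have "\<dots> = (Y \<triangleright> lu V) \<cdot> ((Y \<triangleright> (b \<triangleleft> V)) \<cdot> (\<alpha> Y (Z \<otimes>\<^sub>o X) V \<cdot> ((\<alpha> Y Z X \<triangleleft> V) \<cdot> (((t \<triangleleft> X) \<triangleleft> V)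
    \<cdot> (lui X \<triangleleft> V)))))"
    by (simp add: \<alpha>_nat')
  also have "\<dots> = (Y \<triangleright> lu V) \<cdot> ((Y \<triangleright> (b \<triangleleft> V)) \<cdot> ((Y \<triangleright> \<alpha>i Z X V) \<cdot> (\<alpha> Y Z (X \<otimes>\<^sub>o V) \<cdot> (\<alpha> (Y \<otimes>\<^sub>o Z) X V
    \<cdot> (((t \<triangleleft> X) \<triangleleft> V) \<cdot> (lui X \<triangleleft> V))))))"
    by (simp add: Comp_extend[OF pentagon_mid])
  also have "\<dots> = (Y \<triangleright> lu V) \<cdot> ((Y \<triangleright> (b \<triangleleft> V)) \<cdot> ((Y \<triangleright> \<alpha>i Z X V) \<cdot> (\<alpha> Y Z (X \<otimes>\<^sub>o V) \<cdot> ((t \<triangleleft> (X \<otimes>\<^sub>o V))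
    \<cdot> lui (X \<otimes>\<^sub>o V)))))"
    by (simp add: \<alpha>_nat' LUnit_Tens_inv)
  also have "\<dots> = (Y \<triangleright> cap Z X b V) \<cdot> cup Y Z t (X \<otimes>\<^sub>o V)"
    by (simp add: cap_def cup_def whisker)
  finally show ?thesis .
qed

text \<open>The morphism \<open>h\<close> bends \<open>t\<close> with \<open>c\<close> on the other side. It has to be an actual morphism
\<open>W \<rightarrow> Z\<close>, and not only a family \<open>W \<otimes> V \<rightarrow> Z \<otimes> V\<close>, since switching isomorphisms are natural with
respect to morphisms.\<close>

lemma transpose_whisker:
  assumes o: "Y \<in> Obj C" "Z \<in> Obj C" "W \<in> Obj C"
    and t: "t \<in> Hom C \<I> (Y \<otimes>\<^sub>o Z)" and c: "c \<in> Hom C (W \<otimes>\<^sub>o Y) \<I>"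
  defines "h \<equiv> lu Z \<cdot> ((c \<triangleleft> Z) \<cdot> (\<alpha>i W Y Z \<cdot> ((W \<triangleright> t) \<cdot> \<rho>i W)))"
  shows "h \<in> Hom C W Z" "V \<in> Obj C \<Longrightarrow> h \<triangleleft> V = cap W Y c (Z \<otimes>\<^sub>o V) \<cdot> (W \<triangleright> cup Y Z t V)"
proof -
  note [simp] = o HomD[OF t] HomD[OF c]
  show "h \<in> Hom C W Z"
    by (simp add: h_def Hom_iff)
  assume [simp]: "V \<in> Obj C"
  have "h \<triangleleft> V = (lu Z \<triangleleft> V) \<cdot> (((c \<triangleleft> Z) \<triangleleft> V) \<cdot> ((\<alpha>i W Y Z \<triangleleft> V) \<cdot> (((W \<triangleright> t) \<triangleleft> V) \<cdot> (\<rho>i W \<triangleleft> V))))"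
    by (simp add: h_def whisker)
  also have "\<dots> = lu (Z \<otimes>\<^sub>o V) \<cdot> (\<alpha> \<I> Z V \<cdot> (((c \<triangleleft> Z) \<triangleleft> V) \<cdot> ((\<alpha>i W Y Z \<triangleleft> V) \<cdot> (((W \<triangleright> t) \<triangleleft> V)
    \<cdot> (\<rho>i W \<triangleleft> V)))))"
    by (simp flip: LUnit_Tens)
  also have "\<dots> = lu (Z \<otimes>\<^sub>o V) \<cdot> ((c \<triangleleft> (Z \<otimes>\<^sub>o V)) \<cdot> (\<alpha>i W Y (Z \<otimes>\<^sub>o V) \<cdot> ((W \<triangleright> \<alpha> Y Z V) \<cdot> (\<alpha> W (Y \<otimes>\<^sub>o Z) V
    \<cdot> (((W \<triangleright> t) \<triangleleft> V) \<cdot> (\<rho>i W \<triangleleft> V))))))"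
    by (simp add: \<alpha>_nat' Comp_extend[OF pentagon_inv_left])
  also have "\<dots> = lu (Z \<otimes>\<^sub>o V) \<cdot> ((c \<triangleleft> (Z \<otimes>\<^sub>o V)) \<cdot> (\<alpha>i W Y (Z \<otimes>\<^sub>o V) \<cdot> ((W \<triangleright> \<alpha> Y Z V) \<cdot> ((W \<triangleright> (t \<triangleleft> V))
    \<cdot> (W \<triangleright> lui V)))))"
    by (simp add: \<alpha>_nat' triangle_inv)
  also have "\<dots> = cap W Y c (Z \<otimes>\<^sub>o V) \<cdot> (W \<triangleright> cup Y Z t V)"
    by (simp add: cap_def cup_def whisker)
  finally show "h \<triangleleft> V = cap W Y c (Z \<otimes>\<^sub>o V) \<cdot> (W \<triangleright> cup Y Z t V)" .
qed

lemma cap_precomp: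
  assumes "b \<in> Hom C (Z \<otimes>\<^sub>o X) \<I>" "g \<in> Hom C Y X" "Z \<in> Obj C" "V \<in> Obj C"
  shows "cap Z Y (b \<cdot> (Z \<triangleright> g)) V = cap Z X b V \<cdot> (Z \<triangleright> (g \<triangleleft> V))"
  using assms(3-) HomD[OF assms(1)] HomD[OF assms(2)] Hom_obj[OF assms(2)]
  by (simp add: cap_def \<alpha>i_nat whisker)

lemma cup_postcomp:
  assumes "t \<in> Hom C \<I> (X \<otimes>\<^sub>o Z)" "g \<in> Hom C X Y" "Z \<in> Obj C" "V \<in> Obj C"
  shows "cup Y Z ((g \<triangleleft> Z) \<cdot> t) V = (g \<triangleleft> (Z \<otimes>\<^sub>o V)) \<cdot> cup X Z t V"
  using assms(3-) HomD[OF assms(1)] HomD[OF assms(2)] Hom_obj[OF assms(2)]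
  by (simp add: cup_def \<alpha>_nat' whisker)

lemma \<Psi>_Hom:
  assumes "X \<in> Obj C" "Y \<in> Obj C" "T \<in> triples C X Y"
  shows "\<Psi> C X Y T \<in> Hom C X Y"
  using assms by (cases T) (auto simp: triples_def Hom_iff)

end

context switching
begin

lemma switch_arr [simp]:
  assumes "X \<in> Obj C" "Y \<in> Obj C"
  shows "s X Y \<in> Arr C" "Dom C (s X Y) = X \<otimes>\<^sub>o Y" "Cod C (s X Y) = Y \<otimes>\<^sub>o X"
  using switch_in[OF assms] by (auto simp: Hom_def)

lemma switch_nat:
  assumes "f \<in> Arr C" "g \<in> Arr C" "X = Cod C f" "Y = Cod C g"
  shows "s X Y \<cdot> (f \<otimes>\<^sub>a g) = (g \<otimes>\<^sub>a f) \<cdot> s (Dom C f) (Dom C g)"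
  using assms switch_natural[of f "Dom C f" "Cod C f" g "Dom C g" "Cod C g"] by (auto simp: Hom_def)

lemmas switch_nat' = Comp_extend[OF switch_nat]

lemma sw_arr [simp]:
  assumes "X \<in> Obj C" "Y \<in> Obj C" "V \<in> Obj C"
  shows "sw s X Y V \<in> Arr C" "Dom C (sw s X Y V) = X \<otimes>\<^sub>o Y \<otimes>\<^sub>o V" "Cod C (sw s X Y V) = Y \<otimes>\<^sub>o X \<otimes>\<^sub>o V"
  using assms by (simp_all add: sw_def)

lemma sw_nat:
  assumes "f \<in> Arr C" "g \<in> Arr C" "v \<in> Arr C" "X = Cod C f" "Y = Cod C g" "V = Cod C v"
  shows "sw s X Y V \<cdot> (f \<otimes>\<^sub>a g \<otimes>\<^sub>a v) = (g \<otimes>\<^sub>a f \<otimes>\<^sub>a v) \<cdot> sw s (Dom C f) (Dom C g) (Dom C v)"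
proof -
  note [simp] = assms
  have "sw s X Y V \<cdot> (f \<otimes>\<^sub>a g \<otimes>\<^sub>a v)
      = \<alpha> Y X V \<cdot> (((s X Y \<cdot> (f \<otimes>\<^sub>a g)) \<otimes>\<^sub>a v) \<cdot> \<alpha>i (Dom C f) (Dom C g) (Dom C v))"
    by (simp add: sw_def \<alpha>i_nat Tens_Comp_extend)
  also have "\<dots> = \<alpha> Y X V \<cdot> (((g \<otimes>\<^sub>a f) \<otimes>\<^sub>a v) \<cdot> ((s (Dom C f) (Dom C g) \<triangleleft> Dom C v)
    \<cdot> \<alpha>i (Dom C f) (Dom C g) (Dom C v)))"
    by (simp add: switch_nat Tens_Comp_extend)
  also have "\<dots> = (g \<otimes>\<^sub>a f \<otimes>\<^sub>a v) \<cdot> sw s (Dom C f) (Dom C g) (Dom C v)"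
    by (simp add: sw_def \<alpha>_nat')
  finally show ?thesis .
qed

lemmas sw_nat' = Comp_extend[OF sw_nat]

lemma scal_trace:
  assumes "t \<in> Hom C \<I> (Y \<otimes>\<^sub>o Z)" "b \<in> Hom C (Z \<otimes>\<^sub>o Y) \<I>" "Y \<in> Obj C" "Z \<in> Obj C" "V \<in> Obj C"
  shows "scal (b \<cdot> (s Y Z \<cdot> t)) V = cap Z Y b V \<cdot> (sw s Y Z V \<cdot> cup Y Z t V)"
  using assms(3-) HomD[OF assms(1)] HomD[OF assms(2)]
  by (simp add: scal_def cap_def cup_def sw_def whisker)

text \<open>The morphism \<open>h : W \<rightarrow> Z\<close> obtained by bending \<open>t\<close> with \<open>c\<close> mediates between the two sides.
Of \<open>f = \<Psi> C X Y (Z, t, b)\<close> the right side sees only the morphism, of \<open>g = \<Psi> C Y X (W, u, c)\<close> the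
left side does, so the equation makes the pairing independent of both representatives.\<close>

proposition trace_exchange:
  assumes o: "X \<in> Obj C" "Y \<in> Obj C"
    and T: "(Z, t, b) \<in> triples C X Y" and U: "(W, u, c) \<in> triples C Y X"
  shows "b \<cdot> ((Z \<triangleright> \<Psi> C Y X (W, u, c)) \<cdot> (s Y Z \<cdot> t))
       = c \<cdot> (s Y W \<cdot> ((\<Psi> C X Y (Z, t, b) \<triangleleft> W) \<cdot> u))"
proof -
  define f where "f = \<Psi> C X Y (Z, t, b)"
  define g where "g = \<Psi> C Y X (W, u, c)"
  from T have Z: "Z \<in> Obj C" and t: "t \<in> Hom C \<I> (Y \<otimes>\<^sub>o Z)" and b: "b \<in> Hom C (Z \<otimes>\<^sub>o X) \<I>"
    by (auto simp: triples_def)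
  from U have W: "W \<in> Obj C" and u: "u \<in> Hom C \<I> (X \<otimes>\<^sub>o W)" and c: "c \<in> Hom C (W \<otimes>\<^sub>o Y) \<I>"
    by (auto simp: triples_def)
  have f: "f \<in> Hom C X Y" and g: "g \<in> Hom C Y X"
    using \<Psi>_Hom[OF _ _ T] \<Psi>_Hom[OF _ _ U] o by (auto simp: f_def g_def)
  note [simp] = o Z W t b u c HomD[OF t] HomD[OF b] HomD[OF u] HomD[OF c] HomD[OF f] HomD[OF g]
  obtain h where h: "h \<in> Hom C W Z"
    and hV: "\<And>V. V \<in> Obj C \<Longrightarrow> h \<triangleleft> V = cap W Y c (Z \<otimes>\<^sub>o V) \<cdot> (W \<triangleright> cup Y Z t V)"
    using transpose_whisker[OF \<open>Y \<in> Obj C\<close> Z W t c] by blast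
  note [simp] = HomD[OF h]
  \<comment> \<open>A scalar is determined by its component at \<open>\<I>\<close>.\<close>
  let ?V = \<I>
  have "scal (b \<cdot> ((Z \<triangleright> g) \<cdot> (s Y Z \<cdot> t))) ?V = scal ((b \<cdot> (Z \<triangleright> g)) \<cdot> (s Y Z \<cdot> t)) ?V"
    by simp
  also have "\<dots> = cap Z X b ?V \<cdot> ((Z \<triangleright> (g \<triangleleft> ?V)) \<cdot> (sw s Y Z ?V \<cdot> cup Y Z t ?V))"
    by (subst scal_trace) (auto simp: cap_precomp[OF b g] Hom_iff)
  also have "\<dots> = cap Z X b ?V \<cdot> (sw s X Z ?V \<cdot> ((g \<triangleleft> (Z \<otimes>\<^sub>o ?V)) \<cdot> cup Y Z t ?V))"
    using sw_nat'[of g "Id C Z" "Id C ?V" X Z ?V "cup Y Z t ?V"] by simp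
  \<comment> \<open>The cup \<open>u\<close> of \<open>g\<close> appears and slides past \<open>t\<close>, so that \<open>t\<close> and \<open>c\<close> combine to \<open>h\<close>.\<close>
  also have "\<dots> = cap Z X b ?V \<cdot> (sw s X Z ?V \<cdot> ((X \<triangleright> cap W Y c (Z \<otimes>\<^sub>o ?V)) \<cdot> (cup X W u (Y \<otimes>\<^sub>o Z \<otimes>\<^sub>o ?V)
    \<cdot> cup Y Z t ?V)))"
    unfolding g_def by (subst rwhisker_\<Psi>[OF _ _ _ U]) auto
  also have "\<dots> = cap Z X b ?V \<cdot> (sw s X Z ?V \<cdot> ((X \<triangleright> (h \<triangleleft> ?V)) \<cdot> cup X W u ?V))"
    by (simp add: cup_nat hV whisker)
  also have "\<dots> = cap Z X b ?V \<cdot> ((h \<triangleleft> (X \<otimes>\<^sub>o ?V)) \<cdot> (sw s X W ?V \<cdot> cup X W u ?V))"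
    using sw_nat'[of "Id C X" h "Id C ?V" X Z ?V "cup X W u ?V"] by simp
  \<comment> \<open>Unfolding \<open>h\<close> on the other side of \<open>s\<close> lets \<open>b\<close> pass the cap \<open>c\<close> and meet \<open>t\<close>, which makes
    \<open>f\<close> appear.\<close>
  also have "\<dots> = cap Z X b ?V \<cdot> (cap W Y c (Z \<otimes>\<^sub>o X \<otimes>\<^sub>o ?V) \<cdot> ((W \<triangleright> cup Y Z t (X \<otimes>\<^sub>o ?V)) \<cdot> (sw s X W ?V
    \<cdot> cup X W u ?V)))"
    by (simp add: hV)
  also have "\<dots> = cap W Y c ?V \<cdot> ((W \<triangleright> ((Y \<triangleright> cap Z X b ?V) \<cdot> cup Y Z t (X \<otimes>\<^sub>o ?V))) \<cdot> (sw s X W ?V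
    \<cdot> cup X W u ?V))"
    by (simp add: whisker Comp_extend[OF cap_nat[OF c]])
  also have "\<dots> = cap W Y c ?V \<cdot> ((W \<triangleright> (f \<triangleleft> ?V)) \<cdot> (sw s X W ?V \<cdot> cup X W u ?V))"
    unfolding f_def by (subst rwhisker_\<Psi>[OF _ _ _ T]) auto
  also have "\<dots> = cap W Y c ?V \<cdot> (sw s Y W ?V \<cdot> ((f \<triangleleft> (W \<otimes>\<^sub>o ?V)) \<cdot> cup X W u ?V))"
    using sw_nat'[of f "Id C W" "Id C ?V" Y W ?V "cup X W u ?V"] by simp
  also have "\<dots> = scal (c \<cdot> (s Y W \<cdot> ((f \<triangleleft> W) \<cdot> u))) ?V"
    by (subst scal_trace) (auto simp: cup_postcomp[OF u f] Hom_iff)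
  finally have "scal (b \<cdot> ((Z \<triangleright> g) \<cdot> (s Y Z \<cdot> t))) ?V = scal (c \<cdot> (s Y W \<cdot> ((f \<triangleleft> W) \<cdot> u))) ?V" .
  then show ?thesis
    unfolding f_def[symmetric] g_def[symmetric] by (rule scal_inject[rotated 2]) (simp_all add: Hom_iff)
qed

end

section \<open>Thickened morphisms and the trace pairing\<close>

lemma equivclp_invariant:
  assumes "equivclp R x y" and step: "\<And>x y. R x y \<Longrightarrow> F x = F y"
  shows "F x = F y"
  using assms(1) by (induction rule: equivclp_induct) (auto dest: step)

lemma equivclp_map:
  assumes "equivclp R x y" and step: "\<And>x y. R x y \<Longrightarrow> S (G x) (G y)"
  shows "equivclp S (G x) (G y)"
  using assms(1)
proof (induction rule: equivclp_induct)
  case (step y z)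
  then have "S (G y) (G z) \<or> S (G z) (G y)"
    using assms(2) by blast
  then have "equivclp S (G y) (G z)"
    by (auto intro: r_into_equivclp converse_r_into_equivclp)
  with step.IH show ?case
    by (rule equivclp_trans)
qed simp

context monoidal_category
begin

lemma triplesD:
  assumes "(Z, t, b) \<in> triples C X Y"
  shows "Z \<in> Obj C" "t \<in> Hom C \<I> (Y \<otimes>\<^sub>o Z)" "b \<in> Hom C (Z \<otimes>\<^sub>o X) \<I>"
  using assms by (auto simp: triples_def)

abbreviation triple_class
  where "triple_class X Y T \<equiv> triple_equiv C X Y `` {T}"

lemma equiv_triple_equiv: "equiv (triples C X Y) (triple_equiv C X Y)"
  by (rule equivI)
     (auto simp: triple_equiv_def refl_on_def sym_def trans_def intro: equivclp_sym equivclp_trans)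

lemma Thickened_iff: "fh \<in> Thickened C X Y \<longleftrightarrow> (\<exists>T\<in>triples C X Y. fh = triple_class X Y T)"
  by (auto simp: Thickened_def quotient_def)

text \<open>Operations given on representatives descend to classes as soon as they respect single
steps of the generating relation. This lemma serves for values, the next one for operations
whose result is again a class.\<close>

lemma the_elem_triple_class:
  assumes T: "T \<in> triples C X Y"
    and step: "\<And>T T'. triple_step C X Y T T' \<Longrightarrow> F T = F T'"
  shows "the_elem (F ` triple_class X Y T) = F T"
proof -
  have "F T' = F T" if "T' \<in> triple_class X Y T" for T'
    using that equivclp_invariant[of "triple_step C X Y" T T' F] step
    by (auto simp: triple_equiv_def)
  moreover have "T \<in> triple_class X Y T"
    using T by (auto simp: triple_equiv_def)
  ultimately have "F ` triple_class X Y T = {F T}"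
    by blast
  then show ?thesis
    by simp
qed

lemma Union_triple_class:
  assumes T: "T \<in> triples C X Y"
    and in_triples: "\<And>T. T \<in> triples C X Y \<Longrightarrow> G T \<in> triples C X' Y'"
    and step: "\<And>T T'. triple_step C X Y T T' \<Longrightarrow> triple_step C X' Y' (G T) (G T')"
  shows "(\<Union>T'\<in>triple_class X Y T. triple_class X' Y' (G T')) = triple_class X' Y' (G T)"
proof -
  have "triple_class X' Y' (G T') = triple_class X' Y' (G T)" if "T' \<in> triple_class X Y T" for T'
  proof (rule equiv_class_eq[OF equiv_triple_equiv, symmetric])
    show "(G T, G T') \<in> triple_equiv C X' Y'"
      using that in_triples equivclp_map[of "triple_step C X Y" T T' "triple_step C X' Y'" G] step
      by (auto simp: triple_equiv_def)
  qed
  moreover have "T \<in> triple_class X Y T"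
    using T by (auto simp: triple_equiv_def)
  ultimately show ?thesis
    by blast
qed

text \<open>A morphism between the middle objects can be moved from the cup to the cap by naturality
of the associator.\<close>

lemma triple_step_\<Psi>:
  assumes o: "X \<in> Obj C" "Y \<in> Obj C" and step: "triple_step C X Y T T'"
  shows "\<Psi> C X Y T = \<Psi> C X Y T'"
proof -
  obtain Z t b Z' t' b' where T: "T = (Z, t, b)" "T' = (Z', t', b')"
    by (cases T, cases T')
  with step obtain h where tr: "(Z, t, b) \<in> triples C X Y" "(Z', t', b') \<in> triples C X Y"
    and h: "h \<in> Hom C Z Z'" and eq: "t' = (Y \<triangleright> h) \<cdot> t" "b = b' \<cdot> (h \<triangleleft> X)"
    by auto
  note [simp] = o triplesD(1)[OF tr(1)] triplesD(1)[OF tr(2)] HomD[OF h]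
    HomD[OF triplesD(2)[OF tr(1)]] HomD[OF triplesD(3)[OF tr(2)]]
  show ?thesis
    by (simp add: T eq whisker \<alpha>_nat')
qed

lemma triple_precomp:
  assumes o: "X \<in> Obj C" "Y \<in> Obj C" and T: "(Z, t, b) \<in> triples C X Y" and g: "g \<in> Hom C W X"
  shows "(Z, t, b \<cdot> (Z \<triangleright> g)) \<in> triples C W Y"
    and "\<Psi> C W Y (Z, t, b \<cdot> (Z \<triangleright> g)) = \<Psi> C X Y (Z, t, b) \<cdot> g"
proof -
  note [simp] = o triplesD(1)[OF T] HomD[OF triplesD(2)[OF T]] HomD[OF triplesD(3)[OF T]] HomD[OF g]
    Hom_obj[OF g]
  show "(Z, t, b \<cdot> (Z \<triangleright> g)) \<in> triples C W Y"
    by (simp add: triples_def Hom_iff)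
  show "\<Psi> C W Y (Z, t, b \<cdot> (Z \<triangleright> g)) = \<Psi> C X Y (Z, t, b) \<cdot> g"
    by (simp add: whisker lui_nat interchange' \<alpha>_nat' flip: Tens_Id)
qed

lemma triple_postcomp:
  assumes o: "X \<in> Obj C" "Y \<in> Obj C" and T: "(Z, t, b) \<in> triples C X Y" and h: "h \<in> Hom C Y W"
  shows "(Z, (h \<triangleleft> Z) \<cdot> t, b) \<in> triples C X W"
    and "\<Psi> C X W (Z, (h \<triangleleft> Z) \<cdot> t, b) = h \<cdot> \<Psi> C X Y (Z, t, b)"
proof -
  note [simp] = o triplesD(1)[OF T] HomD[OF triplesD(2)[OF T]] HomD[OF triplesD(3)[OF T]] HomD[OF h]
    Hom_obj[OF h]
  show "(Z, (h \<triangleleft> Z) \<cdot> t, b) \<in> triples C X W"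
    by (simp add: triples_def Hom_iff)
  have "\<Psi> C X W (Z, (h \<triangleleft> Z) \<cdot> t, b)
      = \<rho> W \<cdot> ((W \<triangleright> b) \<cdot> ((h \<triangleleft> (Z \<otimes>\<^sub>o X)) \<cdot> (\<alpha> Y Z X \<cdot> ((t \<triangleleft> X) \<cdot> lui X))))"
    by (simp add: whisker \<alpha>_nat')
  also have "\<dots> = \<rho> W \<cdot> ((h \<triangleleft> \<I>) \<cdot> ((Y \<triangleright> b) \<cdot> (\<alpha> Y Z X \<cdot> ((t \<triangleleft> X) \<cdot> lui X))))"
    by (simp add: interchange')
  also have "\<dots> = h \<cdot> \<Psi> C X Y (Z, t, b)"
    by (simp add: Comp_extend[OF \<rho>_nat])
  finally show "\<Psi> C X W (Z, (h \<triangleleft> Z) \<cdot> t, b) = h \<cdot> \<Psi> C X Y (Z, t, b)" .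
qed

lemma \<Psi>_hat_class:
  assumes "X \<in> Obj C" "Y \<in> Obj C" "T \<in> triples C X Y"
  shows "\<Psi>_hat C X Y (triple_class X Y T) = \<Psi> C X Y T"
  unfolding \<Psi>_hat_def using assms triple_step_\<Psi> by (intro the_elem_triple_class)

lemma thickeners_iff:
  assumes "X \<in> Obj C" "Y \<in> Obj C"
  shows "fh \<in> thickeners C X Y f
    \<longleftrightarrow> (\<exists>Z t b. (Z, t, b) \<in> triples C X Y \<and> fh = triple_class X Y (Z, t, b) \<and> \<Psi> C X Y (Z, t, b) = f)"
proof -
  have "fh \<in> thickeners C X Y f
    \<longleftrightarrow> (\<exists>T \<in> triples C X Y. fh = triple_class X Y T \<and> \<Psi> C X Y T = f)"
    using assms by (auto simp: thickeners_def Thickened_iff \<Psi>_hat_class simp del: \<Psi>.simps)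
  then show ?thesis
    by (simp del: \<Psi>.simps add: Bex_def split_paired_Ex)
qed

lemma precomp_class:
  assumes o: "X \<in> Obj C" "Y \<in> Obj C" and T: "(Z, t, b) \<in> triples C X Y" and g: "g \<in> Hom C W X"
  shows "precomp C W Y (triple_class X Y (Z, t, b)) g = triple_class W Y (Z, t, b \<cdot> (Z \<triangleright> g))"
proof -
  define G where "G = (\<lambda>(Z, t :: 'm, b). (Z, t, b \<cdot> (Z \<triangleright> g)))"
  have "triple_step C W Y (G T) (G T')" if step: "triple_step C X Y T T'" for T T'
  proof -
    obtain Z t b Z' t' b' where T: "T = (Z, t, b)" "T' = (Z', t', b')"
      by (cases T, cases T')
    with step obtain h where tr: "(Z, t, b) \<in> triples C X Y" "(Z', t', b') \<in> triples C X Y"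
      and h: "h \<in> Hom C Z Z'" and eq: "t' = (Y \<triangleright> h) \<cdot> t" "b = b' \<cdot> (h \<triangleleft> X)"
      by auto
    note [simp] = o triplesD(1)[OF tr(1)] triplesD(1)[OF tr(2)] HomD[OF h] HomD[OF g] Hom_obj[OF g]
      HomD[OF triplesD(2)[OF tr(1)]] HomD[OF triplesD(3)[OF tr(2)]]
    have "b \<cdot> (Z \<triangleright> g) = (b' \<cdot> (Z' \<triangleright> g)) \<cdot> (h \<triangleleft> W)"
      by (simp add: eq interchange)
    then show ?thesis
      using triple_precomp(1)[OF o tr(1) g] triple_precomp(1)[OF o tr(2) g] h eq
      by (auto simp: T G_def)
  qed
  moreover have "G T \<in> triples C W Y" if "T \<in> triples C X Y" for T
    using that triple_precomp(1)[OF o _ g] by (cases T) (auto simp: G_def)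
  ultimately have "(\<Union>T'\<in>triple_class X Y (Z, t, b). triple_class W Y (G T'))
    = triple_class W Y (G (Z, t, b))"
    using T by (intro Union_triple_class)
  then show ?thesis
    by (simp add: precomp_def G_def case_prod_beta)
qed

lemma postcomp_class:
  assumes o: "X \<in> Obj C" "Y \<in> Obj C" and T: "(Z, t, b) \<in> triples C X Y" and k: "k \<in> Hom C Y W"
  shows "postcomp C X W k (triple_class X Y (Z, t, b)) = triple_class X W (Z, (k \<triangleleft> Z) \<cdot> t, b)"
proof -
  define G where "G = (\<lambda>(Z, t, b :: 'm). (Z, (k \<triangleleft> Z) \<cdot> t, b))"
  have "triple_step C X W (G T) (G T')" if step: "triple_step C X Y T T'" for T T'
  proof -
    obtain Z t b Z' t' b' where T: "T = (Z, t, b)" "T' = (Z', t', b')"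
      by (cases T, cases T')
    with step obtain h where tr: "(Z, t, b) \<in> triples C X Y" "(Z', t', b') \<in> triples C X Y"
      and h: "h \<in> Hom C Z Z'" and eq: "t' = (Y \<triangleright> h) \<cdot> t" "b = b' \<cdot> (h \<triangleleft> X)"
      by auto
    note [simp] = o triplesD(1)[OF tr(1)] triplesD(1)[OF tr(2)] HomD[OF h] HomD[OF k] Hom_obj[OF k]
      HomD[OF triplesD(2)[OF tr(1)]] HomD[OF triplesD(3)[OF tr(2)]]
    have "(k \<triangleleft> Z') \<cdot> t' = (W \<triangleright> h) \<cdot> ((k \<triangleleft> Z) \<cdot> t)"
      by (simp add: eq interchange')
    then show ?thesis
      using triple_postcomp(1)[OF o tr(1) k] triple_postcomp(1)[OF o tr(2) k] h eq
      by (auto simp: T G_def)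
  qed
  moreover have "G T \<in> triples C X W" if "T \<in> triples C X Y" for T
    using that triple_postcomp(1)[OF o _ k] by (cases T) (auto simp: G_def)
  ultimately have "(\<Union>T'\<in>triple_class X Y (Z, t, b). triple_class X W (G T'))
    = triple_class X W (G (Z, t, b))"
    using T by (intro Union_triple_class)
  then show ?thesis
    by (simp add: postcomp_def G_def case_prod_beta)
qed

lemma Thick_iff: "f \<in> Thick C X Y \<longleftrightarrow> (\<exists>Z t b. (Z, t, b) \<in> triples C X Y \<and> f = \<Psi> C X Y (Z, t, b))"
  unfolding Thick_def image_iff by (simp del: \<Psi>.simps add: Bex_def split_paired_Ex)

lemma Thick_Hom:
  assumes "X \<in> Obj C" "Y \<in> Obj C" "f \<in> Thick C X Y"
  shows "f \<in> Hom C X Y"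
  using assms \<Psi>_Hom unfolding Thick_def by blast

lemma Thick_precomp:
  assumes "X \<in> Obj C" "Y \<in> Obj C" "f \<in> Thick C X Y" "g \<in> Hom C W X"
  shows "f \<cdot> g \<in> Thick C W Y"
  using assms triple_precomp unfolding Thick_iff by metis

lemma Thick_postcomp:
  assumes "X \<in> Obj C" "Y \<in> Obj C" "f \<in> Thick C X Y" "h \<in> Hom C Y W"
  shows "h \<cdot> f \<in> Thick C X W"
  using assms triple_postcomp unfolding Thick_iff by metis

end

context switching
begin

lemma tr_hat_class:
  assumes X: "X \<in> Obj C" and T: "(Z, t, b) \<in> triples C X X"
  shows "tr_hat C s X (triple_class X X (Z, t, b)) = b \<cdot> (s X Z \<cdot> t)"
proof -
  define F where "F = (\<lambda>(Z, t, b). b \<cdot> s X Z \<cdot> t)"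
  have "F T = F T'" if step: "triple_step C X X T T'" for T T'
  proof -
    obtain Z t b Z' t' b' where T: "T = (Z, t, b)" "T' = (Z', t', b')"
      by (cases T, cases T')
    with step obtain h where tr: "(Z, t, b) \<in> triples C X X" "(Z', t', b') \<in> triples C X X"
      and h: "h \<in> Hom C Z Z'" and eq: "t' = (X \<triangleright> h) \<cdot> t" "b = b' \<cdot> (h \<triangleleft> X)"
      by auto
    note [simp] = X triplesD(1)[OF tr(1)] triplesD(1)[OF tr(2)] HomD[OF h]
      HomD[OF triplesD(2)[OF tr(1)]] HomD[OF triplesD(3)[OF tr(2)]]
    show ?thesis
      by (simp add: F_def T eq switch_nat')
  qed
  then have "tr_hat C s X (triple_class X X (Z, t, b)) = F (Z, t, b)"
    unfolding tr_hat_def F_def[symmetric] using T by (intro the_elem_triple_class)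
  then show ?thesis
    using X triplesD(1)[OF T] HomD[OF triplesD(2)[OF T]] HomD[OF triplesD(3)[OF T]]
    by (simp add: F_def)
qed

lemma tr_hat_precomp:
  assumes o: "X \<in> Obj C" "Y \<in> Obj C" and T: "(Z, t, b) \<in> triples C X Y" and g: "g \<in> Hom C Y X"
  shows "tr_hat C s Y (precomp C Y Y (triple_class X Y (Z, t, b)) g) = b \<cdot> ((Z \<triangleright> g) \<cdot> (s Y Z \<cdot> t))"
  using o triplesD(1)[OF T] HomD[OF triplesD(2)[OF T]] HomD[OF triplesD(3)[OF T]] HomD[OF g]
    triple_precomp(1)[OF o T g]
  by (simp add: precomp_class[OF o T g] tr_hat_class)

lemma tr_hat_postcomp:
  assumes o: "X \<in> Obj C" "Y \<in> Obj C" and U: "(W, u, c) \<in> triples C Y X" and f: "f \<in> Hom C X Y"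
  shows "tr_hat C s Y (postcomp C Y Y f (triple_class Y X (W, u, c))) = c \<cdot> (s Y W \<cdot> ((f \<triangleleft> W) \<cdot> u))"
  using o triplesD(1)[OF U] HomD[OF triplesD(2)[OF U]] HomD[OF triplesD(3)[OF U]] HomD[OF f]
    triple_postcomp(1)[OF o(2,1) U f]
  by (simp add: postcomp_class[OF o(2,1) U f] tr_hat_class)

text \<open>By \<open>trace_exchange\<close>, the value from any representative of \<open>f\<close> equals the value from any
representative of \<open>g\<close>. As both morphisms are thick, each has at least one, so all these values
coincide and the description of the pairing determines a unique morphism.\<close>

theorem trace_pairing_eq:
  assumes o: "X \<in> Obj C" "Y \<in> Obj C"
    and T: "(Z, t, b) \<in> triples C X Y" and g: "g \<in> Thick C Y X"
  shows "trace_pairing C s X Y (\<Psi> C X Y (Z, t, b)) g = b \<cdot> ((Z \<triangleright> g) \<cdot> (s Y Z \<cdot> t))"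
proof -
  define f where "f = \<Psi> C X Y (Z, t, b)"
  obtain W u c where U: "(W, u, c) \<in> triples C Y X" and gU: "g = \<Psi> C Y X (W, u, c)"
    using g by (auto simp: Thick_iff simp del: \<Psi>.simps)
  have f: "f \<in> Hom C X Y" and gH: "g \<in> Hom C Y X"
    using \<Psi>_Hom[OF o T] \<Psi>_Hom[OF o(2,1) U] by (auto simp: f_def gU)
  show ?thesis
    unfolding trace_pairing_def f_def[symmetric]
  proof (rule the_equality, intro conjI ballI)
    fix fh assume "fh \<in> thickeners C X Y f"
    then obtain Z' t' b' where T': "(Z', t', b') \<in> triples C X Y"
      "fh = triple_class X Y (Z', t', b')" "f = \<Psi> C X Y (Z', t', b')"
      using o by (auto simp: thickeners_iff simp del: \<Psi>.simps)
    show "b \<cdot> ((Z \<triangleright> g) \<cdot> (s Y Z \<cdot> t)) = tr_hat C s Y (precomp C Y Y fh g)"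
      using trace_exchange[OF o T U] trace_exchange[OF o T'(1) U] tr_hat_precomp[OF o T'(1) gH]
      by (simp add: T'(2) T'(3)[symmetric] f_def[symmetric] gU[symmetric] del: \<Psi>.simps)
  next
    fix gh assume "gh \<in> thickeners C Y X g"
    then obtain W' u' c' where U': "(W', u', c') \<in> triples C Y X"
      "gh = triple_class Y X (W', u', c')" "g = \<Psi> C Y X (W', u', c')"
      using o by (auto simp: thickeners_iff simp del: \<Psi>.simps)
    show "b \<cdot> ((Z \<triangleright> g) \<cdot> (s Y Z \<cdot> t)) = tr_hat C s Y (postcomp C Y Y f gh)"
      using trace_exchange[OF o T U'(1)] tr_hat_postcomp[OF o U'(1) f]
      by (simp add: U'(2) U'(3)[symmetric] f_def[symmetric] del: \<Psi>.simps)
  next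
    fix v
    assume "(\<forall>fh\<in>thickeners C X Y f. v = tr_hat C s Y (precomp C Y Y fh g)) \<and>
      (\<forall>gh\<in>thickeners C Y X g. v = tr_hat C s Y (postcomp C Y Y f gh))"
    moreover have "triple_class X Y (Z, t, b) \<in> thickeners C X Y f"
      using o T by (auto simp: thickeners_iff f_def simp del: \<Psi>.simps)
    ultimately show "v = b \<cdot> ((Z \<triangleright> g) \<cdot> (s Y Z \<cdot> t))"
      using tr_hat_precomp[OF o T gH] by simp
  qed
qed

lemma trace_pairing_Hom:
  assumes o: "X \<in> Obj C" "Y \<in> Obj C" and f: "f \<in> Thick C X Y" and g: "g \<in> Thick C Y X"
  shows "trace_pairing C s X Y f g \<in> Hom C \<I> \<I>"
proof -
  obtain Z t b where T: "(Z, t, b) \<in> triples C X Y" "f = \<Psi> C X Y (Z, t, b)"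
    using f by (auto simp: Thick_iff simp del: \<Psi>.simps)
  show ?thesis
    using o HomD[OF Thick_Hom[OF o(2,1) g]] triplesD(1)[OF T(1)] HomD[OF triplesD(2)[OF T(1)]]
      HomD[OF triplesD(3)[OF T(1)]]
    by (simp add: T(2) trace_pairing_eq[OF o T(1) g] Hom_iff del: \<Psi>.simps)
qed

lemma trace_pairing_sym:
  assumes o: "X \<in> Obj C" "Y \<in> Obj C" and f: "f \<in> Thick C X Y" and g: "g \<in> Thick C Y X"
  shows "trace_pairing C s X Y f g = trace_pairing C s Y X g f"
proof -
  obtain Z t b where T: "(Z, t, b) \<in> triples C X Y" "f = \<Psi> C X Y (Z, t, b)"
    using f by (auto simp: Thick_iff simp del: \<Psi>.simps)
  obtain W u c where U: "(W, u, c) \<in> triples C Y X" "g = \<Psi> C Y X (W, u, c)"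
    using g by (auto simp: Thick_iff simp del: \<Psi>.simps)
  note [simp] = o HomD[OF Thick_Hom[OF o f]] triplesD(1)[OF U(1)] HomD[OF triplesD(2)[OF U(1)]]
  have "trace_pairing C s X Y f g = c \<cdot> (s Y W \<cdot> ((f \<triangleleft> W) \<cdot> u))"
    using trace_pairing_eq[OF o T(1) g] trace_exchange[OF o T(1) U(1)]
    by (simp add: T(2)[symmetric] U(2)[symmetric] del: \<Psi>.simps)
  also have "\<dots> = c \<cdot> ((W \<triangleright> f) \<cdot> (s X W \<cdot> u))"
    by (simp add: switch_nat')
  also have "\<dots> = trace_pairing C s Y X g f"
    using trace_pairing_eq[OF o(2,1) U(1) f] by (simp add: U(2)[symmetric] del: \<Psi>.simps)
  finally show ?thesis .
qed

lemma trace_pairing_eq_trace: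
  assumes o: "X \<in> Obj C" "Y \<in> Obj C" and f: "f \<in> Thick C X Y" and g: "g \<in> Thick C Y X"
    and tp: "trace_property C s Y"
  shows "trace_pairing C s X Y f g = trace C s Y (f \<cdot> g)"
proof -
  obtain Z t b where T: "(Z, t, b) \<in> triples C X Y" "f = \<Psi> C X Y (Z, t, b)"
    using f by (auto simp: Thick_iff simp del: \<Psi>.simps)
  note gH = Thick_Hom[OF o(2,1) g]
  note comp = triple_precomp[OF o T(1) gH]
  let ?fh = "triple_class Y Y (Z, t, b \<cdot> (Z \<triangleright> g))"
  have mem: "?fh \<in> thickeners C Y Y (f \<cdot> g)"
    using o comp by (auto simp: thickeners_iff T(2) simp del: \<Psi>.simps)
  have "trace C s Y (f \<cdot> g) = tr_hat C s Y ?fh"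
    unfolding trace_def
  proof (rule the_equality)
    show "\<forall>fh\<in>thickeners C Y Y (f \<cdot> g). tr_hat C s Y ?fh = tr_hat C s Y fh"
      using tp mem unfolding trace_property_def thickeners_def by auto
  qed (use mem in blast)
  also have "\<dots> = trace_pairing C s X Y f g"
    using trace_pairing_eq[OF o T(1) g] tr_hat_precomp[OF o T(1) gH]
    by (simp add: T(2) precomp_class[OF o T(1) gH] del: \<Psi>.simps)
  finally show ?thesis by simp
qed

end

section \<open>Strong monoidal functors\<close>

context strong_monoidal_functor
begin

lemma F_arr [simp]:
  assumes "f \<in> Arr C"
  shows "FA f \<in> Arr D" "Dom D (FA f) = FO (Dom C f)" "Cod D (FA f) = FO (Cod C f)"
  using FA_in[of f "Dom C f" "Cod C f"] assms by (auto simp: Hom_def)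

lemma F_obj [simp]: "X \<in> Obj C \<Longrightarrow> FO X \<in> Obj D"
  by (rule FO_in)

lemma F_Id: "X \<in> Obj C \<Longrightarrow> FA (Id C X) = Id D (FO X)"
  by (rule FA_Id)

lemma F_Comp:
  assumes "f \<in> Arr C" "g \<in> Arr C" "Cod C f = Dom C g"
  shows "FA (g \<cdot>\<^bsub>C\<^esub> f) = FA g \<cdot>\<^bsub>D\<^esub> FA f"
  using FA_Comp[of f "Dom C f" "Dom C g" g "Cod C g"] assms by (auto simp: Hom_def)

lemma \<phi>_arr [simp]:
  assumes "X \<in> Obj C" "Y \<in> Obj C"
  shows "\<phi> X Y \<in> Arr D" "Dom D (\<phi> X Y) = FO X \<otimes>\<^sub>o\<^bsub>D\<^esub> FO Y" "Cod D (\<phi> X Y) = FO (X \<otimes>\<^sub>o\<^bsub>C\<^esub> Y)"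
    "inv_arr D (\<phi> X Y) \<in> Arr D" "Dom D (inv_arr D (\<phi> X Y)) = FO (X \<otimes>\<^sub>o\<^bsub>C\<^esub> Y)"
    "Cod D (inv_arr D (\<phi> X Y)) = FO X \<otimes>\<^sub>o\<^bsub>D\<^esub> FO Y"
  using \<phi>_in[OF assms] D.inv_arr[OF \<phi>_iso[OF assms]] by (auto simp: Hom_def)

lemma \<phi>\<^sub>0_arr [simp]:
  shows "\<phi>\<^sub>0 \<in> Arr D" "Dom D \<phi>\<^sub>0 = \<I>\<^bsub>D\<^esub>" "Cod D \<phi>\<^sub>0 = FO \<I>\<^bsub>C\<^esub>"
    "inv_arr D \<phi>\<^sub>0 \<in> Arr D" "Dom D (inv_arr D \<phi>\<^sub>0) = FO \<I>\<^bsub>C\<^esub>" "Cod D (inv_arr D \<phi>\<^sub>0) = \<I>\<^bsub>D\<^esub>"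
  using \<phi>\<^sub>0_in D.inv_arr[OF \<phi>\<^sub>0_iso] by (auto simp: Hom_def)

lemma \<phi>_cancel [simp]:
  assumes "X \<in> Obj C" "Y \<in> Obj C" "q \<in> Arr D"
  shows "Cod D q = FO (X \<otimes>\<^sub>o\<^bsub>C\<^esub> Y) \<Longrightarrow> \<phi> X Y \<cdot>\<^bsub>D\<^esub> (inv_arr D (\<phi> X Y) \<cdot>\<^bsub>D\<^esub> q) = q"
  using D.inv_arr_cancel[OF \<phi>_iso] assms by auto

lemma \<phi>\<^sub>0_cancel [simp]:
  assumes "q \<in> Arr D"
  shows "Cod D q = FO \<I>\<^bsub>C\<^esub> \<Longrightarrow> \<phi>\<^sub>0 \<cdot>\<^bsub>D\<^esub> (inv_arr D \<phi>\<^sub>0 \<cdot>\<^bsub>D\<^esub> q) = q"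
  using D.inv_arr_cancel[OF \<phi>\<^sub>0_iso] assms by auto

lemma \<phi>_nat:
  assumes "f \<in> Arr C" "g \<in> Arr C" "X = Cod C f" "Y = Cod C g"
  shows "\<phi> X Y \<cdot>\<^bsub>D\<^esub> (FA f \<otimes>\<^sub>a\<^bsub>D\<^esub> FA g) = FA (f \<otimes>\<^sub>a\<^bsub>C\<^esub> g) \<cdot>\<^bsub>D\<^esub> \<phi> (Dom C f) (Dom C g)"
  using \<phi>_natural[of f "Dom C f" "Cod C f" g "Dom C g" "Cod C g"] assms by (auto simp: Hom_def)

lemma \<phi>_nat_left:
  assumes "f \<in> Arr C" "X = Cod C f" "Y \<in> Obj C"
  shows "\<phi> X Y \<cdot>\<^bsub>D\<^esub> (FA f \<otimes>\<^sub>a\<^bsub>D\<^esub> Id D (FO Y)) = FA (f \<otimes>\<^sub>a\<^bsub>C\<^esub> Id C Y) \<cdot>\<^bsub>D\<^esub> \<phi> (Dom C f) Y"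
  using \<phi>_nat[of f "Id C Y" X Y] assms by (simp add: F_Id)

lemma \<phi>_nat_right:
  assumes "g \<in> Arr C" "Y = Cod C g" "X \<in> Obj C"
  shows "\<phi> X Y \<cdot>\<^bsub>D\<^esub> (Id D (FO X) \<otimes>\<^sub>a\<^bsub>D\<^esub> FA g) = FA (Id C X \<otimes>\<^sub>a\<^bsub>C\<^esub> g) \<cdot>\<^bsub>D\<^esub> \<phi> X (Dom C g)"
  using \<phi>_nat[of "Id C X" g X Y] assms by (simp add: F_Id)

text \<open>The unit axiom of a monoidal functor, solved for the image of the inverse unit constraint,
with which \<open>\<Psi>\<close> begins.\<close>

lemma \<phi>_LUnit_inv:
  assumes X: "X \<in> Obj C"
  shows "\<phi> \<I>\<^bsub>C\<^esub> X \<cdot>\<^bsub>D\<^esub> ((\<phi>\<^sub>0 \<otimes>\<^sub>a\<^bsub>D\<^esub> Id D (FO X)) \<cdot>\<^bsub>D\<^esub> inv_arr D (LUnit D (FO X))) = FA (inv_arr C (LUnit C X))"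
proof -
  note [simp] = X
  have "\<phi> \<I>\<^bsub>C\<^esub> X \<cdot>\<^bsub>D\<^esub> ((\<phi>\<^sub>0 \<otimes>\<^sub>a\<^bsub>D\<^esub> Id D (FO X)) \<cdot>\<^bsub>D\<^esub> inv_arr D (LUnit D (FO X)))
    = FA (inv_arr C (LUnit C X) \<cdot>\<^bsub>C\<^esub> LUnit C X) \<cdot>\<^bsub>D\<^esub> (\<phi> \<I>\<^bsub>C\<^esub> X \<cdot>\<^bsub>D\<^esub> ((\<phi>\<^sub>0 \<otimes>\<^sub>a\<^bsub>D\<^esub> Id D (FO X)) \<cdot>\<^bsub>D\<^esub> inv_arr D (LUnit D (FO X))))"
    by (simp add: F_Id)
  also have "\<dots> = FA (inv_arr C (LUnit C X)) \<cdot>\<^bsub>D\<^esub> ((FA (LUnit C X) \<cdot>\<^bsub>D\<^esub> \<phi> \<I>\<^bsub>C\<^esub> X \<cdot>\<^bsub>D\<^esub> (\<phi>\<^sub>0 \<otimes>\<^sub>a\<^bsub>D\<^esub> Id D (FO X)))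
    \<cdot>\<^bsub>D\<^esub> inv_arr D (LUnit D (FO X)))"
    by (simp add: F_Comp del: C.structure_cancel)
  also have "\<dots> = FA (inv_arr C (LUnit C X))"
    unfolding \<phi>_LUnit[OF X] by simp
  finally show ?thesis .
qed

definition F_triple :: "'o \<Rightarrow> 'o \<Rightarrow> 'o \<times> 'm \<times> 'm \<Rightarrow> 'p \<times> 'n \<times> 'n"
  where "F_triple X Y T = (case T of (Z, t, b) \<Rightarrow>
    (FO Z, inv_arr D (\<phi> Y Z) \<cdot>\<^bsub>D\<^esub> (FA t \<cdot>\<^bsub>D\<^esub> \<phi>\<^sub>0), inv_arr D \<phi>\<^sub>0 \<cdot>\<^bsub>D\<^esub> (FA b \<cdot>\<^bsub>D\<^esub> \<phi> Z X)))"

lemma F_triple_in: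
  assumes "X \<in> Obj C" "Y \<in> Obj C" "T \<in> triples C X Y"
  shows "F_triple X Y T \<in> triples D (FO X) (FO Y)"
  using assms by (auto simp: F_triple_def triples_def Hom_def)

text \<open>The structure isomorphisms introduced by conjugating \<open>F t\<close> and \<open>F b\<close> travel through the
composite by naturality and cancel: the unit axioms consume \<open>\<phi>\<^sub>0\<close> at both ends and the
associativity axiom exchanges the associators in between.\<close>

lemma F_\<Psi>:
  assumes o: "X \<in> Obj C" "Y \<in> Obj C" and T: "T \<in> triples C X Y"
  shows "\<Psi> D (FO X) (FO Y) (F_triple X Y T) = FA (\<Psi> C X Y T)"
proof -
  obtain Z t b where Teq: "T = (Z, t, b)" by (cases T)
  note [simp] = o C.triplesD(1)[OF T[unfolded Teq]] HomD[OF C.triplesD(2)[OF T[unfolded Teq]]]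
    HomD[OF C.triplesD(3)[OF T[unfolded Teq]]]
  let ?Y = "Id D (FO Y)" and ?X = "Id D (FO X)" and ?l = "inv_arr D (LUnit D (FO X))"
  let ?r = "((FA t \<cdot>\<^bsub>D\<^esub> \<phi>\<^sub>0) \<otimes>\<^sub>a\<^bsub>D\<^esub> ?X) \<cdot>\<^bsub>D\<^esub> ?l"
  let ?q = "Assoc D (FO Y) (FO Z) (FO X) \<cdot>\<^bsub>D\<^esub> ((inv_arr D (\<phi> Y Z) \<otimes>\<^sub>a\<^bsub>D\<^esub> ?X) \<cdot>\<^bsub>D\<^esub> ?r)"
  have "\<Psi> D (FO X) (FO Y) (F_triple X Y T) = RUnit D (FO Y) \<cdot>\<^bsub>D\<^esub>
      ((?Y \<otimes>\<^sub>a\<^bsub>D\<^esub> (inv_arr D \<phi>\<^sub>0 \<cdot>\<^bsub>D\<^esub> (FA b \<cdot>\<^bsub>D\<^esub> \<phi> Z X))) \<cdot>\<^bsub>D\<^esub> ?q)"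
    by (simp add: F_triple_def Teq D.rwhisker_Comp)
  also have "\<dots> = FA (RUnit C Y) \<cdot>\<^bsub>D\<^esub> (\<phi> Y \<I>\<^bsub>C\<^esub> \<cdot>\<^bsub>D\<^esub> ((?Y \<otimes>\<^sub>a\<^bsub>D\<^esub> (\<phi>\<^sub>0 \<cdot>\<^bsub>D\<^esub> (inv_arr D \<phi>\<^sub>0 \<cdot>\<^bsub>D\<^esub> (FA b \<cdot>\<^bsub>D\<^esub> \<phi> Z X)))) \<cdot>\<^bsub>D\<^esub> ?q))"
    by (simp add: \<phi>_RUnit[symmetric] D.lwhisker_Comp del: \<phi>\<^sub>0_cancel)
  also have "\<dots> = FA (RUnit C Y) \<cdot>\<^bsub>D\<^esub> (\<phi> Y \<I>\<^bsub>C\<^esub> \<cdot>\<^bsub>D\<^esub> ((?Y \<otimes>\<^sub>a\<^bsub>D\<^esub> FA b) \<cdot>\<^bsub>D\<^esub> ((?Y \<otimes>\<^sub>a\<^bsub>D\<^esub> \<phi> Z X) \<cdot>\<^bsub>D\<^esub> ?q)))"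
    by (simp add: D.lwhisker_Comp)
  also have "\<dots> = FA (RUnit C Y) \<cdot>\<^bsub>D\<^esub> (FA (Id C Y \<otimes>\<^sub>a\<^bsub>C\<^esub> b) \<cdot>\<^bsub>D\<^esub> ((\<phi> Y (Z \<otimes>\<^sub>o\<^bsub>C\<^esub> X) \<cdot>\<^bsub>D\<^esub> (?Y \<otimes>\<^sub>a\<^bsub>D\<^esub> \<phi> Z X)
    \<cdot>\<^bsub>D\<^esub> Assoc D (FO Y) (FO Z) (FO X)) \<cdot>\<^bsub>D\<^esub>
      ((inv_arr D (\<phi> Y Z) \<otimes>\<^sub>a\<^bsub>D\<^esub> ?X) \<cdot>\<^bsub>D\<^esub> ?r)))"
    by (simp add: D.Comp_extend[OF \<phi>_nat_right])
  also have "\<dots> = FA (RUnit C Y) \<cdot>\<^bsub>D\<^esub> (FA (Id C Y \<otimes>\<^sub>a\<^bsub>C\<^esub> b) \<cdot>\<^bsub>D\<^esub> (FA (Assoc C Y Z X) \<cdot>\<^bsub>D\<^esub> (\<phi> (Y \<otimes>\<^sub>o\<^bsub>C\<^esub> Z) X \<cdot>\<^bsub>D\<^esub>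
      (((\<phi> Y Z \<cdot>\<^bsub>D\<^esub> (inv_arr D (\<phi> Y Z) \<cdot>\<^bsub>D\<^esub> (FA t \<cdot>\<^bsub>D\<^esub> \<phi>\<^sub>0))) \<otimes>\<^sub>a\<^bsub>D\<^esub> ?X) \<cdot>\<^bsub>D\<^esub> ?l))))"
    by (subst \<phi>_Assoc[symmetric]) (simp_all add: D.rwhisker_Comp del: \<phi>_cancel)
  also have "\<dots> = FA (RUnit C Y) \<cdot>\<^bsub>D\<^esub> (FA (Id C Y \<otimes>\<^sub>a\<^bsub>C\<^esub> b) \<cdot>\<^bsub>D\<^esub> (FA (Assoc C Y Z X) \<cdot>\<^bsub>D\<^esub> (FA (t \<otimes>\<^sub>a\<^bsub>C\<^esub> Id C X) \<cdot>\<^bsub>D\<^esub>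
      (\<phi> \<I>\<^bsub>C\<^esub> X \<cdot>\<^bsub>D\<^esub> ((\<phi>\<^sub>0 \<otimes>\<^sub>a\<^bsub>D\<^esub> ?X) \<cdot>\<^bsub>D\<^esub> ?l)))))"
    by (simp add: D.rwhisker_Comp D.Comp_extend[OF \<phi>_nat_left])
  also have "\<dots> = FA (\<Psi> C X Y T)"
    by (simp add: \<phi>_LUnit_inv F_Comp Teq)
  finally show ?thesis .
qed

lemma F_Thick:
  assumes "X \<in> Obj C" "Y \<in> Obj C" "f \<in> Thick C X Y"
  shows "FA f \<in> Thick D (FO X) (FO Y)"
proof -
  obtain T where "T \<in> triples C X Y" "f = \<Psi> C X Y T"
    using assms(3) unfolding Thick_def by blast
  then show ?thesis
    using F_triple_in[OF assms(1,2)] F_\<Psi>[OF assms(1,2)] unfolding Thick_def image_iff by metis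
qed

text \<open>With the representative of \<open>F f\<close> from \<open>F_triple\<close>, the structure isomorphisms cancel
pairwise past \<open>F g\<close> (naturality) and past the switching isomorphism (compatibility); what
remains is the conjugation by \<open>\<phi>\<^sub>0\<close>.\<close>

theorem F_trace_pairing:
  assumes sC: "switching C s" and sD: "switching D s'"
    and compat: "switching_compatible C s D s' FO FA \<phi>"
    and o: "X \<in> Obj C" "Y \<in> Obj C" and f: "f \<in> Thick C X Y" and g: "g \<in> Thick C Y X"
  shows "inv_arr D \<phi>\<^sub>0 \<cdot>\<^bsub>D\<^esub> FA (trace_pairing C s X Y f g) \<cdot>\<^bsub>D\<^esub> \<phi>\<^sub>0
    = trace_pairing D s' (FO X) (FO Y) (FA f) (FA g)"
proof -
  interpret sC: switching C s by fact
  interpret sD: switching D s' by fact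
  obtain Z t b where T: "(Z, t, b) \<in> triples C X Y" "f = \<Psi> C X Y (Z, t, b)"
    using f by (auto simp: C.Thick_iff simp del: \<Psi>.simps)
  note [simp] = o C.triplesD(1)[OF T(1)] HomD[OF C.triplesD(2)[OF T(1)]]
    HomD[OF C.triplesD(3)[OF T(1)]] HomD[OF C.Thick_Hom[OF o(2,1) g]]
  have compat': "\<phi> Z Y \<cdot>\<^bsub>D\<^esub> s' (FO Y) (FO Z) = FA (s Y Z) \<cdot>\<^bsub>D\<^esub> \<phi> Y Z"
    using compat by (simp add: switching_compatible_def)
  let ?t = "inv_arr D (\<phi> Y Z) \<cdot>\<^bsub>D\<^esub> (FA t \<cdot>\<^bsub>D\<^esub> \<phi>\<^sub>0)" and ?b = "inv_arr D \<phi>\<^sub>0 \<cdot>\<^bsub>D\<^esub> (FA b \<cdot>\<^bsub>D\<^esub> \<phi> Z X)"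
  have FT: "(FO Z, ?t, ?b) \<in> triples D (FO X) (FO Y)" "FA f = \<Psi> D (FO X) (FO Y) (FO Z, ?t, ?b)"
    using F_triple_in[OF o T(1)] F_\<Psi>[OF o T(1)] by (simp_all add: F_triple_def T(2))
  have "trace_pairing D s' (FO X) (FO Y) (FA f) (FA g)
    = ?b \<cdot>\<^bsub>D\<^esub> ((Id D (FO Z) \<otimes>\<^sub>a\<^bsub>D\<^esub> FA g) \<cdot>\<^bsub>D\<^esub> (s' (FO Y) (FO Z) \<cdot>\<^bsub>D\<^esub> ?t))"
    unfolding FT(2) using FT(1) F_Thick[OF o(2,1) g] by (intro sD.trace_pairing_eq) simp_all
  also have "\<dots> = inv_arr D \<phi>\<^sub>0 \<cdot>\<^bsub>D\<^esub> FA (b \<cdot>\<^bsub>C\<^esub> ((Id C Z \<otimes>\<^sub>a\<^bsub>C\<^esub> g) \<cdot>\<^bsub>C\<^esub> (s Y Z \<cdot>\<^bsub>C\<^esub> t))) \<cdot>\<^bsub>D\<^esub> \<phi>\<^sub>0"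
    by (simp add: F_Comp D.Comp_extend[OF \<phi>_nat_right] D.Comp_extend[OF compat'])
  also have "b \<cdot>\<^bsub>C\<^esub> ((Id C Z \<otimes>\<^sub>a\<^bsub>C\<^esub> g) \<cdot>\<^bsub>C\<^esub> (s Y Z \<cdot>\<^bsub>C\<^esub> t)) = trace_pairing C s X Y f g"
    unfolding T(2) by (rule sC.trace_pairing_eq[OF o T(1) g, symmetric])
  finally show ?thesis ..
qed

end

section \<open>Tensor products of thick morphisms\<close>

context monoidal_category
begin

text \<open>By the pentagon and Kelly's lemma, a tensor factor on the right is absorbed into the index
of the family. This makes the families of nested cups computable; caps behave dually.\<close>

lemma cup_tensor_right:
  assumes o: "Y \<in> Obj C" "Z \<in> Obj C" "W \<in> Obj C" "V \<in> Obj C" and t: "t \<in> Hom C \<I> (Y \<otimes>\<^sub>o Z)"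
  shows "(Y \<triangleright> \<alpha> Z W V) \<cdot> (\<alpha> Y (Z \<otimes>\<^sub>o W) V \<cdot> (cup Y Z t W \<triangleleft> V)) = cup Y Z t (W \<otimes>\<^sub>o V)"
proof -
  note [simp] = o HomD[OF t]
  have "(Y \<triangleright> \<alpha> Z W V) \<cdot> (\<alpha> Y (Z \<otimes>\<^sub>o W) V \<cdot> (cup Y Z t W \<triangleleft> V))
    = ((Y \<triangleright> \<alpha> Z W V) \<cdot> (\<alpha> Y (Z \<otimes>\<^sub>o W) V \<cdot> (\<alpha> Y Z W \<triangleleft> V))) \<cdot> (((t \<triangleleft> W) \<triangleleft> V) \<cdot> (lui W \<triangleleft> V))"
    by (simp add: cup_def whisker)
  also have "\<dots> = \<alpha> Y Z (W \<otimes>\<^sub>o V) \<cdot> (\<alpha> (Y \<otimes>\<^sub>o Z) W V \<cdot> (((t \<triangleleft> W) \<triangleleft> V) \<cdot> (lui W \<triangleleft> V)))"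
    unfolding pentagon'[OF o(1-4)] by simp
  also have "\<dots> = cup Y Z t (W \<otimes>\<^sub>o V)"
    by (simp add: cup_def \<alpha>_nat' LUnit_Tens_inv)
  finally show ?thesis .
qed

lemma cap_tensor_right:
  assumes o: "Z \<in> Obj C" "X \<in> Obj C" "W \<in> Obj C" "V \<in> Obj C" and b: "b \<in> Hom C (Z \<otimes>\<^sub>o X) \<I>"
  shows "(cap Z X b W \<triangleleft> V) \<cdot> \<alpha>i Z (X \<otimes>\<^sub>o W) V = cap Z X b (W \<otimes>\<^sub>o V) \<cdot> (Z \<triangleright> \<alpha> X W V)"
proof -
  note [simp] = o HomD[OF b]
  have "((b \<triangleleft> W) \<triangleleft> V) \<cdot> (\<alpha>i (Z \<otimes>\<^sub>o X) W V \<cdot> q) = \<alpha>i \<I> W V \<cdot> ((b \<triangleleft> (W \<otimes>\<^sub>o V)) \<cdot> q)"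
    if "q \<in> Arr C" "Cod C q = (Z \<otimes>\<^sub>o X) \<otimes>\<^sub>o W \<otimes>\<^sub>o V" for q
    using that \<alpha>i_nat'[of b "Id C W" "Id C V" \<I> W V q] by simp
  moreover have "(lu W \<triangleleft> V) \<cdot> (\<alpha>i \<I> W V \<cdot> q) = lu (W \<otimes>\<^sub>o V) \<cdot> q"
    if "q \<in> Arr C" "Cod C q = \<I> \<otimes>\<^sub>o W \<otimes>\<^sub>o V" for q
    using that by (simp flip: LUnit_Tens)
  ultimately show ?thesis
    by (simp add: cap_def whisker pentagon_inv_long)
qed

text \<open>The second cup is inserted between the legs of the first one, giving \<open>Y1 \<otimes> Y2 \<otimes> Z2 \<otimes> Z1\<close>;
the caps are nested accordingly. The reversed order of the middle objects avoids any crossing of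
strands.\<close>

definition tensor_cup :: "'o \<Rightarrow> 'o \<Rightarrow> 'm \<Rightarrow> 'o \<Rightarrow> 'o \<Rightarrow> 'm \<Rightarrow> 'm"
  where "tensor_cup Y1 Z1 t1 Y2 Z2 t2 = \<alpha>i Y1 Y2 (Z2 \<otimes>\<^sub>o Z1) \<cdot> ((Y1 \<triangleright> cup Y2 Z2 t2 Z1) \<cdot> t1)"

definition tensor_cap :: "'o \<Rightarrow> 'o \<Rightarrow> 'm \<Rightarrow> 'o \<Rightarrow> 'o \<Rightarrow> 'm \<Rightarrow> 'm"
  where "tensor_cap Z1 X1 b1 Z2 X2 b2 = b2 \<cdot> ((Z2 \<triangleright> cap Z1 X1 b1 X2) \<cdot> \<alpha> Z2 Z1 (X1 \<otimes>\<^sub>o X2))"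

lemma tensor_cup_Hom:
  assumes "Y1 \<in> Obj C" "Z1 \<in> Obj C" "Y2 \<in> Obj C" "Z2 \<in> Obj C"
    and "t1 \<in> Hom C \<I> (Y1 \<otimes>\<^sub>o Z1)" "t2 \<in> Hom C \<I> (Y2 \<otimes>\<^sub>o Z2)"
  shows "tensor_cup Y1 Z1 t1 Y2 Z2 t2 \<in> Hom C \<I> ((Y1 \<otimes>\<^sub>o Y2) \<otimes>\<^sub>o Z2 \<otimes>\<^sub>o Z1)"
  using assms(1-4,6) HomD[OF assms(5)] by (simp add: tensor_cup_def Hom_iff)

lemma tensor_cap_Hom:
  assumes "X1 \<in> Obj C" "Z1 \<in> Obj C" "X2 \<in> Obj C" "Z2 \<in> Obj C"
    and "b1 \<in> Hom C (Z1 \<otimes>\<^sub>o X1) \<I>" "b2 \<in> Hom C (Z2 \<otimes>\<^sub>o X2) \<I>"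
  shows "tensor_cap Z1 X1 b1 Z2 X2 b2 \<in> Hom C ((Z2 \<otimes>\<^sub>o Z1) \<otimes>\<^sub>o X1 \<otimes>\<^sub>o X2) \<I>"
  using assms(1-5) HomD[OF assms(6)] by (simp add: tensor_cap_def Hom_iff)

lemma cup_tensor_cup:
  assumes o: "Y1 \<in> Obj C" "Z1 \<in> Obj C" "Y2 \<in> Obj C" "Z2 \<in> Obj C" "V \<in> Obj C"
    and t: "t1 \<in> Hom C \<I> (Y1 \<otimes>\<^sub>o Z1)" "t2 \<in> Hom C \<I> (Y2 \<otimes>\<^sub>o Z2)"
  shows "\<alpha> Y1 Y2 (Z2 \<otimes>\<^sub>o Z1 \<otimes>\<^sub>o V) \<cdot> (((Y1 \<otimes>\<^sub>o Y2) \<triangleright> \<alpha> Z2 Z1 V)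
      \<cdot> cup (Y1 \<otimes>\<^sub>o Y2) (Z2 \<otimes>\<^sub>o Z1) (tensor_cup Y1 Z1 t1 Y2 Z2 t2) V)
    = (Y1 \<triangleright> cup Y2 Z2 t2 (Z1 \<otimes>\<^sub>o V)) \<cdot> cup Y1 Z1 t1 V"
proof -
  note [simp] = o t HomD[OF t(1)]
  have "\<alpha> Y1 Y2 (Z2 \<otimes>\<^sub>o Z1 \<otimes>\<^sub>o V) \<cdot> (((Y1 \<otimes>\<^sub>o Y2) \<triangleright> \<alpha> Z2 Z1 V)
      \<cdot> cup (Y1 \<otimes>\<^sub>o Y2) (Z2 \<otimes>\<^sub>o Z1) (tensor_cup Y1 Z1 t1 Y2 Z2 t2) V)
    = (Y1 \<triangleright> (Y2 \<triangleright> \<alpha> Z2 Z1 V)) \<cdot> (\<alpha> Y1 Y2 ((Z2 \<otimes>\<^sub>o Z1) \<otimes>\<^sub>o V) \<cdot> (\<alpha> (Y1 \<otimes>\<^sub>o Y2) (Z2 \<otimes>\<^sub>o Z1) V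
      \<cdot> ((\<alpha>i Y1 Y2 (Z2 \<otimes>\<^sub>o Z1) \<triangleleft> V) \<cdot> (((Y1 \<triangleright> cup Y2 Z2 t2 Z1) \<triangleleft> V) \<cdot> ((t1 \<triangleleft> V) \<cdot> lui V)))))"
    by (subst cup_def) (simp add: Comp_extend[OF \<alpha>_nat_right] tensor_cup_def whisker)
  also have "\<dots> = (Y1 \<triangleright> (Y2 \<triangleright> \<alpha> Z2 Z1 V)) \<cdot> ((Y1 \<triangleright> \<alpha> Y2 (Z2 \<otimes>\<^sub>o Z1) V)
      \<cdot> (\<alpha> Y1 (Y2 \<otimes>\<^sub>o Z2 \<otimes>\<^sub>o Z1) V \<cdot> (((Y1 \<triangleright> cup Y2 Z2 t2 Z1) \<triangleleft> V) \<cdot> ((t1 \<triangleleft> V) \<cdot> lui V))))"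
    by (simp add: Comp_extend[OF pentagon_inv_left])
  also have "\<dots> = (Y1 \<triangleright> ((Y2 \<triangleright> \<alpha> Z2 Z1 V) \<cdot> (\<alpha> Y2 (Z2 \<otimes>\<^sub>o Z1) V \<cdot> (cup Y2 Z2 t2 Z1 \<triangleleft> V)))) \<cdot> cup Y1 Z1 t1 V"
    by (simp add: \<alpha>_nat' whisker) (simp add: cup_def)
  finally show ?thesis
    by (simp add: cup_tensor_right)
qed

lemma cap_tensor_cap:
  assumes o: "X1 \<in> Obj C" "Z1 \<in> Obj C" "X2 \<in> Obj C" "Z2 \<in> Obj C" "V \<in> Obj C"
    and b: "b1 \<in> Hom C (Z1 \<otimes>\<^sub>o X1) \<I>" "b2 \<in> Hom C (Z2 \<otimes>\<^sub>o X2) \<I>"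
  shows "cap (Z2 \<otimes>\<^sub>o Z1) (X1 \<otimes>\<^sub>o X2) (tensor_cap Z1 X1 b1 Z2 X2 b2) V
    = cap Z2 X2 b2 V \<cdot> ((Z2 \<triangleright> cap Z1 X1 b1 (X2 \<otimes>\<^sub>o V)) \<cdot> ((Z2 \<triangleright> (Z1 \<triangleright> \<alpha> X1 X2 V))
      \<cdot> \<alpha> Z2 Z1 ((X1 \<otimes>\<^sub>o X2) \<otimes>\<^sub>o V)))"
proof -
  note [simp] = o b HomD[OF b(2)]
  have nat: "((Z2 \<triangleright> cap Z1 X1 b1 X2) \<triangleleft> V) \<cdot> (\<alpha>i Z2 (Z1 \<otimes>\<^sub>o X1 \<otimes>\<^sub>o X2) V \<cdot> q)
      = \<alpha>i Z2 X2 V \<cdot> ((Z2 \<triangleright> (cap Z1 X1 b1 X2 \<triangleleft> V)) \<cdot> q)"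
    if "q \<in> Arr C" "Cod C q = Z2 \<otimes>\<^sub>o (Z1 \<otimes>\<^sub>o X1 \<otimes>\<^sub>o X2) \<otimes>\<^sub>o V" for q
    using that \<alpha>i_nat'[of "Id C Z2" "cap Z1 X1 b1 X2" "Id C V" Z2 X2 V q] by simp
  have "cap (Z2 \<otimes>\<^sub>o Z1) (X1 \<otimes>\<^sub>o X2) (tensor_cap Z1 X1 b1 Z2 X2 b2) V
    = lu V \<cdot> ((b2 \<triangleleft> V) \<cdot> (((Z2 \<triangleright> cap Z1 X1 b1 X2) \<triangleleft> V)
      \<cdot> ((\<alpha> Z2 Z1 (X1 \<otimes>\<^sub>o X2) \<triangleleft> V) \<cdot> \<alpha>i (Z2 \<otimes>\<^sub>o Z1) (X1 \<otimes>\<^sub>o X2) V)))"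
    by (subst cap_def) (simp add: tensor_cap_def whisker)
  also have "\<dots> = lu V \<cdot> ((b2 \<triangleleft> V) \<cdot> (\<alpha>i Z2 X2 V \<cdot> ((Z2 \<triangleright> ((cap Z1 X1 b1 X2 \<triangleleft> V)
      \<cdot> \<alpha>i Z1 (X1 \<otimes>\<^sub>o X2) V)) \<cdot> \<alpha> Z2 Z1 ((X1 \<otimes>\<^sub>o X2) \<otimes>\<^sub>o V))))"
    by (simp add: pentagon_inv_right nat whisker)
  also have "\<dots> = cap Z2 X2 b2 V \<cdot> ((Z2 \<triangleright> ((cap Z1 X1 b1 X2 \<triangleleft> V)
      \<cdot> \<alpha>i Z1 (X1 \<otimes>\<^sub>o X2) V)) \<cdot> \<alpha> Z2 Z1 ((X1 \<otimes>\<^sub>o X2) \<otimes>\<^sub>o V))"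
    by (simp add: cap_def[of Z2])
  finally show ?thesis
    by (simp add: cap_tensor_right whisker)
qed

lemma tensor_cap_precomp:
  assumes o: "X1 \<in> Obj C" "Z1 \<in> Obj C" "X2 \<in> Obj C" "Z2 \<in> Obj C"
    and b: "b1 \<in> Hom C (Z1 \<otimes>\<^sub>o X1) \<I>" "b2 \<in> Hom C (Z2 \<otimes>\<^sub>o X2) \<I>"
    and g: "g1 \<in> Hom C Y1 X1" "g2 \<in> Hom C Y2 X2"
  shows "tensor_cap Z1 Y1 (b1 \<cdot> (Z1 \<triangleright> g1)) Z2 Y2 (b2 \<cdot> (Z2 \<triangleright> g2))
    = tensor_cap Z1 X1 b1 Z2 X2 b2 \<cdot> ((Z2 \<otimes>\<^sub>o Z1) \<triangleright> (g1 \<otimes>\<^sub>a g2))"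
proof -
  note [simp] = o b HomD[OF b(2)] HomD[OF g(1)] HomD[OF g(2)] Hom_obj[OF g(1)] Hom_obj[OF g(2)]
  have split: "g1 \<otimes>\<^sub>a g2 = (X1 \<triangleright> g2) \<cdot> (g1 \<triangleleft> Y2)"
    by (simp add: Tens_Comp)
  have cap1: "cap Z1 Y1 (b1 \<cdot> (Z1 \<triangleright> g1)) Y2 = cap Z1 X1 b1 Y2 \<cdot> (Z1 \<triangleright> (g1 \<triangleleft> Y2))"
    by (rule cap_precomp[OF b(1) g(1)]) simp_all
  have "tensor_cap Z1 X1 b1 Z2 X2 b2 \<cdot> ((Z2 \<otimes>\<^sub>o Z1) \<triangleright> (g1 \<otimes>\<^sub>a g2))
    = b2 \<cdot> ((Z2 \<triangleright> (cap Z1 X1 b1 X2 \<cdot> (Z1 \<triangleright> (X1 \<triangleright> g2)))) \<cdot> ((Z2 \<triangleright> (Z1 \<triangleright> (g1 \<triangleleft> Y2))) \<cdot> \<alpha> Z2 Z1 (Y1 \<otimes>\<^sub>o Y2)))"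
    by (simp add: tensor_cap_def \<alpha>_nat_right Comp_extend[OF \<alpha>_nat_right] split whisker)
  also have "\<dots> = tensor_cap Z1 Y1 (b1 \<cdot> (Z1 \<triangleright> g1)) Z2 Y2 (b2 \<cdot> (Z2 \<triangleright> g2))"
    by (simp add: cap_nat[OF b(1)] tensor_cap_def cap1 whisker)
  finally show ?thesis ..
qed

text \<open>The strands of \<open>f1\<close> and \<open>f2\<close> do not cross, so the inner cup of \<open>f2\<close> can be created after
the cap of \<open>f1\<close> has been applied. This is naturality of \<open>cup Y2 Z2 t2\<close> with respect to that cap.
The comparison is made after tensoring with \<open>\<I>\<close>, where the families are available.\<close>

proposition \<Psi>_tensor:
  assumes o: "X1 \<in> Obj C" "Y1 \<in> Obj C" "X2 \<in> Obj C" "Y2 \<in> Obj C"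
    and T1: "(Z1, t1, b1) \<in> triples C X1 Y1" and T2: "(Z2, t2, b2) \<in> triples C X2 Y2"
  defines "T \<equiv> (Z2 \<otimes>\<^sub>o Z1, tensor_cup Y1 Z1 t1 Y2 Z2 t2, tensor_cap Z1 X1 b1 Z2 X2 b2)"
  shows "T \<in> triples C (X1 \<otimes>\<^sub>o X2) (Y1 \<otimes>\<^sub>o Y2)"
    and "\<Psi> C (X1 \<otimes>\<^sub>o X2) (Y1 \<otimes>\<^sub>o Y2) T = \<Psi> C X1 Y1 (Z1, t1, b1) \<otimes>\<^sub>a \<Psi> C X2 Y2 (Z2, t2, b2)"
proof -
  note [simp] = o triplesD[OF T1] triplesD[OF T2]
  show T: "T \<in> triples C (X1 \<otimes>\<^sub>o X2) (Y1 \<otimes>\<^sub>o Y2)"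
    using tensor_cup_Hom[of Y1 Z1 Y2 Z2 t1 t2] tensor_cap_Hom[of X1 Z1 X2 Z2 b1 b2]
    by (simp add: T_def triples_def)
  note [simp] = triplesD[OF T[unfolded T_def]]
  define f1 where "f1 = \<Psi> C X1 Y1 (Z1, t1, b1)"
  define f2 where "f2 = \<Psi> C X2 Y2 (Z2, t2, b2)"
  define f where "f = \<Psi> C (X1 \<otimes>\<^sub>o X2) (Y1 \<otimes>\<^sub>o Y2) T"
  have fH: "f1 \<in> Hom C X1 Y1" "f2 \<in> Hom C X2 Y2" "f \<in> Hom C (X1 \<otimes>\<^sub>o X2) (Y1 \<otimes>\<^sub>o Y2)"
    unfolding f1_def f2_def f_def
    using \<Psi>_Hom[OF _ _ T1] \<Psi>_Hom[OF _ _ T2] \<Psi>_Hom[OF _ _ T] by auto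
  note [simp] = HomD[OF fH(1)] HomD[OF fH(2)] HomD[OF fH(3)]
  let ?V = \<I> let ?V' = "(X1 \<otimes>\<^sub>o X2) \<otimes>\<^sub>o \<I>"
  let ?cup = "cup (Y1 \<otimes>\<^sub>o Y2) (Z2 \<otimes>\<^sub>o Z1) (tensor_cup Y1 Z1 t1 Y2 Z2 t2) ?V'"
  let ?b = "cap Z2 X2 b2 ?V \<cdot> ((Z2 \<triangleright> cap Z1 X1 b1 (X2 \<otimes>\<^sub>o ?V)) \<cdot> (Z2 \<triangleright> (Z1 \<triangleright> \<alpha> X1 X2 ?V)))"
  have w1: "f1 \<triangleleft> V = (Y1 \<triangleright> cap Z1 X1 b1 V) \<cdot> cup Y1 Z1 t1 (X1 \<otimes>\<^sub>o V)" if "V \<in> Obj C" for V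
    using that rwhisker_\<Psi>[OF _ _ _ T1] by (simp add: f1_def del: \<Psi>.simps)
  have w2: "f2 \<triangleleft> V = (Y2 \<triangleright> cap Z2 X2 b2 V) \<cdot> cup Y2 Z2 t2 (X2 \<otimes>\<^sub>o V)" if "V \<in> Obj C" for V
    using that rwhisker_\<Psi>[OF _ _ _ T2] by (simp add: f2_def del: \<Psi>.simps)
  have slide: "(Y2 \<triangleright> (Z2 \<triangleright> (cap Z1 X1 b1 (X2 \<otimes>\<^sub>o ?V) \<cdot> (Z1 \<triangleright> \<alpha> X1 X2 ?V)))) \<cdot> cup Y2 Z2 t2 (Z1 \<otimes>\<^sub>o ?V')
      = cup Y2 Z2 t2 (X2 \<otimes>\<^sub>o ?V) \<cdot> (cap Z1 X1 b1 (X2 \<otimes>\<^sub>o ?V) \<cdot> (Z1 \<triangleright> \<alpha> X1 X2 ?V))"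
    using cup_nat[of t2 Y2 Z2 "cap Z1 X1 b1 (X2 \<otimes>\<^sub>o ?V) \<cdot> (Z1 \<triangleright> \<alpha> X1 X2 ?V)" "X2 \<otimes>\<^sub>o ?V"]
    by simp
  have "\<alpha> Y1 Y2 ?V \<cdot> (f \<triangleleft> ?V) = \<alpha> Y1 Y2 ?V \<cdot> (((Y1 \<otimes>\<^sub>o Y2) \<triangleright> (?b \<cdot> \<alpha> Z2 Z1 ?V')) \<cdot> ?cup)"
    unfolding f_def T_def
    by (subst rwhisker_\<Psi>[OF _ _ _ T[unfolded T_def]]) (simp_all add: cap_tensor_cap)
  also have "\<dots> = (Y1 \<triangleright> (Y2 \<triangleright> ?b)) \<cdot> (\<alpha> Y1 Y2 (Z2 \<otimes>\<^sub>o Z1 \<otimes>\<^sub>o ?V') \<cdot> (((Y1 \<otimes>\<^sub>o Y2) \<triangleright> \<alpha> Z2 Z1 ?V') \<cdot> ?cup))"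
    by (simp add: whisker Comp_extend[OF \<alpha>_nat_right])
  also have "\<dots> = (Y1 \<triangleright> (Y2 \<triangleright> ?b)) \<cdot> ((Y1 \<triangleright> cup Y2 Z2 t2 (Z1 \<otimes>\<^sub>o ?V')) \<cdot> cup Y1 Z1 t1 ?V')"
    by (simp add: cup_tensor_cup)
  also have "\<dots> = (Y1 \<triangleright> ((Y2 \<triangleright> cap Z2 X2 b2 ?V) \<cdot> ((Y2 \<triangleright> (Z2 \<triangleright> (cap Z1 X1 b1 (X2 \<otimes>\<^sub>o ?V)
    \<cdot> (Z1 \<triangleright> \<alpha> X1 X2 ?V))))
      \<cdot> cup Y2 Z2 t2 (Z1 \<otimes>\<^sub>o ?V')))) \<cdot> cup Y1 Z1 t1 ?V'"
    by (simp add: whisker)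
  also have "\<dots> = (Y1 \<triangleright> ((Y2 \<triangleright> cap Z2 X2 b2 ?V) \<cdot> (cup Y2 Z2 t2 (X2 \<otimes>\<^sub>o ?V) \<cdot> (cap Z1 X1 b1 (X2 \<otimes>\<^sub>o ?V)
    \<cdot> (Z1 \<triangleright> \<alpha> X1 X2 ?V))))) \<cdot> cup Y1 Z1 t1 ?V'"
    by (simp only: slide)
  also have "\<dots> = (Y1 \<triangleright> (f2 \<triangleleft> ?V)) \<cdot> ((f1 \<triangleleft> (X2 \<otimes>\<^sub>o ?V)) \<cdot> \<alpha> X1 X2 ?V)"
    by (simp add: w1 w2 whisker cup_nat[of t1])
  also have "\<dots> = \<alpha> Y1 Y2 ?V \<cdot> ((f1 \<otimes>\<^sub>a f2) \<triangleleft> ?V)"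
    by (simp add: \<alpha>_nat Tens_Comp_extend)
  finally have "\<alpha> Y1 Y2 ?V \<cdot> (f \<triangleleft> ?V) = \<alpha> Y1 Y2 ?V \<cdot> ((f1 \<otimes>\<^sub>a f2) \<triangleleft> ?V)" .
  then have "f \<triangleleft> ?V = (f1 \<otimes>\<^sub>a f2) \<triangleleft> ?V"
    by (rule iso_left_cancel[rotated]) (simp_all add: Assoc_iso)
  then show "f = f1 \<otimes>\<^sub>a f2"
    by (rule rwhisker_Unit_faithful) simp_all
qed

end

section \<open>Braidings and twists\<close>

context switching
begin

lemma sw_nat_whiskered:
  assumes "X \<in> Obj C" "Y \<in> Obj C" "v \<in> Arr C" "V = Cod C v"
  shows "sw s X Y V \<cdot> (X \<triangleright> (Y \<triangleright> v)) = (Y \<triangleright> (X \<triangleright> v)) \<cdot> sw s X Y (Dom C v)"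
  using assms sw_nat[of "Id C X" "Id C Y" v] by simp

lemma sw_nat_right:
  assumes "X \<in> Obj C" "g \<in> Arr C" "V \<in> Obj C" "Y = Cod C g"
  shows "sw s X Y V \<cdot> (X \<triangleright> (g \<triangleleft> V)) = (g \<triangleleft> (X \<otimes>\<^sub>o V)) \<cdot> sw s X (Dom C g) V"
  using assms sw_nat[of "Id C X" g "Id C V"] by simp

lemma sw_iso:
  assumes "X \<in> Obj C" "Y \<in> Obj C" "V \<in> Obj C"
  shows "isomorphism C (sw s X Y V)"
  unfolding sw_def using assms
  by (intro iso_Comp iso_Tens iso_Id iso_inv_arr Assoc_iso switch_iso) auto

end

context braided_monoidal_category
begin

text \<open>The two hexagon identities in terms of families, free of associators except for those that
unfold the tensor product itself.\<close>

lemma sw_Tens_right: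
  assumes o: "X \<in> Obj C" "Y \<in> Obj C" "Z \<in> Obj C" "V \<in> Obj C"
  shows "\<alpha> Y Z (X \<otimes>\<^sub>o V) \<cdot> (sw c X (Y \<otimes>\<^sub>o Z) V \<cdot> (X \<triangleright> \<alpha>i Y Z V)) = (Y \<triangleright> sw c X Z V) \<cdot> sw c X Y (Z \<otimes>\<^sub>o V)"
proof -
  note [simp] = o
  let ?p = "\<alpha>i (X \<otimes>\<^sub>o Y) Z V \<cdot> \<alpha>i X Y (Z \<otimes>\<^sub>o V)"
  have "\<alpha> Y Z (X \<otimes>\<^sub>o V) \<cdot> (sw c X (Y \<otimes>\<^sub>o Z) V \<cdot> (X \<triangleright> \<alpha>i Y Z V))
    = (\<alpha> Y Z (X \<otimes>\<^sub>o V) \<cdot> \<alpha> (Y \<otimes>\<^sub>o Z) X V) \<cdot> ((c X (Y \<otimes>\<^sub>o Z) \<triangleleft> V) \<cdot> ((\<alpha> X Y Z \<triangleleft> V) \<cdot> ?p))"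
    by (simp add: sw_def pentagon_inv_mid)
  also have "\<dots> = (Y \<triangleright> \<alpha> Z X V) \<cdot> (\<alpha> Y (Z \<otimes>\<^sub>o X) V \<cdot> (((\<alpha> Y Z X \<cdot> c X (Y \<otimes>\<^sub>o Z) \<cdot> \<alpha> X Y Z) \<triangleleft> V) \<cdot> ?p))"
    unfolding pentagon'[OF o(2,3,1,4), symmetric] by (simp add: whisker)
  also have "\<dots> = (Y \<triangleright> \<alpha> Z X V) \<cdot> ((Y \<triangleright> (c X Z \<triangleleft> V)) \<cdot> (\<alpha> Y (X \<otimes>\<^sub>o Z) V \<cdot> ((\<alpha> Y X Z \<triangleleft> V)
    \<cdot> (((c X Y \<triangleleft> Z) \<triangleleft> V) \<cdot> ?p))))"
    unfolding hexagon1[OF o(1-3)] by (simp add: whisker \<alpha>_nat')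
  also have "\<dots> = (Y \<triangleright> \<alpha> Z X V) \<cdot> ((Y \<triangleright> (c X Z \<triangleleft> V)) \<cdot> ((Y \<triangleright> \<alpha>i X Z V) \<cdot> (\<alpha> Y X (Z \<otimes>\<^sub>o V)
    \<cdot> ((c X Y \<triangleleft> (Z \<otimes>\<^sub>o V)) \<cdot> \<alpha>i X Y (Z \<otimes>\<^sub>o V)))))"
    by (simp add: Comp_extend[OF pentagon_mid] \<alpha>_nat')
  finally show ?thesis
    by (simp add: sw_def whisker)
qed

lemma sw_Tens_left:
  assumes o: "X \<in> Obj C" "Y \<in> Obj C" "Z \<in> Obj C" "V \<in> Obj C"
  shows "(Z \<triangleright> \<alpha> X Y V) \<cdot> sw c (X \<otimes>\<^sub>o Y) Z V = sw c X Z (Y \<otimes>\<^sub>o V) \<cdot> ((X \<triangleright> sw c Y Z V) \<cdot> \<alpha> X Y (Z \<otimes>\<^sub>o V))"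
proof -
  note [simp] = o
  let ?p = "\<alpha>i X (Y \<otimes>\<^sub>o Z) V \<cdot> (X \<triangleright> \<alpha>i Y Z V)"
  have "(Z \<triangleright> \<alpha> X Y V) \<cdot> (sw c (X \<otimes>\<^sub>o Y) Z V \<cdot> \<alpha>i X Y (Z \<otimes>\<^sub>o V))
    = ((Z \<triangleright> \<alpha> X Y V) \<cdot> \<alpha> Z (X \<otimes>\<^sub>o Y) V) \<cdot> ((c (X \<otimes>\<^sub>o Y) Z \<triangleleft> V) \<cdot> (\<alpha>i (X \<otimes>\<^sub>o Y) Z V \<cdot> \<alpha>i X Y (Z \<otimes>\<^sub>o V)))"
    by (simp add: sw_def)
  also have "\<dots> = \<alpha> Z X (Y \<otimes>\<^sub>o V) \<cdot> (\<alpha> (Z \<otimes>\<^sub>o X) Y V \<cdot> (((inv_arr C (\<alpha> Z X Y) \<cdot> c (X \<otimes>\<^sub>o Y) Z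
    \<cdot> inv_arr C (\<alpha> X Y Z)) \<triangleleft> V) \<cdot> ?p))"
    unfolding pentagon_long[OF o(3,1,2,4)] by (simp add: whisker flip: pentagon_inv)
  also have "\<dots> = \<alpha> Z X (Y \<otimes>\<^sub>o V) \<cdot> ((c X Z \<triangleleft> (Y \<otimes>\<^sub>o V)) \<cdot> (\<alpha> (X \<otimes>\<^sub>o Z) Y V \<cdot> ((\<alpha>i X Z Y \<triangleleft> V)
    \<cdot> (((X \<triangleright> c Y Z) \<triangleleft> V) \<cdot> ?p))))"
    unfolding hexagon2[OF o(1-3)] by (simp add: whisker \<alpha>_nat')
  also have "\<dots> = \<alpha> Z X (Y \<otimes>\<^sub>o V) \<cdot> ((c X Z \<triangleleft> (Y \<otimes>\<^sub>o V)) \<cdot> (\<alpha>i X Z (Y \<otimes>\<^sub>o V) \<cdot> ((X \<triangleright> \<alpha> Z Y V)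
    \<cdot> ((X \<triangleright> (c Y Z \<triangleleft> V)) \<cdot> (X \<triangleright> \<alpha>i Y Z V)))))"
    by (simp add: Comp_extend[OF pentagon_inv_left] \<alpha>_nat')
  also have "\<dots> = sw c X Z (Y \<otimes>\<^sub>o V) \<cdot> (X \<triangleright> sw c Y Z V)"
    by (simp add: sw_def whisker)
  finally have "((Z \<triangleright> \<alpha> X Y V) \<cdot> (sw c (X \<otimes>\<^sub>o Y) Z V \<cdot> \<alpha>i X Y (Z \<otimes>\<^sub>o V))) \<cdot> \<alpha> X Y (Z \<otimes>\<^sub>o V)
    = (sw c X Z (Y \<otimes>\<^sub>o V) \<cdot> (X \<triangleright> sw c Y Z V)) \<cdot> \<alpha> X Y (Z \<otimes>\<^sub>o V)"
    by (rule arg_cong)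
  then show ?thesis by simp
qed

text \<open>The hexagon for two copies of \<open>\<I>\<close> says that braiding \<open>B\<close> with \<open>\<I>\<close> twice is the same as
braiding it once; cancelling one braiding proves the claim at the component \<open>\<I> \<otimes> V\<close>, and
naturality along \<open>\<I> \<otimes> V \<cong> V\<close> carries it to \<open>V\<close>.\<close>

lemma sw_Unit:
  assumes o: "B \<in> Obj C" "V \<in> Obj C"
  shows "lu (B \<otimes>\<^sub>o V) \<cdot> sw c B \<I> V = B \<triangleright> lu V"
proof -
  note [simp] = o
  have "sw c B \<I> V \<cdot> (lu (B \<otimes>\<^sub>o \<I> \<otimes>\<^sub>o V) \<cdot> sw c B \<I> (\<I> \<otimes>\<^sub>o V))
    = lu (\<I> \<otimes>\<^sub>o B \<otimes>\<^sub>o V) \<cdot> ((\<I> \<triangleright> sw c B \<I> V) \<cdot> sw c B \<I> (\<I> \<otimes>\<^sub>o V))"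
    by (simp add: lu_nat')
  also have "\<dots> = lu (\<I> \<otimes>\<^sub>o B \<otimes>\<^sub>o V) \<cdot> (\<alpha> \<I> \<I> (B \<otimes>\<^sub>o V) \<cdot> (sw c B (\<I> \<otimes>\<^sub>o \<I>) V \<cdot> (B \<triangleright> \<alpha>i \<I> \<I> V)))"
    by (simp add: sw_Tens_right)
  also have "\<dots> = (lu \<I> \<triangleleft> (B \<otimes>\<^sub>o V)) \<cdot> (sw c B (\<I> \<otimes>\<^sub>o \<I>) V \<cdot> (B \<triangleright> \<alpha>i \<I> \<I> V))"
    by (simp add: Comp_extend[OF LUnit_Tens])
  also have "\<dots> = sw c B \<I> V \<cdot> (B \<triangleright> ((lu \<I> \<triangleleft> V) \<cdot> \<alpha>i \<I> \<I> V))"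
    by (simp add: whisker Comp_extend[OF sw_nat_right])
  also have "(lu \<I> \<triangleleft> V) \<cdot> \<alpha>i \<I> \<I> V = lu (\<I> \<otimes>\<^sub>o V)"
    by (simp flip: LUnit_Tens)
  finally have *: "lu (B \<otimes>\<^sub>o \<I> \<otimes>\<^sub>o V) \<cdot> sw c B \<I> (\<I> \<otimes>\<^sub>o V) = B \<triangleright> lu (\<I> \<otimes>\<^sub>o V)"
    by (rule iso_left_cancel[rotated]) (simp_all add: sw_iso)
  have "(lu (B \<otimes>\<^sub>o V) \<cdot> sw c B \<I> V) \<cdot> (B \<triangleright> (\<I> \<triangleright> lu V)) = (B \<triangleright> lu V) \<cdot> (B \<triangleright> (\<I> \<triangleright> lu V))"
  proof -
    have "(lu (B \<otimes>\<^sub>o V) \<cdot> sw c B \<I> V) \<cdot> (B \<triangleright> (\<I> \<triangleright> lu V))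
      = (B \<triangleright> lu V) \<cdot> (lu (B \<otimes>\<^sub>o \<I> \<otimes>\<^sub>o V) \<cdot> sw c B \<I> (\<I> \<otimes>\<^sub>o V))"
      using sw_nat_whiskered[of B \<I> "lu V" V] by (simp add: lu_nat' del: Tens_Id)
    also have "\<dots> = (B \<triangleright> lu V) \<cdot> (B \<triangleright> (\<I> \<triangleright> lu V))"
      unfolding * by (simp add: lu_nat flip: lwhisker_Comp)
    finally show ?thesis .
  qed
  then show ?thesis
    by (rule iso_right_cancel[rotated]) (simp_all add: iso_Tens iso_Id LUnit_iso)
qed

text \<open>By naturality, braiding a strand with a cap or a cup amounts to braiding it with \<open>\<I>\<close>,
which is trivial. This is how a strand is pulled across.\<close>

lemma cap_braid:
  assumes o: "A \<in> Obj C" "B \<in> Obj C" "Z \<in> Obj C" "V \<in> Obj C" and b: "b \<in> Hom C (Z \<otimes>\<^sub>o A) \<I>"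
  shows "cap Z A b (B \<otimes>\<^sub>o V) \<cdot> ((Z \<triangleright> sw c B A V) \<cdot> sw c B Z (A \<otimes>\<^sub>o V)) = B \<triangleright> cap Z A b V"
proof -
  note [simp] = o HomD[OF b]
  have "cap Z A b (B \<otimes>\<^sub>o V) \<cdot> ((Z \<triangleright> sw c B A V) \<cdot> sw c B Z (A \<otimes>\<^sub>o V))
    = lu (B \<otimes>\<^sub>o V) \<cdot> ((b \<triangleleft> (B \<otimes>\<^sub>o V)) \<cdot> (sw c B (Z \<otimes>\<^sub>o A) V \<cdot> (B \<triangleright> \<alpha>i Z A V)))"
    by (simp add: cap_def flip: sw_Tens_right)
  also have "\<dots> = lu (B \<otimes>\<^sub>o V) \<cdot> (sw c B \<I> V \<cdot> ((B \<triangleright> (b \<triangleleft> V)) \<cdot> (B \<triangleright> \<alpha>i Z A V)))"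
    by (simp add: Comp_extend[OF sw_nat_right])
  also have "\<dots> = B \<triangleright> cap Z A b V"
    by (simp add: Comp_extend[OF sw_Unit] cap_def whisker)
  finally show ?thesis .
qed

lemma cup_braid:
  assumes o: "A \<in> Obj C" "B \<in> Obj C" "W \<in> Obj C" "V \<in> Obj C" and t: "t \<in> Hom C \<I> (W \<otimes>\<^sub>o B)"
  shows "(W \<triangleright> sw c A B V) \<cdot> (sw c A W (B \<otimes>\<^sub>o V) \<cdot> (A \<triangleright> cup W B t V)) = cup W B t (A \<otimes>\<^sub>o V)"
proof -
  note [simp] = o HomD[OF t]
  have unit: "sw c A \<I> V \<cdot> (A \<triangleright> lui V) = lui (A \<otimes>\<^sub>o V)"
  proof (rule iso_left_cancel[OF LUnit_iso[of "A \<otimes>\<^sub>o V"]])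
    show "lu (A \<otimes>\<^sub>o V) \<cdot> (sw c A \<I> V \<cdot> (A \<triangleright> lui V)) = lu (A \<otimes>\<^sub>o V) \<cdot> lui (A \<otimes>\<^sub>o V)"
      by (simp add: Comp_extend[OF sw_Unit] flip: lwhisker_Comp)
  qed simp_all
  have "(W \<triangleright> sw c A B V) \<cdot> (sw c A W (B \<otimes>\<^sub>o V) \<cdot> (A \<triangleright> cup W B t V))
    = ((W \<triangleright> sw c A B V) \<cdot> sw c A W (B \<otimes>\<^sub>o V)) \<cdot> (A \<triangleright> cup W B t V)"
    using t by simp
  also have "\<dots> = \<alpha> W B (A \<otimes>\<^sub>o V) \<cdot> (sw c A (W \<otimes>\<^sub>o B) V \<cdot> ((A \<triangleright> (t \<triangleleft> V)) \<cdot> (A \<triangleright> lui V)))"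
    unfolding sw_Tens_right[OF o(1,3,2,4), symmetric] by (simp add: cup_def whisker)
  also have "\<dots> = cup W B t (A \<otimes>\<^sub>o V)"
    by (simp add: Comp_extend[OF sw_nat_right] unit cup_def)
  finally show ?thesis .
qed

text \<open>Naturality of the braiding of \<open>A\<close> with \<open>B \<otimes> Z\<close> with respect to \<open>c B Z\<close>.\<close>

lemma sw_Yang_Baxter:
  assumes o: "A \<in> Obj C" "B \<in> Obj C" "Z \<in> Obj C" "V \<in> Obj C"
  shows "(Z \<triangleright> sw c A B V) \<cdot> (sw c A Z (B \<otimes>\<^sub>o V) \<cdot> (A \<triangleright> sw c B Z V))
    = sw c B Z (A \<otimes>\<^sub>o V) \<cdot> ((B \<triangleright> sw c A Z V) \<cdot> sw c A B (Z \<otimes>\<^sub>o V))"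
proof -
  note [simp] = o
  have "(Z \<triangleright> sw c A B V) \<cdot> (sw c A Z (B \<otimes>\<^sub>o V) \<cdot> (A \<triangleright> sw c B Z V))
    = ((Z \<triangleright> sw c A B V) \<cdot> sw c A Z (B \<otimes>\<^sub>o V)) \<cdot> (A \<triangleright> sw c B Z V)"
    by simp
  also have "\<dots> = \<alpha> Z B (A \<otimes>\<^sub>o V) \<cdot> (sw c A (Z \<otimes>\<^sub>o B) V \<cdot> ((A \<triangleright> (c B Z \<triangleleft> V)) \<cdot> (A \<triangleright> \<alpha>i B Z V)))"
    unfolding sw_Tens_right[OF o(1,3,2,4), symmetric] by (simp add: sw_def[of c B Z V] whisker)
  also have "\<dots> = \<alpha> Z B (A \<otimes>\<^sub>o V) \<cdot> ((c B Z \<triangleleft> (A \<otimes>\<^sub>o V)) \<cdot> (sw c A (B \<otimes>\<^sub>o Z) V \<cdot> (A \<triangleright> \<alpha>i B Z V)))"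
    by (simp add: Comp_extend[OF sw_nat_right])
  also have "\<dots> = sw c B Z (A \<otimes>\<^sub>o V) \<cdot> (\<alpha> B Z (A \<otimes>\<^sub>o V) \<cdot> (sw c A (B \<otimes>\<^sub>o Z) V \<cdot> (A \<triangleright> \<alpha>i B Z V)))"
    by (simp add: sw_def[of c B Z "A \<otimes>\<^sub>o V"])
  also have "\<dots> = sw c B Z (A \<otimes>\<^sub>o V) \<cdot> ((B \<triangleright> sw c A Z V) \<cdot> sw c A B (Z \<otimes>\<^sub>o V))"
    by (simp add: sw_Tens_right)
  finally show ?thesis .
qed

end

context balanced_monoidal_category
begin

lemma twist_arr [simp]:
  assumes "X \<in> Obj C"
  shows "\<theta> X \<in> Arr C" "Dom C (\<theta> X) = X" "Cod C (\<theta> X) = X"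
  using twist_in[OF assms] by (auto simp: Hom_def)

lemma twist_Tens_whisker:
  assumes o: "A \<in> Obj C" "B \<in> Obj C" "V \<in> Obj C"
  shows "\<alpha> A B V \<cdot> (\<theta> (A \<otimes>\<^sub>o B) \<triangleleft> V) = sw c B A V \<cdot> ((\<theta> B \<otimes>\<^sub>a (\<theta> A \<triangleleft> V)) \<cdot> (sw c A B V \<cdot> \<alpha> A B V))"
proof -
  note [simp] = o
  have "sw c B A V \<cdot> ((\<theta> B \<otimes>\<^sub>a (\<theta> A \<triangleleft> V)) \<cdot> (sw c A B V \<cdot> \<alpha> A B V))
    = \<alpha> A B V \<cdot> ((c B A \<triangleleft> V) \<cdot> (((\<theta> B \<otimes>\<^sub>a \<theta> A) \<triangleleft> V) \<cdot> (c A B \<triangleleft> V)))"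
    by (simp add: sw_def \<alpha>i_nat')
  also have "\<dots> = \<alpha> A B V \<cdot> (\<theta> (A \<otimes>\<^sub>o B) \<triangleleft> V)"
    by (simp add: twist_Tens whisker)
  finally show ?thesis ..
qed

definition twisted_braiding :: "'o \<Rightarrow> 'o \<Rightarrow> 'm"
  where "twisted_braiding X Y = (Y \<triangleright> \<theta> X) \<cdot> c X Y"

lemma sw_twisted_braiding:
  assumes "X \<in> Obj C" "Y \<in> Obj C" "V \<in> Obj C"
  shows "sw twisted_braiding X Y V = (Y \<triangleright> (\<theta> X \<triangleleft> V)) \<cdot> sw c X Y V"
  using assms by (simp add: sw_def twisted_braiding_def whisker \<alpha>_nat')

text \<open>Two nested loops come apart: the strand \<open>B\<close> of the inner loop is pulled across the cap of
the outer one, and the strand \<open>A\<close> of the outer loop across the cup of the inner one. Each pull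
uses up one of the two braidings of \<open>A\<close> with \<open>B\<close> in the twist of \<open>A \<otimes> B\<close>. The factors come out
in reverse order because the inner loop is evaluated last.\<close>

proposition twisted_trace_tensor:
  assumes o: "A \<in> Obj C" "B \<in> Obj C" "Z \<in> Obj C" "W \<in> Obj C"
    and t1: "t1 \<in> Hom C \<I> (A \<otimes>\<^sub>o Z)" and b1: "b1 \<in> Hom C (Z \<otimes>\<^sub>o A) \<I>"
    and t2: "t2 \<in> Hom C \<I> (B \<otimes>\<^sub>o W)" and b2: "b2 \<in> Hom C (W \<otimes>\<^sub>o B) \<I>"
    and s: "switching C twisted_braiding"
  shows "tensor_cap Z A b1 W B b2 \<cdot> (twisted_braiding (A \<otimes>\<^sub>o B) (W \<otimes>\<^sub>o Z) \<cdot> tensor_cup A Z t1 B W t2)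
    = (b2 \<cdot> (twisted_braiding B W \<cdot> t2)) \<cdot> (b1 \<cdot> (twisted_braiding A Z \<cdot> t1))"
proof -
  interpret tw: switching C twisted_braiding by fact
  note [simp] = o t1 b1 t2 b2 HomD[OF t1] HomD[OF b1] HomD[OF t2] HomD[OF b2]
  let ?V = \<I>
  let ?tc = "tensor_cup A Z t1 B W t2" and ?bc = "tensor_cap Z A b1 W B b2"
  have tc: "?tc \<in> Hom C \<I> ((A \<otimes>\<^sub>o B) \<otimes>\<^sub>o (W \<otimes>\<^sub>o Z))" and bc: "?bc \<in> Hom C ((W \<otimes>\<^sub>o Z) \<otimes>\<^sub>o (A \<otimes>\<^sub>o B)) \<I>"
    by (auto intro: tensor_cup_Hom tensor_cap_Hom)
  note [simp] = tc bc HomD[OF tc] HomD[OF bc]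
  \<comment> \<open>The second cup with its legs exchanged; its legs are ordered so that \<open>A\<close> can be pulled
    across it.\<close>
  define \<tau> where "\<tau> = c B W \<cdot> t2"
  have \<tau>: "\<tau> \<in> Hom C \<I> (W \<otimes>\<^sub>o B)"
    by (simp add: \<tau>_def Hom_iff)
  note [simp] = \<tau>
  have cup_\<tau>: "sw c B W V \<cdot> cup B W t2 V = cup W B \<tau> V" if "V \<in> Obj C" for V
    using that by (simp add: \<tau>_def sw_def cup_def whisker)
  let ?cup = "cup (A \<otimes>\<^sub>o B) (W \<otimes>\<^sub>o Z) ?tc ?V"
  let ?\<Theta> = "\<theta> B \<otimes>\<^sub>a (\<theta> A \<triangleleft> ?V)"
  let ?AB = "A \<otimes>\<^sub>o B"
  have slide: "\<alpha> W Z (?AB \<otimes>\<^sub>o ?V) \<cdot> sw c ?AB (W \<otimes>\<^sub>o Z) ?V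
      = (W \<triangleright> sw c ?AB Z ?V) \<cdot> (sw c ?AB W (Z \<otimes>\<^sub>o ?V) \<cdot> (?AB \<triangleright> \<alpha> W Z ?V))"
  proof -
    have "(W \<triangleright> sw c ?AB Z ?V) \<cdot> (sw c ?AB W (Z \<otimes>\<^sub>o ?V) \<cdot> (?AB \<triangleright> \<alpha> W Z ?V))
      = ((W \<triangleright> sw c ?AB Z ?V) \<cdot> sw c ?AB W (Z \<otimes>\<^sub>o ?V)) \<cdot> (?AB \<triangleright> \<alpha> W Z ?V)"
      by simp
    then show ?thesis
      unfolding sw_Tens_right[OF Tens_obj(1)[OF o(1,2)] o(4,3) Tens_obj(2), symmetric] by simp
  qed
  \<comment> \<open>Bring every factor into right-bracketed form: \<open>?\<Theta>\<close> between two braidings of \<open>A\<close> and \<open>B\<close> is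
    the twist of \<open>A \<otimes> B\<close>, and the hexagons split the braiding of \<open>A \<otimes> B\<close> with \<open>W \<otimes> Z\<close> into
    four.\<close>
  have "scal (?bc \<cdot> (twisted_braiding ?AB (W \<otimes>\<^sub>o Z) \<cdot> ?tc)) ?V
    = cap W B b2 ?V \<cdot> ((W \<triangleright> cap Z A b1 (B \<otimes>\<^sub>o ?V)) \<cdot> ((W \<triangleright> (Z \<triangleright> \<alpha> A B ?V)) \<cdot> (\<alpha> W Z (?AB \<otimes>\<^sub>o ?V)
      \<cdot> (((W \<otimes>\<^sub>o Z) \<triangleright> (\<theta> ?AB \<triangleleft> ?V)) \<cdot> (sw c ?AB (W \<otimes>\<^sub>o Z) ?V \<cdot> ?cup)))))"
    by (subst tw.scal_trace) (simp_all add: cap_tensor_cap sw_twisted_braiding)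
  also have "\<dots> = cap W B b2 ?V \<cdot> ((W \<triangleright> cap Z A b1 (B \<otimes>\<^sub>o ?V)) \<cdot> ((W \<triangleright> (Z \<triangleright> (\<alpha> A B ?V \<cdot> (\<theta> ?AB \<triangleleft> ?V))))
      \<cdot> (\<alpha> W Z (?AB \<otimes>\<^sub>o ?V) \<cdot> (sw c ?AB (W \<otimes>\<^sub>o Z) ?V \<cdot> ?cup))))"
    by (simp add: Comp_extend[OF \<alpha>_nat_right] whisker)
  also have "\<dots> = cap W B b2 ?V \<cdot> ((W \<triangleright> cap Z A b1 (B \<otimes>\<^sub>o ?V)) \<cdot> ((W \<triangleright> (Z \<triangleright> (sw c B A ?V \<cdot> (?\<Theta>
    \<cdot> sw c A B ?V))))
      \<cdot> ((W \<triangleright> ((Z \<triangleright> \<alpha> A B ?V) \<cdot> sw c ?AB Z ?V)) \<cdot> (sw c ?AB W (Z \<otimes>\<^sub>o ?V) \<cdot> ((?AB \<triangleright> \<alpha> W Z ?V) \<cdot> ?cup)))))"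
    by (simp add: twist_Tens_whisker Comp_extend[OF slide] whisker)
  also have "\<dots> = cap W B b2 ?V \<cdot> ((W \<triangleright> cap Z A b1 (B \<otimes>\<^sub>o ?V)) \<cdot> ((W \<triangleright> (Z \<triangleright> (sw c B A ?V \<cdot> (?\<Theta>
    \<cdot> sw c A B ?V))))
      \<cdot> ((W \<triangleright> (sw c A Z (B \<otimes>\<^sub>o ?V) \<cdot> (A \<triangleright> sw c B Z ?V)))
      \<cdot> (((W \<triangleright> \<alpha> A B (Z \<otimes>\<^sub>o ?V)) \<cdot> sw c ?AB W (Z \<otimes>\<^sub>o ?V)) \<cdot> ((?AB \<triangleright> \<alpha> W Z ?V) \<cdot> ?cup)))))"
    unfolding sw_Tens_left[OF o(1,2,3) Tens_obj(2)] by (simp add: whisker)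
  also have "\<dots> = cap W B b2 ?V \<cdot> ((W \<triangleright> cap Z A b1 (B \<otimes>\<^sub>o ?V)) \<cdot> ((W \<triangleright> (Z \<triangleright> (sw c B A ?V \<cdot> (?\<Theta>
    \<cdot> sw c A B ?V))))
      \<cdot> ((W \<triangleright> (sw c A Z (B \<otimes>\<^sub>o ?V) \<cdot> (A \<triangleright> sw c B Z ?V)))
      \<cdot> (sw c A W (B \<otimes>\<^sub>o Z \<otimes>\<^sub>o ?V) \<cdot> ((A \<triangleright> sw c B W (Z \<otimes>\<^sub>o ?V))
      \<cdot> (\<alpha> A B (W \<otimes>\<^sub>o Z \<otimes>\<^sub>o ?V) \<cdot> ((?AB \<triangleright> \<alpha> W Z ?V) \<cdot> ?cup)))))))"
    unfolding sw_Tens_left[OF o(1,2,4) Tens_obj(1)[OF o(3) Tens_obj(2)]] by simp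
  also have "\<dots> = cap W B b2 ?V \<cdot> ((W \<triangleright> cap Z A b1 (B \<otimes>\<^sub>o ?V)) \<cdot> ((W \<triangleright> (Z \<triangleright> (sw c B A ?V \<cdot> (?\<Theta>
    \<cdot> sw c A B ?V))))
      \<cdot> ((W \<triangleright> (sw c A Z (B \<otimes>\<^sub>o ?V) \<cdot> (A \<triangleright> sw c B Z ?V)))
      \<cdot> (sw c A W (B \<otimes>\<^sub>o Z \<otimes>\<^sub>o ?V) \<cdot> ((A \<triangleright> (sw c B W (Z \<otimes>\<^sub>o ?V) \<cdot> cup B W t2 (Z \<otimes>\<^sub>o ?V))) \<cdot> cup A Z t1 ?V)))))"
    by (simp add: cup_tensor_cup whisker)
  also have "\<dots> = cap W B b2 ?V \<cdot> ((W \<triangleright> (cap Z A b1 (B \<otimes>\<^sub>o ?V) \<cdot> ((Z \<triangleright> sw c B A ?V) \<cdot> ((Z \<triangleright> ?\<Theta>)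
      \<cdot> ((Z \<triangleright> sw c A B ?V) \<cdot> (sw c A Z (B \<otimes>\<^sub>o ?V) \<cdot> (A \<triangleright> sw c B Z ?V)))))))
      \<cdot> (sw c A W (B \<otimes>\<^sub>o Z \<otimes>\<^sub>o ?V) \<cdot> ((A \<triangleright> cup W B \<tau> (Z \<otimes>\<^sub>o ?V)) \<cdot> cup A Z t1 ?V)))"
    by (simp add: cup_\<tau> whisker)
  \<comment> \<open>Yang-Baxter moves the braiding of \<open>B\<close> with \<open>Z\<close> next to the cap, where \<open>B\<close> is pulled across;
    the loop of \<open>b1\<close> is now closed to the right of \<open>B\<close>.\<close>
  also have "cap Z A b1 (B \<otimes>\<^sub>o ?V) \<cdot> ((Z \<triangleright> sw c B A ?V) \<cdot> ((Z \<triangleright> ?\<Theta>)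
      \<cdot> ((Z \<triangleright> sw c A B ?V) \<cdot> (sw c A Z (B \<otimes>\<^sub>o ?V) \<cdot> (A \<triangleright> sw c B Z ?V)))))
    = (\<theta> B \<triangleleft> ?V) \<cdot> ((B \<triangleright> (cap Z A b1 ?V \<cdot> sw twisted_braiding A Z ?V)) \<cdot> sw c A B (Z \<otimes>\<^sub>o ?V))"
  proof -
    have "cap Z A b1 (B \<otimes>\<^sub>o ?V) \<cdot> ((Z \<triangleright> sw c B A ?V) \<cdot> ((Z \<triangleright> ?\<Theta>)
        \<cdot> ((Z \<triangleright> sw c A B ?V) \<cdot> (sw c A Z (B \<otimes>\<^sub>o ?V) \<cdot> (A \<triangleright> sw c B Z ?V)))))
      = cap Z A b1 (B \<otimes>\<^sub>o ?V) \<cdot> ((Z \<triangleright> sw c B A ?V) \<cdot> ((Z \<triangleright> ?\<Theta>)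
        \<cdot> (sw c B Z (A \<otimes>\<^sub>o ?V) \<cdot> ((B \<triangleright> sw c A Z ?V) \<cdot> sw c A B (Z \<otimes>\<^sub>o ?V)))))"
      by (subst sw_Yang_Baxter) simp_all
    also have "\<dots> = (cap Z A b1 (B \<otimes>\<^sub>o ?V) \<cdot> ((Z \<triangleright> sw c B A ?V) \<cdot> sw c B Z (A \<otimes>\<^sub>o ?V)))
        \<cdot> ((\<theta> B \<otimes>\<^sub>a (Z \<triangleright> (\<theta> A \<triangleleft> ?V))) \<cdot> ((B \<triangleright> sw c A Z ?V) \<cdot> sw c A B (Z \<otimes>\<^sub>o ?V)))"
      using sw_nat'[of "\<theta> B" "Id C Z" "\<theta> A \<triangleleft> ?V" B Z "A \<otimes>\<^sub>o ?V" "(B \<triangleright> sw c A Z ?V) \<cdot> sw c A B (Z \<otimes>\<^sub>o ?V)"]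
      by simp
    also have "\<dots> = (B \<triangleright> cap Z A b1 ?V) \<cdot> ((\<theta> B \<otimes>\<^sub>a (Z \<triangleright> (\<theta> A \<triangleleft> ?V))) \<cdot> ((B \<triangleright> sw c A Z ?V)
      \<cdot> sw c A B (Z \<otimes>\<^sub>o ?V)))"
      by (subst cap_braid) simp_all
    also have "\<dots> = (\<theta> B \<triangleleft> ?V) \<cdot> ((B \<triangleright> (cap Z A b1 ?V \<cdot> sw twisted_braiding A Z ?V)) \<cdot> sw c A B (Z \<otimes>\<^sub>o ?V))"
      by (simp add: sw_twisted_braiding Tens_Comp Tens_Comp_extend)
    finally show ?thesis .
  qed
  also have "cap W B b2 ?V \<cdot> ((W \<triangleright> ((\<theta> B \<triangleleft> ?V) \<cdot> ((B \<triangleright> (cap Z A b1 ?V \<cdot> sw twisted_braiding A Z ?V))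
    \<cdot> sw c A B (Z \<otimes>\<^sub>o ?V))))
      \<cdot> (sw c A W (B \<otimes>\<^sub>o Z \<otimes>\<^sub>o ?V) \<cdot> ((A \<triangleright> cup W B \<tau> (Z \<otimes>\<^sub>o ?V)) \<cdot> cup A Z t1 ?V)))
    = cap W B b2 ?V \<cdot> ((W \<triangleright> (\<theta> B \<triangleleft> ?V)) \<cdot> ((W \<triangleright> (B \<triangleright> (cap Z A b1 ?V \<cdot> sw twisted_braiding A Z ?V)))
      \<cdot> (((W \<triangleright> sw c A B (Z \<otimes>\<^sub>o ?V)) \<cdot> (sw c A W (B \<otimes>\<^sub>o Z \<otimes>\<^sub>o ?V) \<cdot> (A \<triangleright> cup W B \<tau> (Z \<otimes>\<^sub>o ?V)))) \<cdot> cup A Z t1 ?V)))"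
    by (simp add: whisker)
  \<comment> \<open>Now \<open>A\<close> is pulled across the second cup, and naturality separates the two loops.\<close>
  also have "\<dots> = cap W B b2 ?V \<cdot> ((W \<triangleright> (\<theta> B \<triangleleft> ?V)) \<cdot> ((W \<triangleright> (B \<triangleright> (cap Z A b1 ?V
    \<cdot> sw twisted_braiding A Z ?V)))
      \<cdot> (cup W B \<tau> (A \<otimes>\<^sub>o Z \<otimes>\<^sub>o ?V) \<cdot> cup A Z t1 ?V)))"
    by (subst cup_braid) simp_all
  also have "\<dots> = cap W B b2 ?V \<cdot> ((W \<triangleright> (\<theta> B \<triangleleft> ?V)) \<cdot> (cup W B \<tau> ?V
      \<cdot> ((cap Z A b1 ?V \<cdot> sw twisted_braiding A Z ?V) \<cdot> cup A Z t1 ?V)))"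
    using Comp_extend[OF cup_nat[OF \<tau> o(4,2), of "cap Z A b1 ?V
      \<cdot> sw twisted_braiding A Z ?V" ?V], of "cup A Z t1 ?V"]
    by simp
  also have "\<dots> = scal (b2 \<cdot> (twisted_braiding B W \<cdot> t2)) ?V \<cdot> scal (b1 \<cdot> (twisted_braiding A Z \<cdot> t1)) ?V"
    by (simp add: tw.scal_trace sw_twisted_braiding cup_\<tau>)
  also have "\<dots> = scal ((b2 \<cdot> (twisted_braiding B W \<cdot> t2)) \<cdot> (b1 \<cdot> (twisted_braiding A Z \<cdot> t1))) ?V"
    by (subst scal_Comp) (simp_all add: Hom_iff)
  finally show ?thesis
    by (rule scal_inject[rotated 2]) (simp_all add: Hom_iff)
qed

end

context balanced_monoidal_category
begin

lemma switching_twisted_braiding: "switching C twisted_braiding"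
proof
  fix X Y assume o: "X \<in> Obj C" "Y \<in> Obj C"
  note [simp] = o
  show "twisted_braiding X Y \<in> Hom C (X \<otimes>\<^sub>o Y) (Y \<otimes>\<^sub>o X)"
    by (simp add: twisted_braiding_def Hom_iff)
  show "isomorphism C (twisted_braiding X Y)"
    unfolding twisted_braiding_def
    by (intro iso_Comp iso_Tens iso_Id twist_iso switch_iso) simp_all
next
  fix f g X X' Y Y' assume "f \<in> Hom C X X'" "g \<in> Hom C Y Y'"
  note [simp] = HomD[OF this(1)] HomD[OF this(2)] Hom_obj[OF this(1)] Hom_obj[OF this(2)]
    and nat = twist_natural[OF this(1)]
  show "twisted_braiding X' Y' \<cdot> (f \<otimes>\<^sub>a g) = (g \<otimes>\<^sub>a f) \<cdot> twisted_braiding X Y"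
    by (simp add: twisted_braiding_def switch_nat Tens_Comp_extend nat)
qed

text \<open>Absorbing \<open>g1\<close> and \<open>g2\<close> into the caps reduces the claim to loops; scalars commute, which
restores the order of the factors.\<close>

theorem trace_pairing_tensor:
  assumes s: "switching C s"
    and s_eq: "\<And>X Y. X \<in> Obj C \<Longrightarrow> Y \<in> Obj C \<Longrightarrow> s X Y = twisted_braiding X Y"
    and o: "X1 \<in> Obj C" "Y1 \<in> Obj C" "X2 \<in> Obj C" "Y2 \<in> Obj C"
    and f: "f1 \<in> Thick C X1 Y1" "f2 \<in> Thick C X2 Y2"
    and g: "g1 \<in> Thick C Y1 X1" "g2 \<in> Thick C Y2 X2"
  shows "f1 \<otimes>\<^sub>a f2 \<in> Thick C (X1 \<otimes>\<^sub>o X2) (Y1 \<otimes>\<^sub>o Y2)"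
    and "g1 \<otimes>\<^sub>a g2 \<in> Thick C (Y1 \<otimes>\<^sub>o Y2) (X1 \<otimes>\<^sub>o X2)"
    and "trace_pairing C s (X1 \<otimes>\<^sub>o X2) (Y1 \<otimes>\<^sub>o Y2) (f1 \<otimes>\<^sub>a f2) (g1 \<otimes>\<^sub>a g2)
      = trace_pairing C s X1 Y1 f1 g1 \<cdot> trace_pairing C s X2 Y2 f2 g2"
proof -
  interpret sw: switching C s by fact
  have Thick_tensor: "f1 \<otimes>\<^sub>a f2 \<in> Thick C (X1 \<otimes>\<^sub>o X2) (Y1 \<otimes>\<^sub>o Y2)"
    if "X1 \<in> Obj C" "Y1 \<in> Obj C" "X2 \<in> Obj C" "Y2 \<in> Obj C"
      "f1 \<in> Thick C X1 Y1" "f2 \<in> Thick C X2 Y2" for X1 Y1 X2 Y2 f1 f2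
    using \<Psi>_tensor[OF that(1-4)] that(5,6) unfolding Thick_iff by metis
  show "f1 \<otimes>\<^sub>a f2 \<in> Thick C (X1 \<otimes>\<^sub>o X2) (Y1 \<otimes>\<^sub>o Y2)"
    by (rule Thick_tensor) (use o f in auto)
  show g12: "g1 \<otimes>\<^sub>a g2 \<in> Thick C (Y1 \<otimes>\<^sub>o Y2) (X1 \<otimes>\<^sub>o X2)"
    by (rule Thick_tensor) (use o g in auto)
  obtain Z1 t1 b1 where T1: "(Z1, t1, b1) \<in> triples C X1 Y1" "f1 = \<Psi> C X1 Y1 (Z1, t1, b1)"
    using f(1) by (auto simp: Thick_iff simp del: \<Psi>.simps)
  obtain Z2 t2 b2 where T2: "(Z2, t2, b2) \<in> triples C X2 Y2" "f2 = \<Psi> C X2 Y2 (Z2, t2, b2)"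
    using f(2) by (auto simp: Thick_iff simp del: \<Psi>.simps)
  note gH = Thick_Hom[OF o(2,1) g(1)] Thick_Hom[OF o(4,3) g(2)]
  note [simp] = o triplesD[OF T1(1)] triplesD[OF T2(1)] HomD[OF gH(1)] HomD[OF gH(2)]
    HomD[OF triplesD(2)[OF T1(1)]] HomD[OF triplesD(3)[OF T1(1)]]
    HomD[OF triplesD(2)[OF T2(1)]] HomD[OF triplesD(3)[OF T2(1)]] s_eq
  have tr1: "trace_pairing C s X1 Y1 f1 g1 = (b1 \<cdot> (Z1 \<triangleright> g1)) \<cdot> (s Y1 Z1 \<cdot> t1)"
    using sw.trace_pairing_eq[OF o(1,2) T1(1) g(1)] sw.switch_arr[OF o(2), of Z1]
    by (simp add: T1(2) del: \<Psi>.simps)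
  have tr2: "trace_pairing C s X2 Y2 f2 g2 = (b2 \<cdot> (Z2 \<triangleright> g2)) \<cdot> (s Y2 Z2 \<cdot> t2)"
    using sw.trace_pairing_eq[OF o(3,4) T2(1) g(2)] sw.switch_arr[OF o(4), of Z2]
    by (simp add: T2(2) del: \<Psi>.simps)
  let ?tc = "tensor_cup Y1 Z1 t1 Y2 Z2 t2"
  note [simp] = HomD[OF tensor_cup_Hom[of Y1 Z1 Y2 Z2 t1 t2]] HomD[OF tensor_cap_Hom[of X1 Z1 X2 Z2 b1 b2]]
  have s12: "s (Y1 \<otimes>\<^sub>o Y2) (Z2 \<otimes>\<^sub>o Z1) \<in> Hom C ((Y1 \<otimes>\<^sub>o Y2) \<otimes>\<^sub>o (Z2 \<otimes>\<^sub>o Z1)) ((Z2 \<otimes>\<^sub>o Z1) \<otimes>\<^sub>o (Y1 \<otimes>\<^sub>o Y2))"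
    by (rule sw.switch_in) simp_all
  have "trace_pairing C s (X1 \<otimes>\<^sub>o X2) (Y1 \<otimes>\<^sub>o Y2) (f1 \<otimes>\<^sub>a f2) (g1 \<otimes>\<^sub>a g2)
    = tensor_cap Z1 X1 b1 Z2 X2 b2 \<cdot> (((Z2 \<otimes>\<^sub>o Z1) \<triangleright> (g1 \<otimes>\<^sub>a g2)) \<cdot> (s (Y1 \<otimes>\<^sub>o Y2) (Z2 \<otimes>\<^sub>o Z1) \<cdot> ?tc))"
    unfolding T1(2) T2(2) \<Psi>_tensor(2)[OF o T1(1) T2(1), symmetric]
    by (rule sw.trace_pairing_eq[OF _ _ \<Psi>_tensor(1)[OF o T1(1) T2(1)] g12]) simp_all
  also have "\<dots> = (tensor_cap Z1 X1 b1 Z2 X2 b2 \<cdot> ((Z2 \<otimes>\<^sub>o Z1) \<triangleright> (g1 \<otimes>\<^sub>a g2)))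
      \<cdot> (s (Y1 \<otimes>\<^sub>o Y2) (Z2 \<otimes>\<^sub>o Z1) \<cdot> ?tc)"
    using HomD[OF s12] by (simp del: s_eq)
  also have "\<dots> = tensor_cap Z1 Y1 (b1 \<cdot> (Z1 \<triangleright> g1)) Z2 Y2 (b2 \<cdot> (Z2 \<triangleright> g2))
      \<cdot> (twisted_braiding (Y1 \<otimes>\<^sub>o Y2) (Z2 \<otimes>\<^sub>o Z1) \<cdot> ?tc)"
    by (simp add: tensor_cap_precomp[OF _ _ _ _ _ _ gH])
  also have "\<dots> = ((b2 \<cdot> (Z2 \<triangleright> g2)) \<cdot> (twisted_braiding Y2 Z2 \<cdot> t2)) \<cdot> ((b1 \<cdot> (Z1 \<triangleright> g1))
    \<cdot> (twisted_braiding Y1 Z1 \<cdot> t1))"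
    by (rule twisted_trace_tensor) (simp_all add: Hom_iff switching_twisted_braiding)
  also have "\<dots> = trace_pairing C s X2 Y2 f2 g2 \<cdot> trace_pairing C s X1 Y1 f1 g1"
    unfolding tr1 tr2 by simp
  also have "\<dots> = trace_pairing C s X1 Y1 f1 g1 \<cdot> trace_pairing C s X2 Y2 f2 g2"
    by (rule scalars_commute) (use o f g in \<open>auto intro: sw.trace_pairing_Hom\<close>)
  finally show "trace_pairing C s (X1 \<otimes>\<^sub>o X2) (Y1 \<otimes>\<^sub>o Y2) (f1 \<otimes>\<^sub>a f2) (g1 \<otimes>\<^sub>a g2)
      = trace_pairing C s X1 Y1 f1 g1 \<cdot> trace_pairing C s X2 Y2 f2 g2" .
qed

end

section \<open>Additive categories\<close>

context additive_category
begin

abbreviation add (infixl "\<oplus>" 60)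
  where "f \<oplus> g \<equiv> add_arr f g"

lemma add_Hom: "f \<in> Hom C X Y \<Longrightarrow> g \<in> Hom C X Y \<Longrightarrow> f \<oplus> g \<in> Hom C X Y"
  using comm_groupE(1)[OF hom_comm_group] Hom_obj by (fastforce simp: hom_group_def)

lemma zero_Hom: "X \<in> Obj C \<Longrightarrow> Y \<in> Obj C \<Longrightarrow> zero_arr X Y \<in> Hom C X Y"
  using comm_groupE(2)[OF hom_comm_group] by (fastforce simp: hom_group_def)

lemma add_zero:
  assumes "f \<in> Hom C X Y"
  shows "zero_arr X Y \<oplus> f = f" "f \<oplus> zero_arr X Y = f"
proof -
  interpret G: comm_group "hom_group C add_arr zero_arr X Y"
    using hom_comm_group Hom_obj[OF assms] by blast
  show "zero_arr X Y \<oplus> f = f" "f \<oplus> zero_arr X Y = f"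
    using G.l_one[of f] G.r_one[of f] assms by (simp_all add: hom_group_def)
qed

lemma add_idem_zero:
  assumes "f \<in> Hom C X Y" "f \<oplus> f = f"
  shows "f = zero_arr X Y"
proof -
  interpret G: comm_group "hom_group C add_arr zero_arr X Y"
    using hom_comm_group Hom_obj[OF assms(1)] by blast
  show ?thesis
    using G.r_cancel_one[of f f] assms by (simp add: hom_group_def)
qed

lemma zero_Comp:
  assumes "f \<in> Hom C X Y" "Z \<in> Obj C"
  shows "zero_arr Y Z \<cdot> f = zero_arr X Z"
proof (rule add_idem_zero)
  have z: "zero_arr Y Z \<in> Hom C Y Z"
    using zero_Hom assms Hom_obj by blast
  show "zero_arr Y Z \<cdot> f \<in> Hom C X Z"
    using assms z Comp_in by blast
  show "zero_arr Y Z \<cdot> f \<oplus> zero_arr Y Z \<cdot> f = zero_arr Y Z \<cdot> f"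
    using Comp_plus_left[OF assms(1) z z] add_zero[OF z] by simp
qed

lemma Comp_zero:
  assumes "f \<in> Hom C X Y" "W \<in> Obj C"
  shows "f \<cdot> zero_arr W X = zero_arr W Y"
proof (rule add_idem_zero)
  have z: "zero_arr W X \<in> Hom C W X"
    using zero_Hom assms Hom_obj by blast
  show "f \<cdot> zero_arr W X \<in> Hom C W Y"
    using assms z Comp_in by blast
  show "f \<cdot> zero_arr W X \<oplus> f \<cdot> zero_arr W X = f \<cdot> zero_arr W X"
    using Comp_plus_right[OF z z assms(1)] add_zero[OF z] by simp
qed

lemma biproduct_coproduct:
  assumes o: "X1 \<in> Obj C" "X2 \<in> Obj C"
  obtains P i1 i2 p1 p2 where "coproduct C X1 X2 P i1 i2" "p1 \<in> Hom C P X1" "p2 \<in> Hom C P X2"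
    "p1 \<cdot> i1 = Id C X1" "p2 \<cdot> i2 = Id C X2" "p2 \<cdot> i1 = zero_arr X1 X2" "p1 \<cdot> i2 = zero_arr X2 X1"
proof -
  obtain P i1 i2 p1 p2 where P: "P \<in> Obj C" and i: "i1 \<in> Hom C X1 P" "i2 \<in> Hom C X2 P"
    and p: "p1 \<in> Hom C P X1" "p2 \<in> Hom C P X2"
    and eq: "p1 \<cdot> i1 = Id C X1" "p2 \<cdot> i2 = Id C X2" "p2 \<cdot> i1 = zero_arr X1 X2" "p1 \<cdot> i2 = zero_arr X2 X1"
    and sum: "(i1 \<cdot> p1) \<oplus> (i2 \<cdot> p2) = Id C P"
    using biproducts[OF o] by blast
  have "\<exists>!h. h \<in> Hom C P Y \<and> h \<cdot> i1 = f1 \<and> h \<cdot> i2 = f2"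
    if Y: "Y \<in> Obj C" and f: "f1 \<in> Hom C X1 Y" "f2 \<in> Hom C X2 Y" for Y f1 f2
  proof
    have fp: "f1 \<cdot> p1 \<in> Hom C P Y" "f2 \<cdot> p2 \<in> Hom C P Y"
      using f p Comp_in by blast+
    have "((f1 \<cdot> p1) \<oplus> (f2 \<cdot> p2)) \<cdot> i1 = f1 \<cdot> (p1 \<cdot> i1) \<oplus> f2 \<cdot> (p2 \<cdot> i1)"
      unfolding Comp_plus_left[OF i(1) fp] using Comp_assoc[OF i(1) p(1) f(1)] Comp_assoc[OF i(1) p(2) f(2)] by simp
    moreover have "((f1 \<cdot> p1) \<oplus> (f2 \<cdot> p2)) \<cdot> i2 = f1 \<cdot> (p1 \<cdot> i2) \<oplus> f2 \<cdot> (p2 \<cdot> i2)"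
      unfolding Comp_plus_left[OF i(2) fp] using Comp_assoc[OF i(2) p(1) f(1)] Comp_assoc[OF i(2) p(2) f(2)] by simp
    ultimately show "(f1 \<cdot> p1) \<oplus> (f2 \<cdot> p2) \<in> Hom C P Y
        \<and> ((f1 \<cdot> p1) \<oplus> (f2 \<cdot> p2)) \<cdot> i1 = f1 \<and> ((f1 \<cdot> p1) \<oplus> (f2 \<cdot> p2)) \<cdot> i2 = f2"
      using f fp add_Hom Comp_zero o add_zero by (simp add: eq Comp_Id_right)
  next
    fix h assume h: "h \<in> Hom C P Y \<and> h \<cdot> i1 = f1 \<and> h \<cdot> i2 = f2"
    then have hP: "h \<in> Hom C P Y" by blast
    have ip: "i1 \<cdot> p1 \<in> Hom C P P" "i2 \<cdot> p2 \<in> Hom C P P"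
      using i p Comp_in by blast+
    have "h = h \<cdot> ((i1 \<cdot> p1) \<oplus> (i2 \<cdot> p2))"
      using Comp_Id_right[OF hP] by (simp add: sum)
    also have "\<dots> = (h \<cdot> i1) \<cdot> p1 \<oplus> (h \<cdot> i2) \<cdot> p2"
      unfolding Comp_plus_right[OF ip hP] using Comp_assoc[OF p(1) i(1) hP] Comp_assoc[OF p(2) i(2) hP] by simp
    finally show "h = (f1 \<cdot> p1) \<oplus> (f2 \<cdot> p2)"
      using h by simp
  qed
  then have "coproduct C X1 X2 P i1 i2"
    using o P i by (simp add: coproduct_def)
  then show thesis
    using that p eq by blast
qed

text \<open>A sum is \<open>f \<oplus> g = h \<cdot> (i1 \<oplus> i2)\<close> where \<open>h\<close> is the copairing of \<open>f\<close> and \<open>g\<close> on \<open>X \<oplus> X\<close>, so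
it suffices that the functor preserves \<open>i1 \<oplus> i2\<close>. It preserves zero morphisms, which factor
through an initial object, and therefore the biproduct equations; since the image of the
coproduct is again a coproduct, the images of injections and projections satisfy the remaining
equation \<open>i1 \<cdot> p1 \<oplus> i2 \<cdot> p2 = id\<close> too.\<close>

lemma coproduct_functor_additive:
  assumes F_Hom: "\<And>f X Y. f \<in> Hom C X Y \<Longrightarrow> Fa f \<in> Hom C (Fo X) (Fo Y)"
    and F_Id: "\<And>X. X \<in> Obj C \<Longrightarrow> Fa (Id C X) = Id C (Fo X)"
    and F_Comp: "\<And>f g X Y Z. f \<in> Hom C X Y \<Longrightarrow> g \<in> Hom C Y Z \<Longrightarrow> Fa (g \<cdot> f) = Fa g \<cdot> Fa f"
    and F_initial: "\<And>N. initial C N \<Longrightarrow> initial C (Fo N)"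
    and F_coproduct: "\<And>X1 X2 P i1 i2. coproduct C X1 X2 P i1 i2
      \<Longrightarrow> coproduct C (Fo X1) (Fo X2) (Fo P) (Fa i1) (Fa i2)"
    and f: "f \<in> Hom C X Y" and g: "g \<in> Hom C X Y"
  shows "Fa (f \<oplus> g) = Fa f \<oplus> Fa g"
proof -
  have X: "X \<in> Obj C" and Y: "Y \<in> Obj C"
    using Hom_obj[OF f] by auto
  have F_obj: "Fo A \<in> Obj C" if "A \<in> Obj C" for A
    using Hom_obj F_Hom[OF Id_in[OF that]] by blast
  obtain N where N: "initial C N" "terminal C N"
    using zero_object by blast
  then have NO: "N \<in> Obj C"
    by (simp add: initial_def)
  have F_zero: "Fa (zero_arr X X) = zero_arr (Fo X) (Fo X)"
  proof -
    have z: "zero_arr X N \<in> Hom C X N" "zero_arr N X \<in> Hom C N X"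
      using zero_Hom NO X by auto
    have "Fa (zero_arr N X) = zero_arr (Fo N) (Fo X)"
      using F_initial[OF N(1)] F_obj[OF X] F_Hom[OF z(2)] zero_Hom[OF F_obj[OF NO] F_obj[OF X]]
      unfolding initial_def by blast
    then show ?thesis
      using F_Comp[OF z] zero_Comp[OF z(1) X] zero_Comp[OF F_Hom[OF z(1)] F_obj[OF X]] by simp
  qed
  obtain P i1 i2 p1 p2 where cop: "coproduct C X X P i1 i2"
    and p: "p1 \<in> Hom C P X" "p2 \<in> Hom C P X"
    and eq: "p1 \<cdot> i1 = Id C X" "p2 \<cdot> i2 = Id C X" "p2 \<cdot> i1 = zero_arr X X" "p1 \<cdot> i2 = zero_arr X X"
    by (rule biproduct_coproduct[OF X X])
  then have P: "P \<in> Obj C" and i: "i1 \<in> Hom C X P" "i2 \<in> Hom C X P"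
    by (auto simp: coproduct_def)
  have "\<exists>!h. h \<in> Hom C P Y \<and> h \<cdot> i1 = f \<and> h \<cdot> i2 = g"
    using cop Y f g by (simp add: coproduct_def)
  then obtain h where h: "h \<in> Hom C P Y" "h \<cdot> i1 = f" "h \<cdot> i2 = g"
    by blast
  note FH = F_Hom[OF i(1)] F_Hom[OF i(2)] F_Hom[OF p(1)] F_Hom[OF p(2)]
  \<comment> \<open>The candidate for the identity of \<open>Fo P\<close>; it agrees with it on both injections.\<close>
  define e where "e = Fa i1 \<cdot> Fa p1 \<oplus> Fa i2 \<cdot> Fa p2"
  have ip: "Fa i1 \<cdot> Fa p1 \<in> Hom C (Fo P) (Fo P)" "Fa i2 \<cdot> Fa p2 \<in> Hom C (Fo P) (Fo P)"
    using FH Comp_in by blast+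
  have e_Comp: "e \<cdot> Fa k = Fa i1 \<cdot> Fa (p1 \<cdot> k) \<oplus> Fa i2 \<cdot> Fa (p2 \<cdot> k)" if k: "k \<in> Hom C X P" for k
    unfolding e_def Comp_plus_left[OF F_Hom[OF k] ip]
    using Comp_assoc[OF F_Hom[OF k] FH(3,1)] Comp_assoc[OF F_Hom[OF k] FH(4,2)] F_Comp[OF k p(1)] F_Comp[OF k p(2)]
    by simp
  have "e = Id C (Fo P)"
  proof -
    have "coproduct C (Fo X) (Fo X) (Fo P) (Fa i1) (Fa i2)"
      by (rule F_coproduct[OF cop])
    then have "\<exists>!h. h \<in> Hom C (Fo P) (Fo P) \<and> h \<cdot> Fa i1 = Fa i1 \<and> h \<cdot> Fa i2 = Fa i2"
      using F_obj[OF P] FH by (simp add: coproduct_def)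
    moreover have "e \<in> Hom C (Fo P) (Fo P)"
      unfolding e_def by (rule add_Hom[OF ip])
    moreover have "e \<cdot> Fa i1 = Fa i1" "e \<cdot> Fa i2 = Fa i2"
      using e_Comp[OF i(1)] e_Comp[OF i(2)] FH F_obj[OF X] X
      by (simp_all add: eq F_zero F_Id Comp_Id_right Comp_zero add_zero)
    moreover have "Id C (Fo P) \<in> Hom C (Fo P) (Fo P)" "Id C (Fo P) \<cdot> Fa i1 = Fa i1" "Id C (Fo P) \<cdot> Fa i2
      = Fa i2"
      using Id_in F_obj[OF P] FH Comp_Id_left by auto
    ultimately show ?thesis by blast
  qed
  have sum: "i1 \<oplus> i2 \<in> Hom C X P"
    using i by (rule add_Hom)
  have "Fa (i1 \<oplus> i2) = e \<cdot> Fa (i1 \<oplus> i2)"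
    using \<open>e = Id C (Fo P)\<close> Comp_Id_left[OF F_Hom[OF sum]] by simp
  also have "\<dots> = Fa i1 \<oplus> Fa i2"
    unfolding e_Comp[OF sum] Comp_plus_right[OF i p(1)] Comp_plus_right[OF i p(2)]
    using add_zero[OF Id_in[OF X]] FH X by (simp add: eq F_Id Comp_Id_right)
  finally have F_sum: "Fa (i1 \<oplus> i2) = Fa i1 \<oplus> Fa i2" .
  have "Fa (f \<oplus> g) = Fa (h \<cdot> (i1 \<oplus> i2))"
    unfolding Comp_plus_right[OF i h(1)] by (simp add: h)
  also have "\<dots> = Fa h \<cdot> (Fa i1 \<oplus> Fa i2)"
    using F_Comp[OF sum h(1)] F_sum by simp
  also have "\<dots> = Fa f \<oplus> Fa g"
    unfolding Comp_plus_right[OF FH(1,2) F_Hom[OF h(1)]]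
    using F_Comp[OF i(1) h(1)] F_Comp[OF i(2) h(1)] by (simp add: h)
  finally show ?thesis .
qed

end

locale additive_monoidal_category = monoidal_category C + additive_category C add_arr zero_arr
  for C :: "('o, 'm, 'x) moncat_scheme" (structure) and add_arr zero_arr +
  assumes distributive: "distributive C"
begin

lemma lwhisker_add:
  assumes "W \<in> Obj C" "f \<in> Hom C X Y" "g \<in> Hom C X Y"
  shows "W \<triangleright> (f \<oplus> g) = (W \<triangleright> f) \<oplus> (W \<triangleright> g)"
  using assms(2,3)
proof (rule coproduct_functor_additive[where Fo = "\<lambda>X. W \<otimes>\<^sub>o X" and Fa = "\<lambda>f. W \<triangleright> f", rotated -2])
  show "W \<triangleright> f \<in> Hom C (W \<otimes>\<^sub>o X) (W \<otimes>\<^sub>o Y)" if "f \<in> Hom C X Y" for f X Y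
    using assms(1) that by (simp add: Hom_iff)
  show "W \<triangleright> (g \<cdot> f) = (W \<triangleright> g) \<cdot> (W \<triangleright> f)" if "f \<in> Hom C X Y" "g \<in> Hom C Y Z" for f g X Y Z
    using assms(1) HomD[OF that(1)] HomD[OF that(2)] by (simp add: whisker)
qed (use assms(1) distributive in \<open>auto simp: distributive_def\<close>)

lemma rwhisker_add:
  assumes "W \<in> Obj C" "f \<in> Hom C X Y" "g \<in> Hom C X Y"
  shows "(f \<oplus> g) \<triangleleft> W = (f \<triangleleft> W) \<oplus> (g \<triangleleft> W)"
  using assms(2,3)
proof (rule coproduct_functor_additive[where Fo = "\<lambda>X. X \<otimes>\<^sub>o W" and Fa = "\<lambda>f. f \<triangleleft> W", rotated -2])
  show "f \<triangleleft> W \<in> Hom C (X \<otimes>\<^sub>o W) (Y \<otimes>\<^sub>o W)" if "f \<in> Hom C X Y" for f X Y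
    using assms(1) that by (simp add: Hom_iff)
  show "(g \<cdot> f) \<triangleleft> W = (g \<triangleleft> W) \<cdot> (f \<triangleleft> W)" if "f \<in> Hom C X Y" "g \<in> Hom C Y Z" for f g X Y Z
    using assms(1) HomD[OF that(1)] HomD[OF that(2)] by (simp add: whisker)
qed (use assms(1) distributive in \<open>auto simp: distributive_def\<close>)

lemma add_closed [simp]:
  assumes "f \<in> Arr C" "g \<in> Arr C" "Dom C f = Dom C g" "Cod C f = Cod C g"
  shows "f \<oplus> g \<in> Arr C" "Dom C (f \<oplus> g) = Dom C g" "Cod C (f \<oplus> g) = Cod C g"
  using add_Hom[of f "Dom C g" "Cod C g" g] assms by (auto simp: Hom_def)

lemma Comp_add:
  assumes "f \<in> Arr C" "f' \<in> Arr C" "Dom C f = Dom C f'" "Cod C f = Cod C f'"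
  shows "g \<in> Arr C \<Longrightarrow> Dom C g = Cod C f' \<Longrightarrow> g \<cdot> (f \<oplus> f') = g \<cdot> f \<oplus> g \<cdot> f'"
    and "h \<in> Arr C \<Longrightarrow> Cod C h = Dom C f' \<Longrightarrow> (f \<oplus> f') \<cdot> h = f \<cdot> h \<oplus> f' \<cdot> h"
  using Comp_plus_right[of f "Dom C f'" "Cod C f'" f' g "Cod C g"]
    Comp_plus_left[of h "Dom C h" "Dom C f'" f "Cod C f'" f'] assms
  by (auto simp: Hom_def)

lemma \<Psi>_add:
  assumes o: "X \<in> Obj C" "Y \<in> Obj C" "Z \<in> Obj C"
    and t: "t \<in> Hom C \<I> (Y \<otimes>\<^sub>o Z)" "t' \<in> Hom C \<I> (Y \<otimes>\<^sub>o Z)" and b: "b \<in> Hom C (Z \<otimes>\<^sub>o X) \<I>"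
  shows "\<Psi> C X Y (Z, t \<oplus> t', b) = \<Psi> C X Y (Z, t, b) \<oplus> \<Psi> C X Y (Z, t', b)"
  using o HomD[OF t(1)] HomD[OF t(2)] HomD[OF b]
  by (simp add: rwhisker_add[OF _ t] Comp_add)

text \<open>Along the injections, both representatives can be moved to the coproduct \<open>P\<close> of their
middle objects, where the caps combine to a single \<open>b\<close> since \<open>P \<otimes> X\<close> is a coproduct. Now only
the cups differ, and \<open>\<Psi>\<close> is additive in the cup.\<close>

lemma Thick_add:
  assumes o: "X \<in> Obj C" "Y \<in> Obj C" and f: "f1 \<in> Thick C X Y" "f2 \<in> Thick C X Y"
  shows "f1 \<oplus> f2 \<in> Thick C X Y"
proof -
  obtain Z1 t1 b1 where T1: "(Z1, t1, b1) \<in> triples C X Y" "f1 = \<Psi> C X Y (Z1, t1, b1)"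
    using f(1) by (auto simp: Thick_iff simp del: \<Psi>.simps)
  obtain Z2 t2 b2 where T2: "(Z2, t2, b2) \<in> triples C X Y" "f2 = \<Psi> C X Y (Z2, t2, b2)"
    using f(2) by (auto simp: Thick_iff simp del: \<Psi>.simps)
  note [simp] = o triplesD[OF T1(1)] triplesD[OF T2(1)]
  obtain P i1 i2 where cop: "coproduct C Z1 Z2 P i1 i2"
    using biproduct_coproduct[of Z1 Z2] by (metis triplesD(1) T1(1) T2(1))
  then have P: "P \<in> Obj C" and i: "i1 \<in> Hom C Z1 P" "i2 \<in> Hom C Z2 P"
    by (auto simp: coproduct_def)
  have "coproduct C (Z1 \<otimes>\<^sub>o X) (Z2 \<otimes>\<^sub>o X) (P \<otimes>\<^sub>o X) (i1 \<triangleleft> X) (i2 \<triangleleft> X)"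
    using distributive cop o by (simp add: distributive_def)
  moreover have "\<I> \<in> Obj C" by simp
  ultimately obtain b where b: "b \<in> Hom C (P \<otimes>\<^sub>o X) \<I>" "b \<cdot> (i1 \<triangleleft> X) = b1" "b \<cdot> (i2 \<triangleleft> X) = b2"
    using triplesD(3)[OF T1(1)] triplesD(3)[OF T2(1)] unfolding coproduct_def by blast
  have t: "(Y \<triangleright> i1) \<cdot> t1 \<in> Hom C \<I> (Y \<otimes>\<^sub>o P)" "(Y \<triangleright> i2) \<cdot> t2 \<in> Hom C \<I> (Y \<otimes>\<^sub>o P)"
    using HomD[OF i(1)] HomD[OF i(2)] HomD[OF triplesD(2)[OF T1(1)]] HomD[OF triplesD(2)[OF T2(1)]]
    by (simp_all add: Hom_iff)
  have "f1 = \<Psi> C X Y (P, (Y \<triangleright> i1) \<cdot> t1, b)"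
    unfolding T1(2)
    by (rule triple_step_\<Psi>[OF o]) (use T1(1) P i b t in \<open>auto simp: triples_def\<close>)
  moreover have "f2 = \<Psi> C X Y (P, (Y \<triangleright> i2) \<cdot> t2, b)"
    unfolding T2(2)
    by (rule triple_step_\<Psi>[OF o]) (use T2(1) P i b t in \<open>auto simp: triples_def\<close>)
  ultimately have "f1 \<oplus> f2 = \<Psi> C X Y (P, (Y \<triangleright> i1) \<cdot> t1 \<oplus> (Y \<triangleright> i2) \<cdot> t2, b)"
    using \<Psi>_add[OF o P t b(1)] by simp
  moreover have "(P, (Y \<triangleright> i1) \<cdot> t1 \<oplus> (Y \<triangleright> i2) \<cdot> t2, b) \<in> triples C X Y"
    using P b t add_Hom by (simp add: triples_def)
  ultimately show ?thesis
    unfolding Thick_iff by blast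
qed

text \<open>Thick morphisms form an ideal, so zero and negatives are obtained by composing with the
zero morphism and with the negative of the identity of \<open>Y\<close>.\<close>

lemma subgroup_Thick:
  assumes o: "X \<in> Obj C" "Y \<in> Obj C"
  shows "subgroup (Thick C X Y) (hom_group C add_arr zero_arr X Y)"
proof -
  interpret G: comm_group "hom_group C add_arr zero_arr X Y"
    using hom_comm_group o by blast
  interpret E: comm_group "hom_group C add_arr zero_arr Y Y"
    using hom_comm_group o by blast
  show ?thesis
  proof
    show "Thick C X Y \<subseteq> carrier (hom_group C add_arr zero_arr X Y)"
      using Thick_Hom[OF o] by (auto simp: hom_group_def)
    show "f \<otimes>\<^bsub>hom_group C add_arr zero_arr X Y\<^esub> g \<in> Thick C X Y"
      if "f \<in> Thick C X Y" "g \<in> Thick C X Y" for f g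
      using Thick_add[OF o that] by (simp add: hom_group_def)
    have "(\<I>, zero_arr \<I> (Y \<otimes>\<^sub>o \<I>), zero_arr (\<I> \<otimes>\<^sub>o X) \<I>) \<in> triples C X Y"
      using o zero_Hom by (simp add: triples_def)
    then obtain f where "f \<in> Thick C X Y"
      unfolding Thick_def by blast
    then have "zero_arr Y Y \<cdot> f \<in> Thick C X Y"
      using Thick_postcomp[OF o] zero_Hom[OF o(2) o(2)] by blast
    then show "\<one>\<^bsub>hom_group C add_arr zero_arr X Y\<^esub> \<in> Thick C X Y"
      using zero_Comp[OF Thick_Hom[OF o \<open>f \<in> Thick C X Y\<close>] o(2)] by (simp add: hom_group_def)
    show "inv\<^bsub>hom_group C add_arr zero_arr X Y\<^esub> f \<in> Thick C X Y" if f: "f \<in> Thick C X Y" for f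
    proof -
      note fH = Thick_Hom[OF o f]
      define n where "n = inv\<^bsub>hom_group C add_arr zero_arr Y Y\<^esub> (Id C Y)"
      have n: "n \<in> Hom C Y Y" "n \<oplus> Id C Y = zero_arr Y Y"
        using E.inv_closed[of "Id C Y"] E.l_inv[of "Id C Y"] Id_in[OF o(2)]
        by (simp_all add: n_def hom_group_def)
      have "n \<cdot> f \<oplus> f = zero_arr X Y"
        using Comp_plus_left[OF fH n(1) Id_in[OF o(2)]] Comp_Id_left[OF fH] zero_Comp[OF fH o(2)]
        by (simp add: n(2))
      then have "inv\<^bsub>hom_group C add_arr zero_arr X Y\<^esub> f = n \<cdot> f"
        using fH Comp_in[OF fH n(1)] by (intro G.inv_equality) (simp_all add: hom_group_def)
      then show ?thesis
        using Thick_postcomp[OF o f n(1)] by simp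
    qed
  qed
qed

lemma trace_pairing_add_right:
  assumes s: "switching C s" and o: "X \<in> Obj C" "Y \<in> Obj C"
    and f: "f \<in> Thick C X Y" and g: "g \<in> Thick C Y X" "g' \<in> Thick C Y X"
  shows "trace_pairing C s X Y f (g \<oplus> g') = trace_pairing C s X Y f g \<oplus> trace_pairing C s X Y f g'"
proof -
  interpret switching C s by fact
  obtain Z t b where T: "(Z, t, b) \<in> triples C X Y" "f = \<Psi> C X Y (Z, t, b)"
    using f by (auto simp: Thick_iff simp del: \<Psi>.simps)
  note gH = Thick_Hom[OF o(2,1) g(1)] Thick_Hom[OF o(2,1) g(2)]
  note eq = trace_pairing_eq[OF o T(1)]
  show ?thesis
    unfolding T(2) eq[OF g(1)] eq[OF g(2)] eq[OF Thick_add[OF o(2,1) g]]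
    using o triplesD(1)[OF T(1)] HomD[OF triplesD(2)[OF T(1)]] HomD[OF triplesD(3)[OF T(1)]]
      HomD[OF gH(1)] HomD[OF gH(2)]
    by (simp add: lwhisker_add[OF _ gH] Comp_add)
qed

theorem trace_pairing_bilinear:
  assumes s: "switching C s" and o: "X \<in> Obj C" "Y \<in> Obj C"
  shows "g \<in> Thick C Y X \<Longrightarrow> (\<lambda>f. trace_pairing C s X Y f g) \<in>
      hom (hom_group C add_arr zero_arr X Y\<lparr>carrier := Thick C X Y\<rparr>) (hom_group C add_arr zero_arr \<I> \<I>)"
    and "f \<in> Thick C X Y \<Longrightarrow> (\<lambda>g. trace_pairing C s X Y f g) \<in>
      hom (hom_group C add_arr zero_arr Y X\<lparr>carrier := Thick C Y X\<rparr>) (hom_group C add_arr zero_arr \<I> \<I>)"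
proof -
  interpret switching C s by fact
  show "(\<lambda>g. trace_pairing C s X Y f g) \<in>
      hom (hom_group C add_arr zero_arr Y X\<lparr>carrier := Thick C Y X\<rparr>) (hom_group C add_arr zero_arr \<I> \<I>)"
    if f: "f \<in> Thick C X Y"
    using trace_pairing_add_right[OF s o f] trace_pairing_Hom[OF o f]
    by (auto simp: hom_def hom_group_def)
  show "(\<lambda>f. trace_pairing C s X Y f g) \<in>
      hom (hom_group C add_arr zero_arr X Y\<lparr>carrier := Thick C X Y\<rparr>) (hom_group C add_arr zero_arr \<I> \<I>)"
    if g: "g \<in> Thick C Y X"
    using trace_pairing_add_right[OF s o(2,1) g] trace_pairing_Hom[OF o _ g]
      trace_pairing_sym[OF o _ g] Thick_add[OF o]
    by (auto simp: hom_def hom_group_def)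
qed

end

section \<open>Functoriality and properties of the trace pairing\<close>

theorem theorem1p10:
  fixes C :: "('o, 'm) moncat" (structure)
    and s :: "'o \<Rightarrow> 'o \<Rightarrow> 'm"
  assumes "monoidal_category C" and "switching C s"
  shows
    "(\<forall>X\<in>Obj C. \<forall>Y\<in>Obj C. \<forall>f\<in>Thick C X Y. \<forall>g\<in>Thick C Y X.
        trace_pairing C s X Y f g \<in> Hom C \<I> \<I>)
     \<and>
     (\<forall>(D :: ('p, 'n) moncat) s' FO FA \<phi> \<phi>\<^sub>0.
        monoidal_category D \<and> switching D s' \<and> strong_monoidal_functor C D FO FA \<phi> \<phi>\<^sub>0 \<and>
        switching_compatible C s D s' FO FA \<phi> \<longrightarrow>
        (\<forall>X\<in>Obj C. \<forall>Y\<in>Obj C. \<forall>f\<in>Thick C X Y. \<forall>g\<in>Thick C Y X.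
           FA f \<in> Thick D (FO X) (FO Y) \<and> FA g \<in> Thick D (FO Y) (FO X) \<and>
           inv_arr D \<phi>\<^sub>0 \<cdot>\<^bsub>D\<^esub> FA (trace_pairing C s X Y f g) \<cdot>\<^bsub>D\<^esub> \<phi>\<^sub>0 =
             trace_pairing D s' (FO X) (FO Y) (FA f) (FA g)))
     \<and>
     (\<forall>X\<in>Obj C. \<forall>Y\<in>Obj C. \<forall>f\<in>Thick C X Y. \<forall>g\<in>Thick C Y X.
        trace_pairing C s X Y f g = trace_pairing C s Y X g f \<and>
        (trace_property C s Y \<longrightarrow>
           f \<cdot> g \<in> Thick C Y Y \<and> trace_pairing C s X Y f g = trace C s Y (f \<cdot> g)) \<and>
        (trace_property C s X \<longrightarrow>
           g \<cdot> f \<in> Thick C X X \<and> trace_pairing C s X Y f g = trace C s X (g \<cdot> f)))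
     \<and>
     (\<forall>add_arr zero_arr. additive_category C add_arr zero_arr \<and> distributive C \<longrightarrow>
        (\<forall>X\<in>Obj C. \<forall>Y\<in>Obj C.
           subgroup (Thick C X Y) (hom_group C add_arr zero_arr X Y) \<and>
           (\<forall>g\<in>Thick C Y X. (\<lambda>f. trace_pairing C s X Y f g) \<in>
              hom (hom_group C add_arr zero_arr X Y\<lparr>carrier := Thick C X Y\<rparr>) (hom_group C add_arr zero_arr \<I> \<I>)) \<and>
           (\<forall>f\<in>Thick C X Y. (\<lambda>g. trace_pairing C s X Y f g) \<in>
              hom (hom_group C add_arr zero_arr Y X\<lparr>carrier := Thick C Y X\<rparr>) (hom_group C add_arr zero_arr \<I> \<I>))))
     \<and>
     (symmetric_monoidal_category C s \<or>
      (\<exists>c \<theta>. balanced_monoidal_category C c \<theta> \<and>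
         (\<forall>X\<in>Obj C. \<forall>Y\<in>Obj C. s X Y = (Id C Y \<otimes>\<^sub>a \<theta> X) \<cdot> c X Y)) \<longrightarrow>
        (\<forall>X1\<in>Obj C. \<forall>Y1\<in>Obj C. \<forall>X2\<in>Obj C. \<forall>Y2\<in>Obj C.
         \<forall>f1\<in>Thick C X1 Y1. \<forall>g1\<in>Thick C Y1 X1. \<forall>f2\<in>Thick C X2 Y2. \<forall>g2\<in>Thick C Y2 X2.
           f1 \<otimes>\<^sub>a f2 \<in> Thick C (X1 \<otimes>\<^sub>o X2) (Y1 \<otimes>\<^sub>o Y2) \<and>
           g1 \<otimes>\<^sub>a g2 \<in> Thick C (Y1 \<otimes>\<^sub>o Y2) (X1 \<otimes>\<^sub>o X2) \<and>
           trace_pairing C s (X1 \<otimes>\<^sub>o X2) (Y1 \<otimes>\<^sub>o Y2) (f1 \<otimes>\<^sub>a f2) (g1 \<otimes>\<^sub>a g2) =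
             trace_pairing C s X1 Y1 f1 g1 \<cdot> trace_pairing C s X2 Y2 f2 g2))"
proof -
  interpret switching C s by fact
  show ?thesis
  proof (intro conjI)
    show "\<forall>X\<in>Obj C. \<forall>Y\<in>Obj C. \<forall>f\<in>Thick C X Y. \<forall>g\<in>Thick C Y X.
        trace_pairing C s X Y f g \<in> Hom C \<I> \<I>"
      using trace_pairing_Hom by blast
  next
    show "\<forall>(D :: ('p, 'n) moncat) s' FO FA \<phi> \<phi>\<^sub>0.
        monoidal_category D \<and> switching D s' \<and> strong_monoidal_functor C D FO FA \<phi> \<phi>\<^sub>0 \<and>
        switching_compatible C s D s' FO FA \<phi> \<longrightarrow>
        (\<forall>X\<in>Obj C. \<forall>Y\<in>Obj C. \<forall>f\<in>Thick C X Y. \<forall>g\<in>Thick C Y X.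
           FA f \<in> Thick D (FO X) (FO Y) \<and> FA g \<in> Thick D (FO Y) (FO X) \<and>
           inv_arr D \<phi>\<^sub>0 \<cdot>\<^bsub>D\<^esub> FA (trace_pairing C s X Y f g) \<cdot>\<^bsub>D\<^esub> \<phi>\<^sub>0 =
             trace_pairing D s' (FO X) (FO Y) (FA f) (FA g))"
      using strong_monoidal_functor.F_Thick strong_monoidal_functor.F_trace_pairing assms(2) by metis
  next
    show "\<forall>X\<in>Obj C. \<forall>Y\<in>Obj C. \<forall>f\<in>Thick C X Y. \<forall>g\<in>Thick C Y X.
        trace_pairing C s X Y f g = trace_pairing C s Y X g f \<and>
        (trace_property C s Y \<longrightarrow>
           f \<cdot> g \<in> Thick C Y Y \<and> trace_pairing C s X Y f g = trace C s Y (f \<cdot> g)) \<and>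
        (trace_property C s X \<longrightarrow>
           g \<cdot> f \<in> Thick C X X \<and> trace_pairing C s X Y f g = trace C s X (g \<cdot> f))"
      using trace_pairing_sym trace_pairing_eq_trace Thick_precomp Thick_Hom by metis
  next
    show "\<forall>add_arr zero_arr. additive_category C add_arr zero_arr \<and> distributive C \<longrightarrow>
        (\<forall>X\<in>Obj C. \<forall>Y\<in>Obj C.
           subgroup (Thick C X Y) (hom_group C add_arr zero_arr X Y) \<and>
           (\<forall>g\<in>Thick C Y X. (\<lambda>f. trace_pairing C s X Y f g) \<in>
              hom (hom_group C add_arr zero_arr X Y\<lparr>carrier := Thick C X Y\<rparr>) (hom_group C add_arr zero_arr \<I> \<I>)) \<and>
           (\<forall>f\<in>Thick C X Y. (\<lambda>g. trace_pairing C s X Y f g) \<in>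
              hom (hom_group C add_arr zero_arr Y X\<lparr>carrier := Thick C Y X\<rparr>) (hom_group C add_arr zero_arr \<I> \<I>)))"
    proof (intro allI impI, elim conjE)
      fix add_arr zero_arr
      assume "additive_category C add_arr zero_arr" "distributive C"
      then interpret A: additive_monoidal_category C add_arr zero_arr
        by (simp add: additive_monoidal_category_def additive_monoidal_category_axioms_def assms(1))
      show "\<forall>X\<in>Obj C. \<forall>Y\<in>Obj C.
           subgroup (Thick C X Y) (hom_group C add_arr zero_arr X Y) \<and>
           (\<forall>g\<in>Thick C Y X. (\<lambda>f. trace_pairing C s X Y f g) \<in>
              hom (hom_group C add_arr zero_arr X Y\<lparr>carrier := Thick C X Y\<rparr>) (hom_group C add_arr zero_arr \<I> \<I>)) \<and>
           (\<forall>f\<in>Thick C X Y. (\<lambda>g. trace_pairing C s X Y f g) \<in>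
              hom (hom_group C add_arr zero_arr Y X\<lparr>carrier := Thick C Y X\<rparr>) (hom_group C add_arr zero_arr \<I> \<I>))"
        using A.subgroup_Thick A.trace_pairing_bilinear[OF assms(2)] by blast
    qed
  next
    show "symmetric_monoidal_category C s \<or>
      (\<exists>c \<theta>. balanced_monoidal_category C c \<theta> \<and>
         (\<forall>X\<in>Obj C. \<forall>Y\<in>Obj C. s X Y = (Id C Y \<otimes>\<^sub>a \<theta> X) \<cdot> c X Y)) \<longrightarrow>
        (\<forall>X1\<in>Obj C. \<forall>Y1\<in>Obj C. \<forall>X2\<in>Obj C. \<forall>Y2\<in>Obj C.
         \<forall>f1\<in>Thick C X1 Y1. \<forall>g1\<in>Thick C Y1 X1. \<forall>f2\<in>Thick C X2 Y2. \<forall>g2\<in>Thick C Y2 X2.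
           f1 \<otimes>\<^sub>a f2 \<in> Thick C (X1 \<otimes>\<^sub>o X2) (Y1 \<otimes>\<^sub>o Y2) \<and>
           g1 \<otimes>\<^sub>a g2 \<in> Thick C (Y1 \<otimes>\<^sub>o Y2) (X1 \<otimes>\<^sub>o X2) \<and>
           trace_pairing C s (X1 \<otimes>\<^sub>o X2) (Y1 \<otimes>\<^sub>o Y2) (f1 \<otimes>\<^sub>a f2) (g1 \<otimes>\<^sub>a g2) =
             trace_pairing C s X1 Y1 f1 g1 \<cdot> trace_pairing C s X2 Y2 f2 g2)"
    proof
      assume hyp: "symmetric_monoidal_category C s \<or>
        (\<exists>c \<theta>. balanced_monoidal_category C c \<theta> \<and>
           (\<forall>X\<in>Obj C. \<forall>Y\<in>Obj C. s X Y = (Id C Y \<otimes>\<^sub>a \<theta> X) \<cdot> c X Y))"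
      \<comment> \<open>The symmetric case is the balanced case with trivial twists.\<close>
      have "s X Y = (Id C Y \<otimes>\<^sub>a Id C X) \<cdot> s X Y" if "X \<in> Obj C" "Y \<in> Obj C" for X Y
        using that by simp
      with hyp obtain c \<theta> where bal: "balanced_monoidal_category C c \<theta>"
        and s_eq: "\<And>X Y. X \<in> Obj C \<Longrightarrow> Y \<in> Obj C \<Longrightarrow> s X Y = (Id C Y \<otimes>\<^sub>a \<theta> X) \<cdot> c X Y"
        unfolding symmetric_monoidal_category_def by metis
      interpret B: balanced_monoidal_category C c \<theta> by fact
      have s_eq': "s X Y = B.twisted_braiding X Y" if "X \<in> Obj C" "Y \<in> Obj C" for X Y
        using s_eq that by (simp add: B.twisted_braiding_def)
      show "\<forall>X1\<in>Obj C. \<forall>Y1\<in>Obj C. \<forall>X2\<in>Obj C. \<forall>Y2\<in>Obj C.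
         \<forall>f1\<in>Thick C X1 Y1. \<forall>g1\<in>Thick C Y1 X1. \<forall>f2\<in>Thick C X2 Y2. \<forall>g2\<in>Thick C Y2 X2.
           f1 \<otimes>\<^sub>a f2 \<in> Thick C (X1 \<otimes>\<^sub>o X2) (Y1 \<otimes>\<^sub>o Y2) \<and>
           g1 \<otimes>\<^sub>a g2 \<in> Thick C (Y1 \<otimes>\<^sub>o Y2) (X1 \<otimes>\<^sub>o X2) \<and>
           trace_pairing C s (X1 \<otimes>\<^sub>o X2) (Y1 \<otimes>\<^sub>o Y2) (f1 \<otimes>\<^sub>a f2) (g1 \<otimes>\<^sub>a g2) =
             trace_pairing C s X1 Y1 f1 g1 \<cdot> trace_pairing C s X2 Y2 f2 g2"
        by (intro ballI conjI; rule B.trace_pairing_tensor[OF assms(2) s_eq'])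
    qed
  qed
qed

end
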